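(* Let $X$ be a finite set, $E\subset X\times X$ such that the directed graph $(X,E)$ is strongly connected, and $\Sigma=\{x\in X^{\mathbb N_0}:(x_n,x_{n+1})\in E\ \forall n\}$ the associated transitive topological Markov shift. Let $J\subset\mathbb R$ be an open interval and assume: (1) for each $t\in J$, $P(t)=(P_{ij}(t))_{i,j\in X}$ is a row-stochastic matrix with $P_{ij}(t)>0$ if and only if $(i,j)\in E$, and $t\mapsto P_{ij}(t)$ is real analytic for all $i,j$; (2) for each $i\in X$, $t\mapsto A_i(t)\in\mathrm{GL}_2(\mathbb R)$ is real analytic on $J$. If $t_0\in J$ and the family $\{A_i(t_0)\}_{i\in X}$ is projectively uniformly hyperbolic with respect to $\Sigma$, then $t\mapsto\lambda_+\big(A(t),P(t)\big)$ is real analytic on a neighborhood of $t_0$.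
   Context: For an irreducible row-stochastic $P$ on $X$ with stationary probability vector $p$, $\mu$ is the Markov measure on $\Sigma$ with $\mu([i_0,\dots,i_n])=p_{i_0}P_{i_0i_1}\cdots P_{i_{n-1}i_n}$, and for $\{A_i\}\subset\mathrm{GL}_2(\mathbb R)$, $\lambda_+(A,P)$ is the $\mu$-a.e. constant value of $\lim_n\frac1n\log\|A_{x_{n-1}}\cdots A_{x_0}\|$. Projective uniform hyperbolicity w.r.t. $\Sigma$: on $\widehat\Sigma=\{(x_n)_{n\in\mathbb Z}:(x_n,x_{n+1})\in E\ \forall n\}$ with left shift $\widehat\sigma$ there is a continuous splitting $\mathbb R^2=E^d(\hat x)\oplus E^w(\hat x)$ into one-dimensional subspaces with $A_{x_0}E^*(\hat x)=E^*(\widehat\sigma\hat x)$ ($*=d,w$), and some $n\ge1$ with $\|A_{x_{n-1}}\cdots A_{x_0}|_{E^w(\hat x)}\|<\|A_{x_{n-1}}\cdots A_{x_0}|_{E^d(\hat x)}\|$ for every $\hat x\in\widehat\Sigma$. *)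

theory Defs
  imports "HOL-Analysis.Analysis" "HOL-Probability.Probability"
begin

definition real_analytic_on :: "(real \<Rightarrow> real) \<Rightarrow> real set \<Rightarrow> bool" where
  "real_analytic_on f S \<longleftrightarrow>
     (\<forall>x\<in>S. \<exists>r>0. \<exists>c::nat \<Rightarrow> real.
        \<forall>y. \<bar>y - x\<bar> < r \<longrightarrow> (\<lambda>n. c n * (y - x) ^ n) sums f y)"

fun mprod :: "('a \<Rightarrow> real^2^2) \<Rightarrow> (nat \<Rightarrow> 'a) \<Rightarrow> nat \<Rightarrow> real^2^2" where
  "mprod A x 0 = mat 1"
| "mprod A x (Suc n) = A (x n) ** mprod A x n"

definition mnorm :: "real^2^2 \<Rightarrow> real" where
  "mnorm M = onorm (\<lambda>v. M *v v)"

definition stationary_vec :: "('a::finite \<Rightarrow> 'a \<Rightarrow> real) \<Rightarrow> ('a \<Rightarrow> real) \<Rightarrow> bool" where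
  "stationary_vec P p \<longleftrightarrow> (\<forall>i. p i \<ge> 0) \<and> (\<Sum>i\<in>UNIV. p i) = 1 \<and>
     (\<forall>j. (\<Sum>i\<in>UNIV. p i * P i j) = p j)"

text \<open>The Markov measure with initial vector p and transition matrix P on one-sided sequences
  (with the product sigma algebra); it is concentrated on Sigma.\<close>
definition markov_measure ::
  "('a::finite \<Rightarrow> 'a \<Rightarrow> real) \<Rightarrow> ('a \<Rightarrow> real) \<Rightarrow> (nat \<Rightarrow> 'a) measure \<Rightarrow> bool" where
  "markov_measure P p \<mu> \<longleftrightarrow>
     sets \<mu> = sets (PiM UNIV (\<lambda>_. count_space (UNIV :: 'a set))) \<and> prob_space \<mu> \<and>
     (\<forall>n (w::nat \<Rightarrow> 'a). measure \<mu> {x. \<forall>k\<le>n. x k = w k} =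
        p (w 0) * (\<Prod>k<n. P (w k) (w (Suc k))))"

definition lyap_exp :: "('a::finite \<Rightarrow> real^2^2) \<Rightarrow> ('a \<Rightarrow> 'a \<Rightarrow> real) \<Rightarrow> real" where
  "lyap_exp A P = (THE L. \<exists>p \<mu>. stationary_vec P p \<and> markov_measure P p \<mu> \<and>
       (AE x in \<mu>. (\<lambda>n. ln (mnorm (mprod A x n)) / real n) \<longlonglongrightarrow> L))"

definition two_sided :: "('a \<times> 'a) set \<Rightarrow> (int \<Rightarrow> 'a) set" where
  "two_sided E = {x. \<forall>n. (x n, x (n + 1)) \<in> E}"

definition shift2 :: "(int \<Rightarrow> 'a) \<Rightarrow> (int \<Rightarrow> 'a)" where
  "shift2 x = (\<lambda>n. x (n + 1))"

definition line_dist :: "(real^2) set \<Rightarrow> (real^2) set \<Rightarrow> real" where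
  "line_dist L M = Inf {norm (u - v) | u v. u \<in> L \<and> v \<in> M \<and> norm u = 1 \<and> norm v = 1}"

definition is_line :: "(real^2) set \<Rightarrow> bool" where
  "is_line L \<longleftrightarrow> subspace L \<and> dim L = 1"

text \<open>Continuity of a line field on the two-sided shift (product of discrete topologies).\<close>
definition cont_line_field :: "('a \<times> 'a) set \<Rightarrow> ((int \<Rightarrow> 'a) \<Rightarrow> (real^2) set) \<Rightarrow> bool" where
  "cont_line_field E F \<longleftrightarrow>
     (\<forall>x\<in>two_sided E. \<forall>\<epsilon>>0. \<exists>N::nat. \<forall>y\<in>two_sided E.
        (\<forall>k. \<bar>k\<bar> \<le> int N \<longrightarrow> y k = x k) \<longrightarrow> line_dist (F y) (F x) < \<epsilon>)"

definition restr_norm :: "real^2^2 \<Rightarrow> (real^2) set \<Rightarrow> real" where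
  "restr_norm M L = Sup {norm (M *v v) | v. v \<in> L \<and> norm v = 1}"

definition proj_unif_hyp :: "('a \<times> 'a) set \<Rightarrow> ('a \<Rightarrow> real^2^2) \<Rightarrow> bool" where
  "proj_unif_hyp E A \<longleftrightarrow>
     (\<exists>Ed Ew. (\<forall>x\<in>two_sided E. is_line (Ed x) \<and> is_line (Ew x) \<and>
                  Ed x \<inter> Ew x = {0} \<and> span (Ed x \<union> Ew x) = UNIV \<and>
                  (\<lambda>v. A (x 0) *v v) ` Ed x = Ed (shift2 x) \<and>
                  (\<lambda>v. A (x 0) *v v) ` Ew x = Ew (shift2 x)) \<and>
        cont_line_field E Ed \<and> cont_line_field E Ew \<and>
        (\<exists>n\<ge>1. \<forall>x\<in>two_sided E.
           restr_norm (mprod A (\<lambda>k. x (int k)) n) (Ew x)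
             < restr_norm (mprod A (\<lambda>k. x (int k)) n) (Ed x)))"

end

theory Submission
  imports Defs "HOL-Library.Discrete_Functions" "HOL-Complex_Analysis.Cauchy_Integral_Formula"
begin

text \<open>
  The splitting at \<open>t\<^sub>0\<close> provides, for every letter \<open>i\<close>, a vector \<open>v i\<close> in the dominant line of a sequence
  passing through \<open>i\<close> and a vector \<open>om i\<close> in the weak line of one. Dominant lines depend only on the
  past and weak lines only on the future, so along an admissible word \<open>u = i\<^sub>0 \<dots> i\<^sub>n\<close> the number
  \<open>g u = det (A\<^bsub>i\<^sub>n\<^sub>-\<^sub>1\<^esub> \<dots> A\<^bsub>i\<^sub>0\<^esub> v i\<^sub>0, om i\<^sub>n)\<close> is comparable with the norm of the product. A cone argument
  shows that this, and the exponential smallness of the determinant relative to \<open>(g u)\<^sup>2\<close>, survive on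
  a complex neighbourhood of \<open>t\<^sub>0\<close>.

  The expected value of \<open>ln \<bar>g (i\<^sub>0 \<dots> i\<^sub>n) / g (i\<^sub>0 \<dots> i\<^sub>n\<^sub>-\<^sub>1)\<bar>\<close> tends to the Lyapunov exponent. By stationarity its
  increment in \<open>n\<close> is the expected logarithm of the cross ratio
  \<open>g (i\<^sub>0 \<dots> i\<^sub>n) g (i\<^sub>1 \<dots> i\<^sub>n\<^sub>-\<^sub>1) / (g (i\<^sub>1 \<dots> i\<^sub>n) g (i\<^sub>0 \<dots> i\<^sub>n\<^sub>-\<^sub>1))\<close>, which is \<open>1 + O(\<kappa>\<^sup>n)\<close> with \<open>\<kappa> < 1\<close>. For complex parameters
  the transition weights of words grow at most like \<open>R\<^sup>n\<close> with \<open>R\<close> close to \<open>1\<close>, so the series of increments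
  converges uniformly and its sum is holomorphic.
\<close>

section \<open>Planar determinants and products along words\<close>

text \<open>At complex parameters there is no probability measure and no holomorphic norm, so the
  extension cannot be sought as an almost sure limit. The vectors \<open>v i\<close> and
  \<open>om i\<close> are taken at \<open>t0\<close> and never move with the parameter, which keeps
  each \<open>g u\<close> holomorphic; perturbed invariant lines are never constructed. The
  telescoping identity is proved at real parameters alone; at complex ones the series is the
  definition of the extension. Cross ratios near 1 admit the principal logarithm, while the starting
  mean needs a branch of \<open>ln g\<close> on a disc, whose real part does not depend on the
  branch. The determinant is measured against \<open>(g u)^2\<close> because a Pluecker identity
  writes the cross ratio minus 1 as a middle determinant, times bounded factors, over a product of
  two values of \<open>g\<close>. The cone argument wants contraction at every letter, but the
  hypothesis gives it only after a block; an adapted rescaling of the weak vectors closes this gap.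
  The growth rate \<open>R\<close> is fixed after the contraction rate, so that their product is
  below 1.\<close>

definition det2 :: "'b::comm_ring_1^2 \<Rightarrow> 'b^2 \<Rightarrow> 'b" where
  "det2 x y = x $ 1 * y $ 2 - x $ 2 * y $ 1"

lemma det2_self [simp]: "det2 x x = 0"
  by (simp add: det2_def mult.commute)

lemma det2_add_left: "det2 (x + y) z = det2 x z + det2 y z"
  and det2_add_right: "det2 z (x + y) = det2 z x + det2 z y"
  and det2_smult_left: "det2 (c *s x) z = c * det2 x z"
  and det2_smult_right: "det2 z (c *s x) = c * det2 z x"
  and det2_diff_left: "det2 (x - y) z = det2 x z - det2 y z"
  and det2_diff_right: "det2 z (x - y) = det2 z x - det2 z y"
  by (simp_all add: det2_def algebra_simps)

lemmas det2_simps = det2_add_left det2_add_right det2_smult_left det2_smult_right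
  det2_diff_left det2_diff_right

lemma det2_commute: "det2 y x = - det2 x y"
  by (simp add: det2_def algebra_simps)

lemma det2_mult: "det2 (M *v x) (M *v y) = det M * det2 x y"
  by (simp add: det2_def det_2 matrix_vector_mult_def sum_2 algebra_simps)

text \<open>Cramer's rule in the frame \<open>(d, w)\<close>, cleared of denominators so that it is
  a polynomial identity over any commutative ring.\<close>

lemma det2_expand: "det2 d w *s x = det2 x w *s d + det2 d x *s w"
  by (simp add: vec_eq_iff forall_2 det2_def algebra_simps)

lemma norm_det2_le: "norm (det2 x y) \<le> 2 * norm x * norm y" for x y :: "'b::real_normed_field^2"
proof -
  have "norm (x $ 1 * y $ 2) \<le> norm x * norm y" "norm (x $ 2 * y $ 1) \<le> norm x * norm y"
    by (auto simp: norm_mult intro!: mult_mono Finite_Cartesian_Product.norm_nth_le)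
  then show ?thesis
    using norm_triangle_ineq4[of "x $ 1 * y $ 2" "x $ 2 * y $ 1"] unfolding det2_def by linarith
qed

lemma abs_det2_le: "\<bar>det2 x y\<bar> \<le> 2 * norm x * norm y" for x y :: "real^2"
  using norm_det2_le[of x y] by simp

fun word_prod :: "('a \<Rightarrow> 'b::comm_semiring_1^2^2) \<Rightarrow> 'a list \<Rightarrow> 'b^2^2" where
  "word_prod A [] = mat 1"
| "word_prod A (i # u) = word_prod A u ** A i"

lemma word_prod_append: "word_prod A (u @ v) = word_prod A v ** word_prod A u"
  by (induction u) (simp_all add: matrix_mul_assoc)

lemma mprod_eq_word_prod: "mprod A x n = word_prod A (map x [0..<n])"
  by (induction n) (simp_all add: word_prod_append)

section \<open>Compactness of the two-sided shift\<close>

definition shiftz :: "int \<Rightarrow> (int \<Rightarrow> 'a) \<Rightarrow> int \<Rightarrow> 'a" where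
  "shiftz m x = (\<lambda>n. x (n + m))"

definition agree :: "nat \<Rightarrow> (int \<Rightarrow> 'a) \<Rightarrow> (int \<Rightarrow> 'a) \<Rightarrow> bool" where
  "agree N x y \<longleftrightarrow> (\<forall>k. \<bar>k\<bar> \<le> int N \<longrightarrow> y k = x k)"

lemma agree_mono: "agree N x y \<Longrightarrow> M \<le> N \<Longrightarrow> agree M x y"
  by (auto simp: agree_def)

lemma shiftz_shiftz [simp]: "shiftz m (shiftz n x) = shiftz (m + n) x"
  by (simp add: shiftz_def ac_simps)

lemma shiftz_zero [simp]: "shiftz 0 x = x"
  by (simp add: shiftz_def)

lemma shift2_shiftz: "shift2 (shiftz m x) = shiftz (m + 1) x"
  by (simp add: shift2_def shiftz_def ac_simps)

lemma shiftz_two_sided [simp]: "shiftz m x \<in> two_sided E \<longleftrightarrow> x \<in> two_sided E"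
proof -
  have "(\<forall>n. (x (n + m), x (n + 1 + m)) \<in> E) \<longleftrightarrow> (\<forall>n. (x n, x (n + 1)) \<in> E)"
  proof (intro iffI allI)
    fix n assume *: "\<forall>n. (x (n + m), x (n + 1 + m)) \<in> E"
    show "(x n, x (n + 1)) \<in> E"
      using *[rule_format, of "n - m"] by (simp add: diff_add_eq)
  next
    fix n assume *: "\<forall>n. (x n, x (n + 1)) \<in> E"
    show "(x (n + m), x (n + 1 + m)) \<in> E"
      using *[rule_format, of "n + m"] by (simp add: add.commute add.left_commute)
  qed
  then show ?thesis
    unfolding two_sided_def shiftz_def mem_Collect_eq .
qed

text \<open>The shift space is closed in a product of finite discrete spaces, hence compact.
  Finitely many cylinders cover it, and \<open>N0\<close> is the largest of their radii.\<close>

lemma two_sided_covering: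
  fixes E :: "('a::finite \<times> 'a) set"
  assumes "\<And>x. x \<in> two_sided E \<Longrightarrow> \<exists>N. B N x"
  obtains N0 where "\<And>y. y \<in> two_sided E \<Longrightarrow> \<exists>x\<in>two_sided E. \<exists>N\<le>N0. B N x \<and> agree N x y"
proof -
  define T :: "(int \<Rightarrow> 'a) topology" where "T = product_topology (\<lambda>_. discrete_topology UNIV) UNIV"
  define cyl where "cyl N x = {y :: int \<Rightarrow> 'a. agree N x y}" for N x
  have top: "topspace T = UNIV"
    by (simp add: T_def)
  have cyl_eq: "cyl N x = PiE UNIV (\<lambda>k. if \<bar>k\<bar> \<le> int N then {x k} else UNIV)" for N x
    by (auto simp: cyl_def agree_def PiE_def Pi_def split: if_splits)
  have op: "openin T (cyl N x)" for N x
  proof -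
    have "finite {k :: int. (if \<bar>k\<bar> \<le> int N then {x k} else UNIV) \<noteq> (UNIV :: 'a set)}"
      by (rule finite_subset[of _ "{- int N..int N}"]) (auto split: if_splits)
    then show ?thesis
      unfolding T_def cyl_eq by (intro product_topology_basis[rotated]) (auto)
  qed
  \<comment> \<open>A forbidden transition at \<open>n\<close> is visible on the window of radius
    \<open>\<bar>n\<bar> + 1\<close>, which contains both \<open>n\<close> and
    \<open>n + 1\<close>.\<close>
  have "openin T (- two_sided E)"
  proof (subst openin_subopen, intro ballI)
    fix x assume "x \<in> - two_sided E"
    then obtain n where n: "(x n, x (n + 1)) \<notin> E"
      by (auto simp: two_sided_def)
    have "cyl (nat (\<bar>n\<bar> + 1)) x \<subseteq> - two_sided E"
    proof
      fix y assume "y \<in> cyl (nat (\<bar>n\<bar> + 1)) x"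
      then have "y n = x n" "y (n + 1) = x (n + 1)"
        by (auto simp: cyl_def agree_def)
      with n have "(y n, y (n + 1)) \<notin> E"
        by (simp only: not_False_eq_True)
      then show "y \<in> - two_sided E"
        unfolding two_sided_def by blast
    qed
    moreover have "x \<in> cyl (nat (\<bar>n\<bar> + 1)) x"
      by (simp add: cyl_def agree_def)
    ultimately show "\<exists>U. openin T U \<and> x \<in> U \<and> U \<subseteq> - two_sided E"
      using op by blast
  qed
  then have cl: "closedin T (two_sided E)"
    by (simp add: closedin_def top Compl_eq_Diff_UNIV)
  have "compact_space T"
    by (simp add: T_def compact_space_product_topology compact_space_discrete_topology)
  then have comp: "compactin T (two_sided E)"
    using cl by (simp add: closedin_compact_space)
  obtain N where N: "\<And>x. x \<in> two_sided E \<Longrightarrow> B (N x) x"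
    using assms by metis
  define U where "U = (\<lambda>x. cyl (N x) x) ` two_sided E"
  have "\<forall>V\<in>U. openin T V" "two_sided E \<subseteq> \<Union>U"
    using op by (auto simp: U_def cyl_def agree_def)
  then obtain F where F: "finite F" "F \<subseteq> U" "two_sided E \<subseteq> \<Union>F"
    using comp unfolding compactin_def by blast
  obtain S where S: "S \<subseteq> two_sided E" "finite S" "F = (\<lambda>x. cyl (N x) x) ` S"
    using finite_subset_image[OF F(1) F(2)[unfolded U_def]] by blast
  show ?thesis
  proof (rule that[of "Max (insert 0 (N ` S))"])
    fix y assume "y \<in> two_sided E"
    then have "y \<in> (\<Union>x\<in>S. cyl (N x) x)"
      using F(3) unfolding S(3) by (rule subsetD[rotated])
    then obtain x where x: "x \<in> S" "agree (N x) x y"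
      by (auto simp: cyl_def)
    then have "x \<in> two_sided E" "B (N x) x" "N x \<le> Max (insert 0 (N ` S))"
      using S(1,2) N by auto
    with x show "\<exists>x\<in>two_sided E. \<exists>n\<le>Max (insert 0 (N ` S)). B n x \<and> agree n x y"
      by blast
  qed
qed

text \<open>In the covering lemma the radius \<open>N\<close> also serves as the bound: the property
  is \<open>f \<ge> 1 / (N + 1)\<close> on the cylinder of radius \<open>N\<close>. Bounded radii
  then keep \<open>f\<close> away from zero.\<close>

lemma two_sided_bounded_below:
  fixes f :: "(int \<Rightarrow> 'a::finite) \<Rightarrow> real"
  assumes cont: "\<And>x e. x \<in> two_sided E \<Longrightarrow> e > 0 \<Longrightarrow>
      \<exists>N. \<forall>y\<in>two_sided E. agree N x y \<longrightarrow> \<bar>f y - f x\<bar> < e"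
    and pos: "\<And>x. x \<in> two_sided E \<Longrightarrow> f x > 0"
  obtains \<delta> where "\<delta> > 0" "\<And>x. x \<in> two_sided E \<Longrightarrow> \<delta> \<le> f x"
proof -
  have ex: "\<exists>N. \<forall>y\<in>two_sided E. agree N x y \<longrightarrow> 1 / (real N + 1) \<le> f y"
    if x: "x \<in> two_sided E" for x
  proof -
    obtain N where N: "\<forall>y\<in>two_sided E. agree N x y \<longrightarrow> \<bar>f y - f x\<bar> < f x / 2"
      using cont[OF x] pos[OF x] half_gt_zero by blast
    obtain M :: nat where M: "2 / f x < real M"
      using reals_Archimedean2 by blast
    have "1 / (real (max N M) + 1) \<le> f x / 2"
    proof -
      have "2 / f x \<le> real (max N M) + 1"
        using M by linarith
      then have "2 \<le> (real (max N M) + 1) * f x"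
        using pos[OF x] by (simp add: field_simps)
      then show ?thesis
        by (simp add: field_simps)
    qed
    moreover have "f x / 2 \<le> f y" if "y \<in> two_sided E" "agree (max N M) x y" for y
    proof -
      have "\<bar>f y - f x\<bar> < f x / 2"
        using N that agree_mono[OF that(2), of N] by auto
      then show ?thesis
        by linarith
    qed
    ultimately show ?thesis
      by (intro exI[of _ "max N M"]) (meson order_trans)
  qed
  obtain N0 where N0: "\<And>y. y \<in> two_sided E \<Longrightarrow> \<exists>x\<in>two_sided E. \<exists>N\<le>N0.
      (\<forall>y\<in>two_sided E. agree N x y \<longrightarrow> 1 / (real N + 1) \<le> f y) \<and> agree N x y"
    using two_sided_covering[of E "\<lambda>N x. \<forall>y\<in>two_sided E. agree N x y \<longrightarrow> 1 / (real N + 1) \<le> f y"] ex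
    by metis
  show ?thesis
  proof (rule that[of "1 / (real N0 + 1)"])
    fix y assume y: "y \<in> two_sided E"
    then obtain N where "N \<le> N0" "1 / (real N + 1) \<le> f y"
      using N0[OF y] by blast
    moreover have "1 / (real N0 + 1) \<le> 1 / (real N + 1)"
      using \<open>N \<le> N0\<close> by (simp add: frac_le)
    ultimately show "1 / (real N0 + 1) \<le> f y"
      by linarith
  qed simp
qed

text \<open>Unit vectors on a line have no preferred sign, so closeness is up to a factor 1 or -1.
  Two points agreeing on a large window are compared through a common centre, and the signs
  multiply.\<close>

lemma two_sided_uniformly_continuous:
  fixes d :: "(int \<Rightarrow> 'a::finite) \<Rightarrow> real^2"
  assumes cont: "\<And>x e. x \<in> two_sided E \<Longrightarrow> e > 0 \<Longrightarrow>
      \<exists>N. \<forall>y\<in>two_sided E. agree N x y \<longrightarrow> (\<exists>s\<in>{1,-1}. norm (d y - s *s d x) < e)"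
    and "e > 0"
  obtains N where "\<And>x y. x \<in> two_sided E \<Longrightarrow> y \<in> two_sided E \<Longrightarrow> agree N x y \<Longrightarrow>
      \<exists>s\<in>{1,-1}. norm (d y - s *s d x) < e"
proof -
  obtain N where N: "\<And>y. y \<in> two_sided E \<Longrightarrow> \<exists>x\<in>two_sided E. \<exists>n\<le>N.
     (\<forall>y\<in>two_sided E. agree n x y \<longrightarrow> (\<exists>s\<in>{1,-1}. norm (d y - s *s d x) < e / 2)) \<and> agree n x y"
    using two_sided_covering[of E "\<lambda>n x. \<forall>y\<in>two_sided E. agree n x y \<longrightarrow>
        (\<exists>s\<in>{1,-1}. norm (d y - s *s d x) < e / 2)"] cont half_gt_zero[OF \<open>e > 0\<close>] by (metis (lifting))
  show ?thesis
  proof (rule that)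
    fix x y assume x: "x \<in> two_sided E" and y: "y \<in> two_sided E" and xy: "agree N x y"
    obtain z n where z: "n \<le> N" "agree n z x"
      "\<forall>y\<in>two_sided E. agree n z y \<longrightarrow> (\<exists>s\<in>{1,-1}. norm (d y - s *s d z) < e / 2)"
      using N[OF x] by blast
    have "agree n z y"
      using z(1,2) xy by (auto simp: agree_def)
    then obtain s t :: real where st: "s \<in> {1,-1}" "t \<in> {1,-1}"
      "norm (d y - s *s d z) < e / 2" "norm (d x - t *s d z) < e / 2"
      using z x y by meson
    have "d y - (s * t) *s d x = (d y - s *s d z) - (s * t) *s (d x - t *s d z)"
      using st(2) by (auto simp: vec_eq_iff algebra_simps)
    also have "norm \<dots> \<le> norm (d y - s *s d z) + norm ((s * t) *s (d x - t *s d z))"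
      by (rule norm_triangle_ineq4)
    also have "norm ((s * t) *s (d x - t *s d z)) = norm (d x - t *s d z)"
      using st(1,2) by (auto simp: scalar_mult_eq_scaleR)
    finally show "\<exists>s\<in>{1,-1}. norm (d y - s *s d x) < e"
      using st by (intro bexI[of _ "s * t"]) auto
  qed
qed

section \<open>Dominated splittings\<close>

lemma norm_smult [simp]: "norm (c *s v) = \<bar>c\<bar> * norm v" for v :: "real^2"
  by (simp add: scalar_mult_eq_scaleR)

text \<open>Lines are represented by unit vectors with no control over their sign; this is why the
  continuity and dependence statements carry a factor 1 or -1.\<close>

locale dominated_splitting =
  fixes E :: "('a::finite \<times> 'a) set" and A :: "'a \<Rightarrow> real^2^2"
    and d w :: "(int \<Rightarrow> 'a) \<Rightarrow> real^2"
  assumes invertible: "invertible (A i)"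
    and norm_d [simp]: "x \<in> two_sided E \<Longrightarrow> norm (d x) = 1"
    and norm_w [simp]: "x \<in> two_sided E \<Longrightarrow> norm (w x) = 1"
    and det2_dw: "x \<in> two_sided E \<Longrightarrow> det2 (d x) (w x) \<noteq> 0"
    and equivariant_d: "x \<in> two_sided E \<Longrightarrow> \<exists>a. A (x 0) *v d x = a *s d (shift2 x)"
    and equivariant_w: "x \<in> two_sided E \<Longrightarrow> \<exists>a. A (x 0) *v w x = a *s w (shift2 x)"
    and cont_d: "x \<in> two_sided E \<Longrightarrow> e > 0 \<Longrightarrow>
      \<exists>N. \<forall>y\<in>two_sided E. agree N x y \<longrightarrow> (\<exists>s\<in>{1,-1}. norm (d y - s *s d x) < e)"
    and cont_w: "x \<in> two_sided E \<Longrightarrow> e > 0 \<Longrightarrow>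
      \<exists>N. \<forall>y\<in>two_sided E. agree N x y \<longrightarrow> (\<exists>s\<in>{1,-1}. norm (w y - s *s w x) < e)"
    and dominated: "\<exists>n\<ge>1. \<forall>x\<in>two_sided E. norm (mprod A (\<lambda>k. x (int k)) n *v w x)
                                         < norm (mprod A (\<lambda>k. x (int k)) n *v d x)"
begin

definition mult_d :: "(int \<Rightarrow> 'a) \<Rightarrow> real" where
  "mult_d x = (SOME a. A (x 0) *v d x = a *s d (shift2 x))"

definition mult_w :: "(int \<Rightarrow> 'a) \<Rightarrow> real" where
  "mult_w x = (SOME a. A (x 0) *v w x = a *s w (shift2 x))"

lemma mult_d: "x \<in> two_sided E \<Longrightarrow> A (x 0) *v d x = mult_d x *s d (shift2 x)"
  unfolding mult_d_def by (rule someI_ex) (rule equivariant_d)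

lemma mult_w: "x \<in> two_sided E \<Longrightarrow> A (x 0) *v w x = mult_w x *s w (shift2 x)"
  unfolding mult_w_def by (rule someI_ex) (rule equivariant_w)

definition M :: "(int \<Rightarrow> 'a) \<Rightarrow> nat \<Rightarrow> real^2^2" where
  "M x n = mprod A (\<lambda>k. x (int k)) n"

definition mult_d_n :: "(int \<Rightarrow> 'a) \<Rightarrow> nat \<Rightarrow> real" where
  "mult_d_n x n = (\<Prod>k<n. mult_d (shiftz (int k) x))"

definition mult_w_n :: "(int \<Rightarrow> 'a) \<Rightarrow> nat \<Rightarrow> real" where
  "mult_w_n x n = (\<Prod>k<n. mult_w (shiftz (int k) x))"

lemma shift2_two_sided [simp]: "shift2 x \<in> two_sided E \<longleftrightarrow> x \<in> two_sided E"
  using shift2_shiftz[of 0 x] by simp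

lemma M_d: "x \<in> two_sided E \<Longrightarrow> M x n *v d x = mult_d_n x n *s d (shiftz (int n) x)"
proof (induction n)
  case (Suc n)
  have "M x (Suc n) *v d x = A (x (int n)) *v (M x n *v d x)"
    by (simp add: M_def matrix_vector_mul_assoc)
  also have "\<dots> = mult_d_n x n *s (A (shiftz (int n) x 0) *v d (shiftz (int n) x))"
    using Suc by (simp add: vector_scalar_commute shiftz_def)
  also have "\<dots> = mult_d_n x (Suc n) *s d (shiftz (int (Suc n)) x)"
    using Suc.prems by (simp add: mult_d mult_d_n_def shift2_shiftz vector_smult_assoc add.commute)
  finally show ?case .
qed (simp add: M_def mult_d_n_def)

lemma M_w: "x \<in> two_sided E \<Longrightarrow> M x n *v w x = mult_w_n x n *s w (shiftz (int n) x)"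
proof (induction n)
  case (Suc n)
  have "M x (Suc n) *v w x = A (x (int n)) *v (M x n *v w x)"
    by (simp add: M_def matrix_vector_mul_assoc)
  also have "\<dots> = mult_w_n x n *s (A (shiftz (int n) x 0) *v w (shiftz (int n) x))"
    using Suc by (simp add: vector_scalar_commute shiftz_def)
  also have "\<dots> = mult_w_n x (Suc n) *s w (shiftz (int (Suc n)) x)"
    using Suc.prems by (simp add: mult_w mult_w_n_def shift2_shiftz vector_smult_assoc add.commute)
  finally show ?case .
qed (simp add: M_def mult_w_n_def)

text \<open>Since \<open>d x\<close> and \<open>w x\<close> are unit vectors, the modulus of a
  multiplier is the norm of \<open>A (x 0)\<close> applied to a unit vector. The finitely many
  matrices and their inverses bound it on both sides.\<close>

lemma multiplier_bounds:
  obtains c where "0 < c" "c \<le> 1" "\<And>x. x \<in> two_sided E \<Longrightarrow> c \<le> \<bar>mult_d x\<bar> \<and> \<bar>mult_d x\<bar> \<le> 1 / c \<and> c \<le> \<bar>mult_w x\<bar> \<and> \<bar>mult_w x\<bar> \<le> 1 / c"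
proof -
  obtain B where B: "\<And>i. B i ** A i = mat 1"
    using invertible unfolding invertible_def by metis
  define K where "K = 1 + (\<Sum>i\<in>UNIV. onorm ((*v) (A i)) + onorm ((*v) (B i)))"
  have nn: "0 \<le> onorm ((*v) X)" for X :: "real^2^2"
    by (intro onorm_pos_le matrix_vector_mul_bounded_linear)
  have K: "onorm ((*v) (A i)) \<le> K" "onorm ((*v) (B i)) \<le> K" for i
  proof -
    have "onorm ((*v) (A i)) + onorm ((*v) (B i)) \<le>
        (\<Sum>i\<in>UNIV. onorm ((*v) (A i)) + onorm ((*v) (B i)))"
      using nn by (intro member_le_sum) auto
    then show "onorm ((*v) (A i)) \<le> K" "onorm ((*v) (B i)) \<le> K"
      using nn[of "A i"] nn[of "B i"] by (auto simp: K_def)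
  qed
  have K1: "K \<ge> 1"
    using nn by (auto simp: K_def intro!: sum_nonneg add_nonneg_nonneg)
  have on: "norm (X *v v) \<le> onorm ((*v) X) * norm v" for X :: "real^2^2" and v
    by (rule onorm[OF matrix_vector_mul_bounded_linear])
  have up: "norm (A i *v v) \<le> K" if "norm v = 1" for v i
    using on[of "A i" v] K(1)[of i] that by simp
  have lo: "1 / K \<le> norm (A i *v v)" if "norm v = 1" for v i
  proof -
    have "v = B i *v (A i *v v)"
      by (simp add: matrix_vector_mul_assoc B)
    then have "1 \<le> onorm ((*v) (B i)) * norm (A i *v v)"
      using on[of "B i" "A i *v v"] that by simp
    also have "\<dots> \<le> K * norm (A i *v v)"
      using K(2)[of i] by (intro mult_right_mono) auto
    finally show ?thesis
      using K1 by (simp add: field_simps)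
  qed
  show ?thesis
  proof (rule that[of "1 / K"])
    fix x assume x: "x \<in> two_sided E"
    show "1 / K \<le> \<bar>mult_d x\<bar> \<and> \<bar>mult_d x\<bar> \<le> 1 / (1 / K) \<and> 1 / K \<le> \<bar>mult_w x\<bar> \<and> \<bar>mult_w x\<bar> \<le> 1 / (1 / K)"
      using up[of "d x" "x 0"] lo[of "d x" "x 0"] up[of "w x" "x 0"] lo[of "w x" "x 0"] x
      by (simp add: mult_d mult_w)
  qed (use K1 in auto)
qed

lemma mult_d_nz: "x \<in> two_sided E \<Longrightarrow> mult_d x \<noteq> 0" and mult_w_nz: "x \<in> two_sided E \<Longrightarrow> mult_w x \<noteq> 0"
  using multiplier_bounds by (metis abs_zero not_less)+

lemma mult_d_n_nz: "x \<in> two_sided E \<Longrightarrow> mult_d_n x n \<noteq> 0" and mult_w_n_nz: "x \<in> two_sided E \<Longrightarrow> mult_w_n x n \<noteq> 0"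
  by (simp_all add: mult_d_n_def mult_w_n_def mult_d_nz mult_w_nz)

text \<open>The modulus of the determinant does not see the sign choices, so it is a continuous
  positive function on a compact space.\<close>

lemma angle_bound:
  obtains \<delta> where "\<delta> > 0" "\<And>x. x \<in> two_sided E \<Longrightarrow> \<delta> \<le> \<bar>det2 (d x) (w x)\<bar>"
proof (rule two_sided_bounded_below[where E = E and f = "\<lambda>x. \<bar>det2 (d x) (w x)\<bar>"])
  fix x and e :: real assume x: "x \<in> two_sided E" and e: "e > 0"
  then have e4: "e / 4 > 0"
    by simp
  obtain N1 where N1: "\<forall>y\<in>two_sided E. agree N1 x y \<longrightarrow> (\<exists>s\<in>{1,-1}. norm (d y - s *s d x) < e / 4)"
    using cont_d[OF x e4] by blast
  obtain N2 where N2: "\<forall>y\<in>two_sided E. agree N2 x y \<longrightarrow> (\<exists>s\<in>{1,-1}. norm (w y - s *s w x) < e / 4)"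
    using cont_w[OF x e4] by blast
  show "\<exists>N. \<forall>y\<in>two_sided E. agree N x y \<longrightarrow> \<bar>\<bar>det2 (d y) (w y)\<bar> - \<bar>det2 (d x) (w x)\<bar>\<bar> < e"
  proof (intro exI[of _ "max N1 N2"] ballI impI)
    fix y assume y: "y \<in> two_sided E" and ag: "agree (max N1 N2) x y"
    obtain s t :: real where s: "s \<in> {1,-1}" "norm (d y - s *s d x) < e / 4"
      and t: "t \<in> {1,-1}" "norm (w y - t *s w x) < e / 4"
      using N1 N2 y ag by (meson agree_mono max.cobounded1 max.cobounded2)
    have "det2 (d y) (w y) - (s * t) * det2 (d x) (w x) =
       det2 (d y - s *s d x) (w y) + s * det2 (d x) (w y - t *s w x)"
      by (simp add: det2_simps algebra_simps)
    moreover have "\<bar>det2 (d y - s *s d x) (w y)\<bar> \<le> 2 * norm (d y - s *s d x) * norm (w y)"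
      by (rule abs_det2_le)
    moreover have "\<bar>s * det2 (d x) (w y - t *s w x)\<bar> \<le> 2 * norm (d x) * norm (w y - t *s w x)"
      using abs_det2_le[of "d x" "w y - t *s w x"] s(1) by auto
    ultimately have "\<bar>det2 (d y) (w y) - (s * t) * det2 (d x) (w x)\<bar> < e"
      using s(2) t(2) x y by simp
    moreover have "\<bar>(s * t) * det2 (d x) (w x)\<bar> = \<bar>det2 (d x) (w x)\<bar>"
      using s(1) t(1) by auto
    ultimately show "\<bar>\<bar>det2 (d y) (w y)\<bar> - \<bar>det2 (d x) (w x)\<bar>\<bar> < e"
      by linarith
  qed
qed (use det2_dw that in auto)

text \<open>Pointwise strict domination becomes a uniform ratio: compactness yields a gap \<delta>
  between the two norms, and the larger one is at most \<open>D\<close>, so the quotient is at most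
  \<open>1 - \<delta> / D\<close>.\<close>

lemma block_domination:
  obtains N \<kappa> where "N \<ge> 1" "0 < \<kappa>" "\<kappa> < 1"
    "\<And>x. x \<in> two_sided E \<Longrightarrow> \<bar>mult_w_n x N\<bar> \<le> \<kappa> * \<bar>mult_d_n x N\<bar>"
proof -
  obtain N where N: "N \<ge> 1" and dom: "\<And>x. x \<in> two_sided E \<Longrightarrow> norm (M x N *v w x) < norm (M x N *v d x)"
    using dominated unfolding M_def by blast
  have dom': "\<bar>mult_w_n x N\<bar> < \<bar>mult_d_n x N\<bar>" if "x \<in> two_sided E" for x
    using dom[OF that] that by (simp add: M_d M_w)
  have cont: "\<exists>n. \<forall>y\<in>two_sided E. agree n x y \<longrightarrow>
      \<bar>(norm (M y N *v d y) - norm (M y N *v w y)) - (norm (M x N *v d x) - norm (M x N *v w x))\<bar> < e"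
    if x: "x \<in> two_sided E" and e: "e > 0" for x e
  proof -
    define K where "K = onorm ((*v) (M x N)) + 1"
    have K: "norm (M x N *v v) \<le> K * norm v" for v
      using onorm[OF matrix_vector_mul_bounded_linear, of "M x N" v] unfolding K_def
      by (simp add: distrib_right add_increasing2)
    have Kpos: "K > 0"
      unfolding K_def by (simp add: add_nonneg_pos onorm_pos_le matrix_vector_mul_bounded_linear)
    then have e': "e / (2 * K) > 0"
      using e by simp
    obtain N1 where N1: "\<forall>y\<in>two_sided E. agree N1 x y \<longrightarrow> (\<exists>s\<in>{1,-1}. norm (d y - s *s d x) < e / (2 * K))"
      using cont_d[OF x e'] by blast
    obtain N2 where N2: "\<forall>y\<in>two_sided E. agree N2 x y \<longrightarrow> (\<exists>s\<in>{1,-1}. norm (w y - s *s w x) < e / (2 * K))"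
      using cont_w[OF x e'] by blast
    have near: "\<bar>norm (M x N *v u) - norm (M x N *v v)\<bar> < e / 2"
      if "s \<in> {1,-1}" "norm (u - s *s v) < e / (2 * K)" for s u v
    proof -
      have "norm (M x N *v (s *s v)) = norm (M x N *v v)"
        using that(1) by (auto simp: vector_scalar_commute)
      then have "\<bar>norm (M x N *v u) - norm (M x N *v v)\<bar> \<le> norm (M x N *v u - M x N *v (s *s v))"
        by (metis norm_triangle_ineq3)
      also have "\<dots> = norm (M x N *v (u - s *s v))"
        by (simp add: matrix_vector_mult_diff_distrib)
      also have "\<dots> \<le> K * norm (u - s *s v)"
        by (rule K)
      also have "\<dots> < K * (e / (2 * K))"
        using that(2) Kpos by (intro mult_strict_left_mono)
      also have "\<dots> = e / 2"
        using Kpos by simp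
      finally show ?thesis .
    qed
    show ?thesis
    \<comment> \<open>The radius is at least \<open>N\<close>, so that the two products coincide and
      only the vectors vary.\<close>
    proof (intro exI[of _ "max N (max N1 N2)"] ballI impI)
      fix y assume y: "y \<in> two_sided E" and ag: "agree (max N (max N1 N2)) x y"
      obtain s t :: real where s: "s \<in> {1,-1}" "norm (d y - s *s d x) < e / (2 * K)"
        and t: "t \<in> {1,-1}" "norm (w y - t *s w x) < e / (2 * K)"
        using N1 N2 y ag by (meson agree_mono max.cobounded1 max.cobounded2)
      have "M y N = M x N"
        unfolding M_def mprod_eq_word_prod
        by (intro arg_cong[where f = "word_prod A"] map_cong refl) (use ag in \<open>auto simp: agree_def\<close>)
      then show "\<bar>(norm (M y N *v d y) - norm (M y N *v w y)) - (norm (M x N *v d x) - norm (M x N *v w x))\<bar> < e"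
        using near[OF s] near[OF t] by (simp only:)
    qed
  qed
  obtain \<delta> where \<delta>: "\<delta> > 0" "\<And>x. x \<in> two_sided E \<Longrightarrow> \<delta> \<le> norm (M x N *v d x) - norm (M x N *v w x)"
    using two_sided_bounded_below[of E "\<lambda>x. norm (M x N *v d x) - norm (M x N *v w x)"] cont dom
    by (metis (lifting) diff_gt_0_iff_gt)
  obtain c where c: "0 < c" "c \<le> 1" "\<And>x. x \<in> two_sided E \<Longrightarrow> c \<le> \<bar>mult_d x\<bar> \<and> \<bar>mult_d x\<bar> \<le> 1 / c \<and> c \<le> \<bar>mult_w x\<bar> \<and> \<bar>mult_w x\<bar> \<le> 1 / c"
    by (rule multiplier_bounds) blast
  define D where "D = (1 / c) ^ N"
  have D: "\<bar>mult_d_n x N\<bar> \<le> D" if "x \<in> two_sided E" for x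
  proof -
    have "\<bar>mult_d_n x N\<bar> = (\<Prod>k<N. \<bar>mult_d (shiftz (int k) x)\<bar>)"
      by (simp add: mult_d_n_def abs_prod)
    also have "\<dots> \<le> (\<Prod>k<N. 1 / c)"
      using c(3) that by (intro prod_mono) auto
    finally show ?thesis
      by (simp add: D_def)
  qed
  have Dpos: "D > 0"
    using c by (simp add: D_def)
  show ?thesis
  \<comment> \<open>The maximum with 1/2 keeps the rate positive.\<close>
  proof (rule that[of N "max (1/2) (1 - \<delta> / D)"])
    fix x assume x: "x \<in> two_sided E"
    have "\<delta> \<le> \<bar>mult_d_n x N\<bar> - \<bar>mult_w_n x N\<bar>"
      using \<delta>(2)[OF x] x by (simp add: M_d M_w)
    moreover have "\<delta> / D * \<bar>mult_d_n x N\<bar> \<le> \<delta>"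
      using D[OF x] Dpos \<delta>(1) by (simp add: field_simps)
    ultimately have "\<bar>mult_w_n x N\<bar> \<le> (1 - \<delta> / D) * \<bar>mult_d_n x N\<bar>"
      by (simp add: algebra_simps)
    also have "\<dots> \<le> max (1/2) (1 - \<delta> / D) * \<bar>mult_d_n x N\<bar>"
      by (intro mult_right_mono) auto
    finally show "\<bar>mult_w_n x N\<bar> \<le> max (1/2) (1 - \<delta> / D) * \<bar>mult_d_n x N\<bar>" .
  qed (use N \<delta>(1) Dpos in auto)
qed

lemma mult_d_n_add: "mult_d_n x (m + n) = mult_d_n x m * mult_d_n (shiftz (int m) x) n"
  by (induction n) (simp_all add: mult_d_n_def add.commute mult.assoc)

lemma mult_w_n_add: "mult_w_n x (m + n) = mult_w_n x m * mult_w_n (shiftz (int m) x) n"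
  by (induction n) (simp_all add: mult_w_n_def add.commute mult.assoc)

lemma geometric_domination:
  obtains N \<kappa> where "N \<ge> 1" "0 < \<kappa>" "\<kappa> < 1"
    "\<And>x m. x \<in> two_sided E \<Longrightarrow> \<bar>mult_w_n x (m * N)\<bar> \<le> \<kappa> ^ m * \<bar>mult_d_n x (m * N)\<bar>"
proof -
  obtain N \<kappa> where N: "N \<ge> 1" "0 < \<kappa>" "\<kappa> < 1"
    and dom: "\<And>x. x \<in> two_sided E \<Longrightarrow> \<bar>mult_w_n x N\<bar> \<le> \<kappa> * \<bar>mult_d_n x N\<bar>"
    by (rule block_domination) blast
  have "\<bar>mult_w_n x (m * N)\<bar> \<le> \<kappa> ^ m * \<bar>mult_d_n x (m * N)\<bar>" if "x \<in> two_sided E" for x m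
  proof (induction m)
    case (Suc m)
    have "\<bar>mult_w_n x (m * N + N)\<bar> = \<bar>mult_w_n x (m * N)\<bar> * \<bar>mult_w_n (shiftz (int (m * N)) x) N\<bar>"
      by (subst mult_w_n_add) (simp add: abs_mult)
    also have "\<dots> \<le> (\<kappa> ^ m * \<bar>mult_d_n x (m * N)\<bar>) * (\<kappa> * \<bar>mult_d_n (shiftz (int (m * N)) x) N\<bar>)"
      using Suc dom that N by (intro mult_mono) auto
    also have "\<dots> = \<kappa> ^ Suc m * \<bar>mult_d_n x (m * N + N)\<bar>"
      by (subst mult_d_n_add) (simp add: abs_mult)
    finally show ?case
      by (simp add: add.commute)
  qed (simp add: mult_d_n_def mult_w_n_def)
  then show ?thesis
    using that N by blast
qed

end

section \<open>Dependence of the dominant line on the past and of the weak line on the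
  future\<close>

lemma unit_parallel:
  fixes x y :: "real^2"
  assumes "norm x = 1" "norm y = 1" "det2 x y = 0"
  obtains s where "s \<in> {1,-1}" "y = s *s x"
proof -
  have 1: "x $ 1 ^ 2 + x $ 2 ^ 2 = 1" and 2: "y $ 1 ^ 2 + y $ 2 ^ 2 = 1"
    using assms(1,2) by (simp_all add: norm_vec_def L2_set_def sum_2)
  have 3: "x $ 1 * y $ 2 = x $ 2 * y $ 1"
    using assms(3) by (simp add: det2_def)
  \<comment> \<open>The inner product; by Lagrange's identity its square plus the square of the
    determinant is 1, so it is a sign.\<close>
  define s where "s = x $ 1 * y $ 1 + x $ 2 * y $ 2"
  have "y $ 1 = s * x $ 1" "y $ 2 = s * x $ 2"
    unfolding s_def using 1 3 by algebra+
  moreover have "s\<^sup>2 = 1"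
    unfolding s_def using 1 2 3 by algebra
  ultimately show ?thesis
    by (intro that[of s]) (auto simp: vec_eq_iff forall_2 power2_eq_1_iff)
qed

lemma eventually_zero_of_domination:
  fixes P \<delta> \<kappa> :: real
  assumes "0 < \<kappa>" "\<kappa> < 1" "\<delta> > 0" "\<And>m. m \<ge> m0 \<Longrightarrow> \<bar>P\<bar> * \<delta> \<le> \<kappa> ^ m * 4"
  shows "P = 0"
proof -
  have "(\<lambda>m. \<kappa> ^ m * 4) \<longlonglongrightarrow> 0 * 4"
    using assms(1,2) by (intro tendsto_mult LIMSEQ_power_zero tendsto_const) auto
  then have "\<bar>P\<bar> * \<delta> \<le> 0 * 4"
    by (rule tendsto_lowerbound) (use assms(4) in \<open>auto simp: eventually_at_top_linorder\<close>)
  then show ?thesis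
    using assms(3) by (simp add: mult_le_0_iff)
qed

text \<open>The estimate that ends both dependence proofs. There \<open>a\<close> and
  \<open>b\<close> are the dominant and weak multipliers over \<open>m\<close> blocks,
  \<open>p\<close> and \<open>R\<close> are determinants of unit vectors, hence at most 2, and
  \<open>q\<close> is bounded below by transversality.\<close>

lemma domination_product:
  fixes a b P p q R :: real
  assumes "a * P * q = b * p * R" "a \<noteq> 0" "\<bar>b\<bar> \<le> \<kappa> ^ m * \<bar>a\<bar>" "\<bar>p\<bar> \<le> 2" "\<bar>R\<bar> \<le> 2" "\<delta> \<le> \<bar>q\<bar>"
  shows "\<bar>P\<bar> * \<delta> \<le> \<kappa> ^ m * 4"
proof -
  have "\<bar>a\<bar> * (\<bar>P\<bar> * \<delta>) \<le> \<bar>a\<bar> * (\<bar>P\<bar> * \<bar>q\<bar>)"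
    using assms by (intro mult_left_mono) auto
  also have "\<dots> = \<bar>b\<bar> * (\<bar>p\<bar> * \<bar>R\<bar>)"
    using arg_cong[OF assms(1), of abs] by (simp add: abs_mult)
  also have "\<dots> \<le> (\<kappa> ^ m * \<bar>a\<bar>) * (2 * 2)"
    using assms by (intro mult_mono) auto
  finally have "\<bar>a\<bar> * (\<bar>P\<bar> * \<delta>) \<le> \<bar>a\<bar> * (\<kappa> ^ m * 4)"
    by (simp add: algebra_simps)
  then show ?thesis
    using assms(2) by simp
qed

context dominated_splitting
begin

lemma M_cong: "(\<And>k. k < n \<Longrightarrow> x (int k) = y (int k)) \<Longrightarrow> M x n = M y n"
  unfolding M_def mprod_eq_word_prod by (intro arg_cong[where f = "word_prod A"] map_cong refl) auto

lemma det_M_nz: "x \<in> two_sided E \<Longrightarrow> det (M x n) \<noteq> 0"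
  using det2_mult[of "M x n" "d x" "w x"] mult_d_n_nz[of x n] mult_w_n_nz[of x n]
    det2_dw[of "shiftz (int n) x"]
  by (auto simp: M_d M_w det2_simps)

text \<open>Moving one vector by less than \<open>\<delta> / 4\<close> changes its determinant
  against a unit vector by at most \<open>\<delta> / 2\<close>, which leaves half of the angle
  bound.\<close>

lemma transversality_persists:
  obtains \<delta> N where "\<delta> > 0"
    "\<And>x y. x \<in> two_sided E \<Longrightarrow> y \<in> two_sided E \<Longrightarrow> agree N x y \<Longrightarrow> \<delta> \<le> \<bar>det2 (d y) (w x)\<bar>"
    "\<And>x y. x \<in> two_sided E \<Longrightarrow> y \<in> two_sided E \<Longrightarrow> agree N x y \<Longrightarrow> \<delta> \<le> \<bar>det2 (w y) (d x)\<bar>"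
proof -
  obtain \<delta> where \<delta>: "\<delta> > 0" "\<And>x. x \<in> two_sided E \<Longrightarrow> \<delta> \<le> \<bar>det2 (d x) (w x)\<bar>"
    using angle_bound by blast
  then have "\<delta> / 4 > 0"
    by simp
  obtain N1 where N1: "\<And>x y. x \<in> two_sided E \<Longrightarrow> y \<in> two_sided E \<Longrightarrow> agree N1 x y \<Longrightarrow>
      \<exists>s\<in>{1,-1}. norm (d y - s *s d x) < \<delta> / 4"
    using two_sided_uniformly_continuous[of E d, OF cont_d \<open>\<delta> / 4 > 0\<close>] by blast
  obtain N2 where N2: "\<And>x y. x \<in> two_sided E \<Longrightarrow> y \<in> two_sided E \<Longrightarrow> agree N2 x y \<Longrightarrow>
      \<exists>s\<in>{1,-1}. norm (w y - s *s w x) < \<delta> / 4"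
    using two_sided_uniformly_continuous[of E w, OF cont_w \<open>\<delta> / 4 > 0\<close>] by blast
  have near: "\<delta> / 2 \<le> \<bar>det2 u' v\<bar>"
    if "s \<in> {1,-1}" "norm (u' - s *s u) < \<delta> / 4" "\<delta> \<le> \<bar>det2 u v\<bar>" "norm v = 1" for s u u' v
  proof -
    have "s * det2 u v = det2 u' v - det2 (u' - s *s u) v"
      by (simp add: det2_simps)
    moreover have "\<bar>s * det2 u v\<bar> = \<bar>det2 u v\<bar>"
      using that(1) by auto
    moreover have "\<bar>det2 (u' - s *s u) v\<bar> \<le> \<delta> / 2"
      using abs_det2_le[of "u' - s *s u" v] that(2,4) by simp
    ultimately show ?thesis
      using that(3) by linarith
  qed
  show ?thesis
  proof (rule that[of "\<delta> / 2" "max N1 N2"])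
    fix x y assume x: "x \<in> two_sided E" and y: "y \<in> two_sided E" and ag: "agree (max N1 N2) x y"
    have ag: "agree N1 x y" "agree N2 x y"
      using agree_mono[OF ag] by auto
    show "\<delta> / 2 \<le> \<bar>det2 (d y) (w x)\<bar>"
      using N1[OF x y ag(1)] near[OF _ _ \<delta>(2)[OF x], of _ "d y"] norm_w[OF x] by blast
    have "\<delta> \<le> \<bar>det2 (w x) (d x)\<bar>"
      using \<delta>(2)[OF x] by (simp add: det2_commute[of "w x"])
    then show "\<delta> / 2 \<le> \<bar>det2 (w y) (d x)\<bar>"
      using N2[OF x y ag(2)] near[of _ "w y" "w x" "d x"] norm_d[OF x] by blast
  qed (use \<delta> in auto)
qed

text \<open>Read \<open>n\<close> steps earlier, both sequences agree on a large window around 0, so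
  \<open>d Y\<close> is transverse to \<open>w X\<close> there. One and the same matrix carries
  \<open>d X\<close> and \<open>d Y\<close> to the lines of \<open>d x\<close> and
  \<open>d y\<close>, and the component of \<open>d Y\<close> along \<open>w X\<close> shrinks
  relative to the dominant one. Letting \<open>n\<close> grow makes \<open>d x\<close> and
  \<open>d y\<close> parallel.\<close>

lemma d_depends_on_past:
  assumes x: "x \<in> two_sided E" and y: "y \<in> two_sided E" and past: "\<And>k. k < 0 \<Longrightarrow> y k = x k"
  obtains s where "s \<in> {1,-1}" "d y = s *s d x"
proof -
  obtain \<delta> Nu where \<delta>: "\<delta> > 0" and Nu: "\<And>x y. x \<in> two_sided E \<Longrightarrow> y \<in> two_sided E \<Longrightarrow>
      agree Nu x y \<Longrightarrow> \<delta> \<le> \<bar>det2 (d y) (w x)\<bar>"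
    using transversality_persists by metis
  obtain N \<kappa> where N: "N \<ge> 1" "0 < \<kappa>" "\<kappa> < 1" and
    dom: "\<And>x m. x \<in> two_sided E \<Longrightarrow> \<bar>mult_w_n x (m * N)\<bar> \<le> \<kappa> ^ m * \<bar>mult_d_n x (m * N)\<bar>"
    using geometric_domination by metis
  have "det2 (d x) (d y) = 0"
  proof (rule eventually_zero_of_domination[OF N(2,3) \<delta>])
    fix m assume m: "m \<ge> Suc Nu"
    define n where "n = m * N"
    have "Nu < m * N"
      using m N(1) by (metis Suc_le_eq less_le_trans mult.right_neutral mult_le_mono2)
    then have n: "int Nu < int n"
      by (simp only: n_def of_nat_less_iff)
    define X where "X = shiftz (- int n) x"
    define Y where "Y = shiftz (- int n) y"
    have XY: "X \<in> two_sided E" "Y \<in> two_sided E" "shiftz (int n) X = x" "shiftz (int n) Y = y"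
      using x y by (simp_all add: X_def Y_def)
    have "agree Nu X Y"
      using n past by (auto simp: agree_def X_def Y_def shiftz_def)
    then have q: "\<delta> \<le> \<bar>det2 (d Y) (w X)\<bar>"
      using Nu XY by blast
    have MXY: "M Y n = M X n"
      using past by (intro M_cong) (auto simp: X_def Y_def shiftz_def)
    define P where "P = det2 (d x) (d y)"
    define p where "p = det2 (d X) (d Y)"
    define Q where "Q = det2 (d Y) (w X)"
    define R where "R = det2 (d y) (w x)"
    have e1: "det (M X n) * p = mult_d_n X n * (mult_d_n Y n * P)"
      using det2_mult[of "M X n" "d X" "d Y"] M_d[OF XY(1), of n] M_d[OF XY(2), of n] XY MXY
      by (simp add: det2_simps P_def p_def)
    have e2: "det (M X n) * Q = mult_d_n Y n * (mult_w_n X n * R)"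
      using det2_mult[of "M X n" "d Y" "w X"] M_w[OF XY(1), of n] M_d[OF XY(2), of n] XY MXY
      by (simp add: det2_simps Q_def R_def mult.assoc mult.left_commute)
    \<comment> \<open>The quotient of \<open>e1\<close> and \<open>e2\<close>, in cross-multiplied
      form: \<open>det (M X n)\<close> and \<open>mult_d_n Y n\<close> cancel and the ratio of weak
      to dominant multipliers remains.\<close>
    have "(det (M X n) * mult_d_n Y n) * (mult_d_n X n * P * Q) = (det (M X n) * Q) * (mult_d_n X n * (mult_d_n Y n * P))"
      by (simp add: mult_ac)
    also have "\<dots> = (mult_d_n Y n * (mult_w_n X n * R)) * (det (M X n) * p)"
      by (simp only: e1 e2)
    also have "\<dots> = (det (M X n) * mult_d_n Y n) * (mult_w_n X n * p * R)"
      by (simp add: mult_ac)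
    finally have "mult_d_n X n * P * Q = mult_w_n X n * p * R"
      using det_M_nz[OF XY(1)] mult_d_n_nz[OF XY(2)] by simp
    then have "\<bar>P\<bar> * \<delta> \<le> \<kappa> ^ m * 4"
      by (rule domination_product)
        (use XY x y mult_d_n_nz[OF XY(1)] dom[OF XY(1), of m] q abs_det2_le[of "d X" "d Y"] abs_det2_le[of "d y" "w x"]
          in \<open>auto simp: n_def p_def R_def Q_def\<close>)
    then show "\<bar>det2 (d x) (d y)\<bar> * \<delta> \<le> \<kappa> ^ m * 4"
      by (simp add: P_def)
  qed
  then show ?thesis
    using unit_parallel[of "d x" "d y"] x y that by auto
qed

text \<open>The mirror image: \<open>n\<close> steps later the sequences agree on a large window. A
  component of \<open>w y\<close> along \<open>d x\<close> would be amplified against the weak one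
  and end up contradicting the transversality of \<open>w Y\<close> and \<open>d X\<close>.\<close>

lemma w_depends_on_future:
  assumes x: "x \<in> two_sided E" and y: "y \<in> two_sided E" and future: "\<And>k. k \<ge> 0 \<Longrightarrow> y k = x k"
  obtains s where "s \<in> {1,-1}" "w y = s *s w x"
proof -
  obtain \<delta> Nu where \<delta>: "\<delta> > 0" and Nu: "\<And>x y. x \<in> two_sided E \<Longrightarrow> y \<in> two_sided E \<Longrightarrow>
      agree Nu x y \<Longrightarrow> \<delta> \<le> \<bar>det2 (w y) (d x)\<bar>"
    using transversality_persists by metis
  obtain N \<kappa> where N: "N \<ge> 1" "0 < \<kappa>" "\<kappa> < 1" and
    dom: "\<And>x m. x \<in> two_sided E \<Longrightarrow> \<bar>mult_w_n x (m * N)\<bar> \<le> \<kappa> ^ m * \<bar>mult_d_n x (m * N)\<bar>"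
    using geometric_domination by metis
  have "det2 (w x) (w y) = 0"
  proof (rule eventually_zero_of_domination[OF N(2,3) \<delta>])
    fix m assume m: "m \<ge> Suc Nu"
    define n where "n = m * N"
    have "Nu < m * N"
      using m N(1) by (metis Suc_le_eq less_le_trans mult.right_neutral mult_le_mono2)
    then have n: "int Nu < int n"
      by (simp only: n_def of_nat_less_iff)
    define X where "X = shiftz (int n) x"
    define Y where "Y = shiftz (int n) y"
    have XY: "X \<in> two_sided E" "Y \<in> two_sided E"
      using x y by (simp_all add: X_def Y_def)
    have "agree Nu X Y"
      using n future by (auto simp: agree_def X_def Y_def shiftz_def)
    then have q: "\<delta> \<le> \<bar>det2 (w Y) (d X)\<bar>"
      using Nu XY by blast
    have MXY: "M y n = M x n"
      using future by (intro M_cong) auto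
    define P where "P = det2 (w x) (w y)"
    define p where "p = det2 (w X) (w Y)"
    define Q where "Q = det2 (w Y) (d X)"
    define R where "R = det2 (w y) (d x)"
    have e1: "det (M x n) * P = mult_w_n x n * (mult_w_n y n * p)"
      using det2_mult[of "M x n" "w x" "w y"] M_w[OF x, of n] M_w[OF y, of n] MXY
      by (simp add: det2_simps P_def p_def X_def Y_def)
    have e2: "det (M x n) * R = mult_w_n y n * (mult_d_n x n * Q)"
      using det2_mult[of "M x n" "w y" "d x"] M_d[OF x, of n] M_w[OF y, of n] MXY
      by (simp add: det2_simps Q_def R_def X_def Y_def mult.assoc mult.left_commute)
    have "(det (M x n) * mult_w_n y n) * (mult_d_n x n * P * Q) = (det (M x n) * P) * (mult_w_n y n * (mult_d_n x n * Q))"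
      by (simp add: mult_ac)
    also have "\<dots> = (mult_w_n x n * (mult_w_n y n * p)) * (det (M x n) * R)"
      by (simp only: e1 e2)
    also have "\<dots> = (det (M x n) * mult_w_n y n) * (mult_w_n x n * p * R)"
      by (simp add: mult_ac)
    finally have "mult_d_n x n * P * Q = mult_w_n x n * p * R"
      using det_M_nz[OF x] mult_w_n_nz[OF y] by simp
    then have "\<bar>P\<bar> * \<delta> \<le> \<kappa> ^ m * 4"
      by (rule domination_product)
        (use XY x y mult_d_n_nz[OF x] dom[OF x, of m] q abs_det2_le[of "w X" "w Y"] abs_det2_le[of "w y" "d x"]
          in \<open>auto simp: n_def p_def R_def Q_def\<close>)
    then show "\<bar>det2 (w x) (w y)\<bar> * \<delta> \<le> \<kappa> ^ m * 4"
      by (simp add: P_def)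
  qed
  then show ?thesis
    using unit_parallel[of "w x" "w y"] x y that by auto
qed

text \<open>Rescaling \<^term>\<open>w\<close> by the exponential of a coboundary replaces the one-step ratio of the
  multipliers by its geometric mean over a block, so that domination already holds in one step.\<close>

lemma adapted_scaling:
  obtains u :: "(int \<Rightarrow> 'a) \<Rightarrow> real" and \<kappa> U where "0 < \<kappa>" "\<kappa> < 1"
    "\<And>x. x \<in> two_sided E \<Longrightarrow> \<bar>u x\<bar> \<le> U"
    "\<And>x. x \<in> two_sided E \<Longrightarrow> exp (u (shift2 x) - u x) * \<bar>mult_w x\<bar> \<le> \<kappa> * \<bar>mult_d x\<bar>"
proof -
  obtain N \<kappa> where N: "N \<ge> 1" "0 < \<kappa>" "\<kappa> < 1"
    and dom: "\<And>x. x \<in> two_sided E \<Longrightarrow> \<bar>mult_w_n x N\<bar> \<le> \<kappa> * \<bar>mult_d_n x N\<bar>"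
    by (rule block_domination) blast
  obtain c where c: "0 < c" "c \<le> 1" "\<And>x. x \<in> two_sided E \<Longrightarrow> c \<le> \<bar>mult_d x\<bar> \<and> \<bar>mult_d x\<bar> \<le> 1 / c \<and> c \<le> \<bar>mult_w x\<bar> \<and> \<bar>mult_w x\<bar> \<le> 1 / c"
    by (rule multiplier_bounds) blast
  define r where "r x = ln \<bar>mult_w x\<bar> - ln \<bar>mult_d x\<bar>" for x
  \<comment> \<open>The weights fall by \<open>1 / N\<close> per step and end at 0, so that
    \<open>u x - u (shift2 x)\<close> is \<open>r x\<close> minus its block average.\<close>
  define u where "u x = (\<Sum>k<N. (real N - 1 - real k) / real N * r (shiftz (int k) x))" for x
  have r_le: "\<bar>r x\<bar> \<le> 2 * ln (1 / c)" if x: "x \<in> two_sided E" for x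
  proof -
    have "ln c \<le> ln \<bar>mult_d x\<bar>" "ln c \<le> ln \<bar>mult_w x\<bar>" "ln \<bar>mult_d x\<bar> \<le> ln (1 / c)" "ln \<bar>mult_w x\<bar> \<le> ln (1 / c)"
      using c(1) c(3)[OF x] mult_d_nz[OF x] mult_w_nz[OF x] by (auto intro!: ln_mono)
    moreover have "ln (1 / c) = - ln c"
      using c(1) by (simp add: ln_div)
    ultimately show ?thesis
      unfolding r_def by linarith
  qed
  have cob: "u x - u (shift2 x) = r x - (1 / real N) * (\<Sum>k<N. r (shiftz (int k) x))" for x
  proof -
    have "u (shift2 x) = (\<Sum>k<N. (real N - real (Suc k)) / real N * r (shiftz (int (Suc k)) x))"
      unfolding u_def using shift2_shiftz[of 0 x] by (intro sum.cong) (simp_all add: diff_diff_eq add.commute)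
    also have "\<dots> = (\<Sum>k<Suc N. (real N - real k) / real N * r (shiftz (int k) x)) - r x"
      using N(1) by (subst sum.lessThan_Suc_shift) simp
    also have "\<dots> = (\<Sum>k<N. (real N - real k) / real N * r (shiftz (int k) x)) - r x"
      by simp
    finally have "u x - u (shift2 x) = r x + (\<Sum>k<N. (real N - 1 - real k) / real N * r (shiftz (int k) x) -
        (real N - real k) / real N * r (shiftz (int k) x))"
      by (simp add: u_def sum_subtractf)
    also have "\<dots> = r x + (\<Sum>k<N. - (1 / real N) * r (shiftz (int k) x))"
      by (intro arg_cong2[where f = "(+)"] sum.cong refl) (simp add: left_diff_distrib[symmetric] diff_divide_distrib[symmetric])
    finally show ?thesis
      by (simp only: sum_distrib_left[symmetric])
  qed
  show ?thesis
  \<comment> \<open>The block rate \<kappa> is spread over \<open>N\<close> letters, whence its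
    \<open>N\<close>-th root.\<close>
  proof (rule that[of "exp (ln \<kappa> / real N)" u "real N * (2 * ln (1 / c))"])
    show "exp (ln \<kappa> / real N) < 1"
      using N by (simp add: divide_neg_pos)
  next
    fix x assume x: "x \<in> two_sided E"
    have "\<bar>u x\<bar> \<le> (\<Sum>k<N. \<bar>(real N - 1 - real k) / real N * r (shiftz (int k) x)\<bar>)"
      unfolding u_def by (rule sum_abs)
    also have "\<dots> \<le> (\<Sum>k<N. 1 * (2 * ln (1 / c)))"
      unfolding abs_mult using x c(1,2) N(1) by (intro sum_mono mult_mono r_le) auto
    finally show "\<bar>u x\<bar> \<le> real N * (2 * ln (1 / c))"
      by simp
    have ln_prod: "(\<Sum>k<n. r (shiftz (int k) x)) = ln \<bar>mult_w_n x n\<bar> - ln \<bar>mult_d_n x n\<bar>" for n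
    proof (induction n)
      case (Suc n)
      have "ln \<bar>mult_w_n x (Suc n)\<bar> = ln \<bar>mult_w_n x n\<bar> + ln \<bar>mult_w (shiftz (int n) x)\<bar>"
        using mult_w_n_nz[OF x, of n] mult_w_nz[of "shiftz (int n) x"] x by (simp add: mult_w_n_def abs_mult ln_mult)
      moreover have "ln \<bar>mult_d_n x (Suc n)\<bar> = ln \<bar>mult_d_n x n\<bar> + ln \<bar>mult_d (shiftz (int n) x)\<bar>"
        using mult_d_n_nz[OF x, of n] mult_d_nz[of "shiftz (int n) x"] x by (simp add: mult_d_n_def abs_mult ln_mult)
      ultimately show ?case
        using Suc by (simp add: r_def)
    qed (simp add: mult_w_n_def mult_d_n_def)
    have "ln \<bar>mult_w_n x N\<bar> \<le> ln (\<kappa> * \<bar>mult_d_n x N\<bar>)"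
      using dom[OF x] mult_w_n_nz[OF x, of N] mult_d_n_nz[OF x, of N] N(2) by (intro ln_mono) auto
    then have "(\<Sum>k<N. r (shiftz (int k) x)) \<le> ln \<kappa>"
      using N(2) mult_d_n_nz[OF x, of N] by (simp add: ln_prod ln_mult)
    then have "(1 / real N) * (\<Sum>k<N. r (shiftz (int k) x)) \<le> ln \<kappa> / real N"
      using N(1) by (simp add: divide_right_mono)
    then have "u (shift2 x) - u x + r x \<le> ln \<kappa> / real N"
      using cob[of x] by linarith
    then have "exp (u (shift2 x) - u x + r x) \<le> exp (ln \<kappa> / real N)"
      by simp
    moreover have "exp (r x) = \<bar>mult_w x\<bar> / \<bar>mult_d x\<bar>"
      using mult_d_nz[OF x] mult_w_nz[OF x] by (simp add: r_def exp_diff)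
    ultimately have "exp (u (shift2 x) - u x) * (\<bar>mult_w x\<bar> / \<bar>mult_d x\<bar>) \<le> exp (ln \<kappa> / real N)"
      by (simp add: exp_add)
    then show "exp (u (shift2 x) - u x) * \<bar>mult_w x\<bar> \<le> exp (ln \<kappa> / real N) * \<bar>mult_d x\<bar>"
      using mult_d_nz[OF x] by (simp add: field_simps)
  qed simp
qed

end

text \<open>An invariant frame \<open>(d, w)\<close> along the word. It starts at \<open>v\<close> and its weak vector ends on the line of
  \<open>om\<close>, so that \<open>\<lambda>x. det2 x om\<close> is a multiple of the dominant coordinate at the end of the word.\<close>

definition hyperbolic_word ::
  "('a \<Rightarrow> real^2^2) \<Rightarrow> ('a \<Rightarrow> real^2) \<Rightarrow> ('a \<Rightarrow> real^2) \<Rightarrow> real \<Rightarrow> real \<Rightarrow> 'a list \<Rightarrow> bool" where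
  "hyperbolic_word A v om \<kappa> c xs \<longleftrightarrow> (\<exists>d w a b s.
     d 0 = v (hd xs) \<and> w (length xs - 1) = s *s om (last xs) \<and> c \<le> \<bar>s\<bar> \<and> \<bar>s\<bar> \<le> 1 / c \<and>
     (\<forall>k<length xs. norm (d k) \<le> 1 / c \<and> norm (w k) \<le> 1 / c \<and> c \<le> \<bar>det2 (d k) (w k)\<bar>) \<and>
     (\<forall>k. Suc k < length xs \<longrightarrow>
        A (xs ! k) *v d k = a k *s d (Suc k) \<and> A (xs ! k) *v w k = b k *s w (Suc k) \<and>
        c \<le> \<bar>a k\<bar> \<and> \<bar>b k\<bar> \<le> \<kappa> * \<bar>a k\<bar>))"

abbreviation adm :: "('a \<times> 'a) set \<Rightarrow> 'a list \<Rightarrow> bool" where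
  "adm E xs \<equiv> xs \<noteq> [] \<and> successively (\<lambda>i j. (i, j) \<in> E) xs"

section \<open>Finitely many start and end vectors serve all admissible words\<close>

lemma two_sided_through:
  assumes succ: "\<And>i. \<exists>j. (i, j) \<in> E" and pred: "\<And>j. \<exists>i. (i, j) \<in> E"
  shows "\<exists>x\<in>two_sided E. x 0 = i"
proof -
  obtain f where f: "\<And>i. (i, f i) \<in> E"
    using succ by metis
  obtain g where g: "\<And>j. (g j, j) \<in> E"
    using pred by metis
  define x where "x k = (if k \<ge> 0 then (f ^^ nat k) i else (g ^^ nat (- k)) i)" for k :: int
  have "(x k, x (k + 1)) \<in> E" for k
  proof (cases "k \<ge> 0")
    case True
    then have "nat (k + 1) = Suc (nat k)"
      by simp
    then show ?thesis
      using True f by (simp add: x_def)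
  next
    case False
    then have "nat (- k) = Suc (nat (- (k + 1)))"
      by simp
    then have "x k = g ((g ^^ nat (- (k + 1))) i)"
      using False by (simp add: x_def)
    moreover have "x (k + 1) = (g ^^ nat (- (k + 1))) i"
      using False by (cases "k = -1") (auto simp: x_def)
    ultimately show ?thesis
      using g by simp
  qed
  then show ?thesis
    by (intro bexI[of _ x]) (auto simp: two_sided_def x_def)
qed

text \<open>The past of \<open>y\<close>, the word and the future of \<open>z\<close> are glued. The
  shift by \<open>length xs - 1\<close> places \<open>z 0\<close> on the last letter, so that word
  and future overlap in exactly one letter.\<close>

lemma two_sided_splice:
  assumes "adm E xs" "y \<in> two_sided E" "y 0 = hd xs" "z \<in> two_sided E" "z 0 = last xs"
  defines "x \<equiv> \<lambda>k::int. if k < 0 then y k else if k < int (length xs) then xs ! nat k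
                       else z (k - int (length xs - 1))"
  shows "x \<in> two_sided E"
proof -
  have len: "length xs > 0"
    using assms(1) by auto
  have step: "(x k, x (k + 1)) \<in> E" if "x \<in> two_sided E" for x k
    using that by (simp add: two_sided_def)
  have "(x k, x (k + 1)) \<in> E" for k
  proof -
    consider "k < -1" | "k = -1" | "0 \<le> k" "k + 1 < int (length xs)"
      | "k + 1 = int (length xs)" | "k \<ge> int (length xs)"
      by linarith
    then show ?thesis
    proof cases
      case 1
      then show ?thesis
        using step[OF assms(2), of k] by (simp add: x_def)
    next
      case 2
      have "(y (-1), y (-1 + 1)) \<in> E"
        by (rule step[OF assms(2)])
      then show ?thesis
        using 2 assms(3) len by (simp add: x_def hd_conv_nth)
    next
      case 3
      define n where "n = nat k"
      have n: "k = int n" "Suc n < length xs"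
        using 3 by (auto simp: n_def)
      have "(xs ! n, xs ! Suc n) \<in> E"
        using assms(1) n(2) by (auto simp: successively_conv_nth)
      moreover have "nat (int n + 1) = Suc n"
        by simp
      ultimately show ?thesis
        using n by (simp add: x_def)
    next
      case 4
      obtain n where n: "length xs = Suc n"
        using len gr0_implies_Suc by blast
      then have "k = int n"
        using 4 by simp
      moreover have "last xs = xs ! n"
        using n by (cases xs rule: rev_cases) auto
      ultimately have "x k = z 0" "x (k + 1) = z (0 + 1)"
        using n assms(5) by (simp_all add: x_def)
      then show ?thesis
        using step[OF assms(4), of 0] by simp
    next
      case 5
      define m where "m = k - int (length xs - 1)"
      have "k + 1 - int (length xs - 1) = m + 1"
        by (simp add: m_def)
      moreover have "x k = z m" "x (k + 1) = z (k + 1 - int (length xs - 1))"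
        using 5 len by (simp_all add: x_def m_def)
      ultimately have "x k = z m" "x (k + 1) = z (m + 1)"
        by (simp_all only:)
      then show ?thesis
        using step[OF assms(4), of m] by simp
    qed
  qed
  then show ?thesis
    by (simp add: two_sided_def)
qed

text \<open>One reference sequence \<open>z i\<close> through each letter suffices. A word is glued
  between the past of the reference at its first letter and the future of the reference at its last
  one. Dependence on past and future then identifies the dominant line at the start and the weak
  line at the end with reference lines, and the rescaling by \<open>u\<close> makes domination hold
  at each letter.\<close>

lemma (in dominated_splitting) hyperbolic_words:
  assumes succ: "\<And>i. \<exists>j. (i, j) \<in> E" and pred: "\<And>j. \<exists>i. (i, j) \<in> E"
  obtains v om \<kappa> c where "0 < \<kappa>" "\<kappa> < 1" "0 < c" "\<And>xs. adm E xs \<Longrightarrow> hyperbolic_word A v om \<kappa> c xs"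
proof -
  obtain u \<kappa> U where u: "0 < \<kappa>" "\<kappa> < 1" "\<And>x. x \<in> two_sided E \<Longrightarrow> \<bar>u x\<bar> \<le> U"
    and dom: "\<And>x. x \<in> two_sided E \<Longrightarrow> exp (u (shift2 x) - u x) * \<bar>mult_w x\<bar> \<le> \<kappa> * \<bar>mult_d x\<bar>"
    using adapted_scaling by metis
  obtain c0 where c0: "0 < c0" "c0 \<le> 1" "\<And>x. x \<in> two_sided E \<Longrightarrow> c0 \<le> \<bar>mult_d x\<bar>"
    using multiplier_bounds by metis
  obtain \<delta> where \<delta>: "\<delta> > 0" "\<And>x. x \<in> two_sided E \<Longrightarrow> \<delta> \<le> \<bar>det2 (d x) (w x)\<bar>"
    using angle_bound by metis
  obtain z where z: "\<And>i. z i \<in> two_sided E" "\<And>i. z i 0 = i"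
    using two_sided_through[OF succ pred] by metis
  \<comment> \<open>One constant for several bounds: \<open>c0\<close> for the multipliers,
    \<open>\<delta> * exp (- \<bar>U\<bar>)\<close> for the angle after rescaling, and
    \<open>exp (- \<bar>U\<bar>)\<close> for the rescaled weak vectors and the factor
    \<open>s\<close>, which may be that small or as large as the inverse.\<close>
  define c where "c = min c0 (min \<delta> 1 * exp (- \<bar>U\<bar>))"
  have c: "0 < c" "c \<le> c0" "c \<le> \<delta> * exp (- \<bar>U\<bar>)" "c \<le> exp (- \<bar>U\<bar>)" "exp \<bar>U\<bar> \<le> 1 / c" "1 \<le> 1 / c"
  proof -
    show "0 < c" "c \<le> c0"
      using c0 \<delta> by (auto simp: c_def)
    have "min \<delta> 1 * exp (- \<bar>U\<bar>) \<le> \<delta> * exp (- \<bar>U\<bar>)" "min \<delta> 1 * exp (- \<bar>U\<bar>) \<le> 1 * exp (- \<bar>U\<bar>)"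
      by (intro mult_right_mono; simp)+
    then show "c \<le> \<delta> * exp (- \<bar>U\<bar>)" and e: "c \<le> exp (- \<bar>U\<bar>)"
      unfolding c_def by linarith+
    then have "c * exp \<bar>U\<bar> \<le> exp (- \<bar>U\<bar>) * exp \<bar>U\<bar>"
      by (intro mult_right_mono) auto
    then show "exp \<bar>U\<bar> \<le> 1 / c"
      using \<open>0 < c\<close> by (simp add: exp_add[symmetric] pos_le_divide_eq mult.commute)
    then show "1 \<le> 1 / c"
      by (rule order_trans[rotated]) simp
  qed
  have eu: "exp (- \<bar>U\<bar>) \<le> exp (- u x)" "exp (- u x) \<le> exp \<bar>U\<bar>" if "x \<in> two_sided E" for x
    using u(3)[OF that] by auto
  have ec: "c \<le> exp (- u x)" "exp (- u x) \<le> 1 / c" if "x \<in> two_sided E" for x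
    using eu[OF that] c(4,5) by linarith+
  have "hyperbolic_word A (\<lambda>i. d (z i)) (\<lambda>i. w (z i)) \<kappa> c xs" if xs: "adm E xs" for xs
  proof -
    define n where "n = length xs - 1"
    have n: "length xs = Suc n"
      using xs by (cases xs) (auto simp: n_def)
    define x where "x = (\<lambda>k::int. if k < 0 then z (hd xs) k else if k < int (length xs) then xs ! nat k
                       else z (last xs) (k - int (length xs - 1)))"
    have x: "x \<in> two_sided E"
      unfolding x_def by (rule two_sided_splice[OF xs]) (use z in auto)
    define X where "X k = shiftz (int k) x" for k
    have X: "X k \<in> two_sided E" for k
      using x by (simp add: X_def)
    have X_Suc: "shift2 (X k) = X (Suc k)" for k
      by (simp add: X_def shift2_shiftz add.commute)
    have X_0: "X k 0 = xs ! k" if "k < length xs" for k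
      using that by (simp add: X_def shiftz_def x_def)
    obtain s0 where s0: "s0 \<in> {1,-1}" "d (z (hd xs)) = s0 *s d x"
      by (rule d_depends_on_past[OF x z(1)[of "hd xs"]]) (auto simp: x_def)
    have "X n k = z (last xs) k" if "k \<ge> 0" for k
    proof (cases "k = 0")
      case True
      then show ?thesis
        using n z(2) xs by (simp add: X_0 last_conv_nth n_def)
    next
      case False
      then show ?thesis
        using that n by (simp add: X_def shiftz_def x_def)
    qed
    then obtain s1 where s1: "s1 \<in> {1,-1}" "w (X n) = s1 *s w (z (last xs))"
      using w_depends_on_future[OF z(1)[of "last xs"] X[of n]] by metis
    have abs1: "\<bar>s0\<bar> = 1" "\<bar>s1\<bar> = 1"
      using s0(1) s1(1) by auto
    define a where "a k = mult_d (X k)" for k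
    \<comment> \<open>The weak multiplier in the rescaled frame, whose weak vector at
      \<open>k\<close> is \<open>exp (- u (X k)) *s w (X k)\<close>.\<close>
    define b where "b k = exp (u (X (Suc k)) - u (X k)) * mult_w (X k)" for k
    show ?thesis
      unfolding hyperbolic_word_def
    proof (rule exI[of _ "\<lambda>k. s0 *s d (X k)"], rule exI[of _ "\<lambda>k. exp (- u (X k)) *s w (X k)"],
        rule exI[of _ a], rule exI[of _ b], rule exI[of _ "exp (- u (X n)) * s1"], intro conjI allI impI)
      show "s0 *s d (X 0) = d (z (hd xs))"
        using s0 by (simp add: X_def)
      show "exp (- u (X (length xs - 1))) *s w (X (length xs - 1)) = (exp (- u (X n)) * s1) *s w (z (last xs))"
        using n s1 by (simp add: vector_smult_assoc)
      show "c \<le> \<bar>exp (- u (X n)) * s1\<bar>" "\<bar>exp (- u (X n)) * s1\<bar> \<le> 1 / c"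
        using ec[OF X, of n] abs1 by (simp_all only: abs_mult abs_exp_cancel mult_1_right)
    next
      fix k
      show "norm (s0 *s d (X k)) \<le> 1 / c" "norm (exp (- u (X k)) *s w (X k)) \<le> 1 / c"
        using abs1 ec(2)[OF X, of k] c(6) norm_d[OF X, of k] norm_w[OF X, of k] by (simp_all only: norm_smult abs_exp_cancel mult_1 mult_1_right)
      have "c \<le> exp (- \<bar>U\<bar>) * \<delta>"
        using c by (simp add: mult.commute)
      also have "\<dots> \<le> exp (- u (X k)) * \<bar>det2 (d (X k)) (w (X k))\<bar>"
        using \<delta> X by (intro mult_mono eu) auto
      also have "\<dots> = \<bar>det2 (s0 *s d (X k)) (exp (- u (X k)) *s w (X k))\<bar>"
        using abs1 by (simp add: det2_simps abs_mult)
      finally show "c \<le> \<bar>det2 (s0 *s d (X k)) (exp (- u (X k)) *s w (X k))\<bar>" .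
    next
      fix k assume k: "Suc k < length xs"
      then have [simp]: "xs ! k = X k 0"
        by (simp add: X_0)
      show "A (xs ! k) *v (s0 *s d (X k)) = a k *s (s0 *s d (X (Suc k)))"
        using mult_d[OF X[of k]] by (simp add: a_def vector_scalar_commute X_Suc vector_smult_assoc mult.commute)
      show "A (xs ! k) *v (exp (- u (X k)) *s w (X k)) = b k *s (exp (- u (X (Suc k))) *s w (X (Suc k)))"
        using mult_w[OF X[of k]]
        by (simp add: b_def vector_scalar_commute X_Suc vector_smult_assoc exp_diff exp_minus field_simps)
      show "c \<le> \<bar>a k\<bar>"
        using c0(3)[OF X, of k] c(2) by (simp add: a_def)
      show "\<bar>b k\<bar> \<le> \<kappa> * \<bar>a k\<bar>"
        using dom[OF X, of k] by (simp add: a_def b_def abs_mult X_Suc)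
    qed
  qed
  with u c show ?thesis
    using that by blast
qed

section \<open>From line fields to unit vector fields\<close>

lemma line_unit_vector:
  assumes "is_line L"
  obtains u :: "real^2" where "u \<in> L" "norm u = 1" "L = range (\<lambda>c. c *s u)"
proof -
  have L: "subspace L" "dim L = 1"
    using assms by (auto simp: is_line_def)
  then obtain y where y: "y \<in> L" "y \<noteq> 0"
    using dim_eq_0[of L] by (metis (no_types, lifting) dim_eq_0 insert_iff subsetI zero_neq_one singletonD)
  define u where "u = (1 / norm y) *\<^sub>R y"
  have u: "u \<in> L" "norm u = 1"
    using y L(1) by (auto simp: u_def subspace_scale)
  have "independent {u}"
    using u(2) by (simp add: independent_insert) (metis norm_zero zero_neq_one)
  then have "L \<subseteq> span {u}"
    using u(1) L(2) by (intro card_ge_dim_independent) auto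
  moreover have "span {u} \<subseteq> L"
    using u(1) L(1) by (simp add: span_minimal)
  ultimately have "L = range (\<lambda>c. c *s u)"
    by (auto simp: span_singleton scalar_mult_eq_scaleR)
  then show ?thesis
    using that u by blast
qed

lemma unit_vector_of_range:
  fixes u v :: "real^2"
  assumes "v \<in> range (\<lambda>c. c *s u)" "norm v = 1" "norm u = 1"
  obtains s where "s \<in> {1,-1}" "v = s *s u"
proof -
  obtain c where c: "v = c *s u"
    using assms(1) by blast
  then have "\<bar>c\<bar> = 1"
    using assms(2,3) by (simp add: scalar_mult_eq_scaleR)
  then have "c \<in> {1,-1}"
    by (auto simp: abs_if split: if_splits)
  with c show ?thesis
    using that by blast
qed

lemma restr_norm_line:
  fixes u :: "real^2"
  assumes "norm u = 1"
  shows "restr_norm X (range (\<lambda>c. c *s u)) = norm (X *v u)"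
proof -
  have "{norm (X *v v) | v. v \<in> range (\<lambda>c. c *s u) \<and> norm v = 1} = {norm (X *v u)}" (is "?S = _")
  proof
    show "?S \<subseteq> {norm (X *v u)}"
    proof clarify
      fix v c assume "norm (c *s u) = 1"
      then have "\<bar>c\<bar> = 1"
        using assms by (simp add: scalar_mult_eq_scaleR)
      then show "norm (X *v (c *s u)) = norm (X *v u)"
        by (simp add: vector_scalar_commute)
    qed
    have "u \<in> range (\<lambda>c. c *s u)"
      by (rule range_eqI[of _ _ 1]) simp
    then show "{norm (X *v u)} \<subseteq> ?S"
      using assms by auto
  qed
  then show ?thesis
    by (simp add: restr_norm_def)
qed

text \<open>Some pair of unit vectors has distance below \<open>e\<close> because the infimum does.
  Unit vectors on a line differ from the chosen ones by a sign, and the two signs combine into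
  \<open>s * t\<close>.\<close>

lemma line_dist_less:
  fixes u v :: "real^2"
  assumes "line_dist (range (\<lambda>c. c *s v)) (range (\<lambda>c. c *s u)) < e" "norm u = 1" "norm v = 1"
  shows "\<exists>s\<in>{1,-1}. norm (v - s *s u) < e"
proof -
  define S where "S = {norm (x - y) | x y. x \<in> range (\<lambda>c. c *s v) \<and> y \<in> range (\<lambda>c. c *s u) \<and> norm x = 1 \<and> norm y = 1}"
  have S: "r \<in> S \<longleftrightarrow> (\<exists>x y. r = norm (x - y) \<and> x \<in> range (\<lambda>c. c *s v) \<and> y \<in> range (\<lambda>c. c *s u) \<and> norm x = 1 \<and> norm y = 1)" for r
    by (simp only: S_def mem_Collect_eq)
  have "v \<in> range (\<lambda>c. c *s v)" "u \<in> range (\<lambda>c. c *s u)"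
    by (rule range_eqI[of _ _ 1], simp)+
  then have "norm (v - u) \<in> S"
    unfolding S using assms(2,3) by (intro exI conjI) (rule refl)
  then have "S \<noteq> {}"
    by (metis empty_iff)
  moreover have "Inf S < e"
    using assms(1) by (simp only: line_dist_def S_def)
  ultimately obtain r where "r \<in> S" "r < e"
    using cInf_lessD[of S e] by blast
  then obtain x y where "r = norm (x - y)" and xy: "x \<in> range (\<lambda>c. c *s v)" "y \<in> range (\<lambda>c. c *s u)" "norm x = 1" "norm y = 1"
    unfolding S by metis
  with \<open>r < e\<close> have e: "norm (x - y) < e"
    by simp
  obtain s where s: "s \<in> {1,-1}" "x = s *s v"
    using unit_vector_of_range[OF xy(1,3) assms(3)] by blast
  obtain t where t: "t \<in> {1,-1}" "y = t *s u"
    using unit_vector_of_range[OF xy(2,4) assms(2)] by blast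
  have "v - (s * t) *s u = s *s (x - y)"
    using s t by (auto simp: vec_eq_iff)
  then have "norm (v - (s * t) *s u) = norm (x - y)"
    using s(1) by (auto simp: scalar_mult_eq_scaleR)
  then show ?thesis
    using e s(1) t(1) by (intro bexI[of _ "s * t"]) auto
qed

lemma proj_unif_hyp_splitting:
  assumes "proj_unif_hyp E A" and inv: "\<And>i. invertible (A i)"
  obtains d w where "dominated_splitting E A d w"
proof -
  obtain Ed Ew n where
    K0: "\<forall>x\<in>two_sided E. is_line (Ed x) \<and> is_line (Ew x) \<and>
                  Ed x \<inter> Ew x = {0} \<and> span (Ed x \<union> Ew x) = UNIV \<and>
                  (\<lambda>v. A (x 0) *v v) ` Ed x = Ed (shift2 x) \<and>
                  (\<lambda>v. A (x 0) *v v) ` Ew x = Ew (shift2 x)"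
    and cont: "cont_line_field E Ed" "cont_line_field E Ew"
    and n0: "n \<ge> 1" "\<forall>x\<in>two_sided E. restr_norm (mprod A (\<lambda>k. x (int k)) n) (Ew x)
             < restr_norm (mprod A (\<lambda>k. x (int k)) n) (Ed x)"
    using assms(1)[unfolded proj_unif_hyp_def] by (elim exE conjE) (rule that; assumption)
  have K: "is_line (Ed x)" "is_line (Ew x)" "Ed x \<inter> Ew x = {0}"
    "(\<lambda>v. A (x 0) *v v) ` Ed x = Ed (shift2 x)" "(\<lambda>v. A (x 0) *v v) ` Ew x = Ew (shift2 x)"
    if "x \<in> two_sided E" for x
    using bspec[OF K0 that] by simp_all
  have "\<exists>u. norm u = 1 \<and> Ed x = range (\<lambda>c. c *s u)" "\<exists>u. norm u = 1 \<and> Ew x = range (\<lambda>c. c *s u)"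
    if "x \<in> two_sided E" for x
    using line_unit_vector[OF K(1)[OF that]] line_unit_vector[OF K(2)[OF that]] by metis+
  then obtain d w where
    d: "\<And>x. x \<in> two_sided E \<Longrightarrow> norm (d x) = 1" "\<And>x. x \<in> two_sided E \<Longrightarrow> Ed x = range (\<lambda>c. c *s d x)" and
    w: "\<And>x. x \<in> two_sided E \<Longrightarrow> norm (w x) = 1" "\<And>x. x \<in> two_sided E \<Longrightarrow> Ew x = range (\<lambda>c. c *s w x)"
    by metis
  have sh: "shift2 x \<in> two_sided E" if "x \<in> two_sided E" for x
    using that shift2_shiftz[of 0 x] by simp
  have mem: "u \<in> range (\<lambda>c. c *s u)" for u :: "real^2"
    by (rule range_eqI[of _ _ 1]) simp
  have "dominated_splitting E A d w"
  proof
    fix x assume x: "x \<in> two_sided E"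
    show "det2 (d x) (w x) \<noteq> 0"
    proof
      assume "det2 (d x) (w x) = 0"
      then obtain s where "s \<in> {1,-1}" "w x = s *s d x"
        using unit_parallel d(1)[OF x] w(1)[OF x] by metis
      then have "w x \<in> Ed x"
        unfolding d(2)[OF x] by blast
      moreover have "w x \<in> Ew x"
        unfolding w(2)[OF x] by (rule mem)
      ultimately have "w x \<in> Ed x \<inter> Ew x"
        by blast
      then show False
        using K(3)[OF x] w(1)[OF x] by auto
    qed
    have "A (x 0) *v d x \<in> Ed (shift2 x)"
      using mem[of "d x"] unfolding K(4)[OF x, symmetric] d(2)[OF x] by (rule imageI)
    then show "\<exists>a. A (x 0) *v d x = a *s d (shift2 x)"
      using d(2)[OF sh[OF x]] by auto
    have "A (x 0) *v w x \<in> Ew (shift2 x)"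
      using mem[of "w x"] unfolding K(5)[OF x, symmetric] w(2)[OF x] by (rule imageI)
    then show "\<exists>a. A (x 0) *v w x = a *s w (shift2 x)"
      using w(2)[OF sh[OF x]] by auto
    fix e :: real assume e: "e > 0"
    obtain N where "\<forall>y\<in>two_sided E. (\<forall>k. \<bar>k\<bar> \<le> int N \<longrightarrow> y k = x k) \<longrightarrow> line_dist (Ed y) (Ed x) < e"
      using cont(1) x e unfolding cont_line_field_def by blast
    then show "\<exists>N. \<forall>y\<in>two_sided E. agree N x y \<longrightarrow> (\<exists>s\<in>{1,-1}. norm (d y - s *s d x) < e)"
      using x d line_dist_less[of "d _" "d x" e] unfolding agree_def by metis
    obtain N where "\<forall>y\<in>two_sided E. (\<forall>k. \<bar>k\<bar> \<le> int N \<longrightarrow> y k = x k) \<longrightarrow> line_dist (Ew y) (Ew x) < e"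
      using cont(2) x e unfolding cont_line_field_def by blast
    then show "\<exists>N. \<forall>y\<in>two_sided E. agree N x y \<longrightarrow> (\<exists>s\<in>{1,-1}. norm (w y - s *s w x) < e)"
      using x w line_dist_less[of "w _" "w x" e] unfolding agree_def by metis
  next
    show "\<exists>n\<ge>1. \<forall>x\<in>two_sided E. norm (mprod A (\<lambda>k. x (int k)) n *v w x)
                                         < norm (mprod A (\<lambda>k. x (int k)) n *v d x)"
      using n0 by (intro exI[of _ n]) (simp add: d w restr_norm_line)
  qed (use inv d w in auto)
  then show ?thesis
    by (rule that)
qed

section \<open>Perturbation of hyperbolic words\<close>

definition cvec :: "real^2 \<Rightarrow> complex^2" where
  "cvec x = (\<chi> r. of_real (x $ r))"

lemma cvec_nth [simp]: "cvec x $ r = of_real (x $ r)"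
  by (simp add: cvec_def)

lemma norm_cvec [simp]: "norm (cvec x) = norm x"
  by (simp add: norm_vec_def)

lemma cvec_smult: "cvec (a *s x) = of_real a *s cvec x"
  by (simp add: vec_eq_iff)

lemma det2_cvec: "det2 (cvec x) (cvec y) = of_real (det2 x y)"
  by (simp add: det2_def)

text \<open>The matrix with rows \<open>(p, r)\<close> and \<open>(q, s)\<close> perturbs
  \<open>diag (a, b)\<close> by at most \<open>\<theta> * \<bar>a\<bar>\<close> in each entry. The
  cone \<open>cmod y \<le> cmod x\<close> is mapped into itself because
  \<open>\<kappa> + 2 * \<theta> \<le> 1 - 2 * \<theta>\<close>.\<close>

lemma cone_step:
  fixes p q r s x y :: complex and a b \<kappa> \<theta> :: real
  assumes \<kappa>: "0 < \<kappa>" "\<kappa> < 1" and \<theta>: "\<theta> = (1 - \<kappa>) / 16"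
    and p: "cmod (p - of_real a) \<le> \<theta> * \<bar>a\<bar>" and q: "cmod q \<le> \<theta> * \<bar>a\<bar>"
    and r: "cmod r \<le> \<theta> * \<bar>a\<bar>" and s: "cmod (s - of_real b) \<le> \<theta> * \<bar>a\<bar>" and b: "\<bar>b\<bar> \<le> \<kappa> * \<bar>a\<bar>"
  shows "cmod y \<le> cmod x \<Longrightarrow> (1 - 2 * \<theta>) * \<bar>a\<bar> * cmod x \<le> cmod (p * x + r * y)"
    and "cmod y \<le> cmod x \<Longrightarrow> cmod (q * x + s * y) \<le> cmod (p * x + r * y)"
    and "cmod (p * s - q * r) \<le> ((1 + \<theta>) * (\<kappa> + \<theta>) + \<theta>\<^sup>2) * \<bar>a\<bar>\<^sup>2"
proof -
  have t0: "\<theta> > 0"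
    using \<kappa> \<theta> by simp
  have pl: "(1 - \<theta>) * \<bar>a\<bar> \<le> cmod p" and pu: "cmod p \<le> (1 + \<theta>) * \<bar>a\<bar>"
    using p norm_triangle_ineq2[of "of_real a" p] norm_triangle_ineq2[of p "of_real a"]
    by (simp_all add: norm_minus_commute algebra_simps)
  have su: "cmod s \<le> (\<kappa> + \<theta>) * \<bar>a\<bar>"
    using s b norm_triangle_ineq2[of s "of_real b"] by (simp add: algebra_simps)
  show main: "(1 - 2 * \<theta>) * \<bar>a\<bar> * cmod x \<le> cmod (p * x + r * y)" if yx: "cmod y \<le> cmod x"
  proof -
    have "(1 - \<theta>) * \<bar>a\<bar> * cmod x \<le> cmod (p * x)"
      using mult_right_mono[OF pl norm_ge_zero[of x]] by (simp add: norm_mult)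
    moreover have "cmod (r * y) \<le> \<theta> * \<bar>a\<bar> * cmod x"
      unfolding norm_mult using r yx t0 by (intro mult_mono) auto
    moreover have "cmod (p * x) - cmod (r * y) \<le> cmod (p * x + r * y)"
      by (rule norm_diff_ineq)
    ultimately show ?thesis
      by (simp add: algebra_simps)
  qed
  show "cmod (q * x + s * y) \<le> cmod (p * x + r * y)" if yx: "cmod y \<le> cmod x"
  proof -
    have "cmod (q * x + s * y) \<le> cmod (q * x) + cmod (s * y)"
      by (rule norm_triangle_ineq)
    also have "\<dots> \<le> \<theta> * \<bar>a\<bar> * cmod x + (\<kappa> + \<theta>) * \<bar>a\<bar> * cmod x"
      unfolding norm_mult using q su yx t0 \<kappa> by (intro add_mono mult_mono) auto
    also have "\<dots> = (\<kappa> + 2 * \<theta>) * (\<bar>a\<bar> * cmod x)"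
      by (simp add: algebra_simps)
    also have "\<dots> \<le> (1 - 2 * \<theta>) * (\<bar>a\<bar> * cmod x)"
      using \<kappa> \<theta> by (intro mult_right_mono) auto
    also have "\<dots> \<le> cmod (p * x + r * y)"
      using main[OF yx] by (simp add: mult.assoc)
    finally show ?thesis .
  qed
  have "cmod (p * s - q * r) \<le> cmod p * cmod s + cmod q * cmod r"
    by (metis norm_mult norm_triangle_ineq4)
  also have "\<dots> \<le> (1 + \<theta>) * \<bar>a\<bar> * ((\<kappa> + \<theta>) * \<bar>a\<bar>) + \<theta> * \<bar>a\<bar> * (\<theta> * \<bar>a\<bar>)"
    using pu su q r t0 \<kappa> by (intro add_mono mult_mono) auto
  also have "\<dots> = ((1 + \<theta>) * (\<kappa> + \<theta>) + \<theta>\<^sup>2) * \<bar>a\<bar>\<^sup>2"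
    by (simp add: power2_eq_square algebra_simps)
  finally show "cmod (p * s - q * r) \<le> ((1 + \<theta>) * (\<kappa> + \<theta>) + \<theta>\<^sup>2) * \<bar>a\<bar>\<^sup>2" .
qed

text \<open>The determinant bound of \<open>cone_step\<close> over the square of the cone expansion.
  With \<open>\<kappa> = 1 - 16 * \<theta>\<close> the numerator is below
  \<open>1 - 14 * \<theta> + 2 * \<theta>^2\<close>, while the denominator is
  \<open>1 - 4 * \<theta> + 4 * \<theta>^2\<close>.\<close>

lemma contraction_rate:
  fixes \<kappa> \<theta> :: real
  assumes "0 < \<kappa>" "\<kappa> < 1" "\<theta> = (1 - \<kappa>) / 16"
  shows "0 < ((1 + \<theta>) * (\<kappa> + \<theta>) + \<theta>\<^sup>2) / (1 - 2 * \<theta>)\<^sup>2" "((1 + \<theta>) * (\<kappa> + \<theta>) + \<theta>\<^sup>2) / (1 - 2 * \<theta>)\<^sup>2 < 1"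
    "0 < \<theta>" "0 < 1 - 2 * \<theta>"
proof -
  show t: "0 < \<theta>" "0 < 1 - 2 * \<theta>"
    using assms by auto
  then show "0 < ((1 + \<theta>) * (\<kappa> + \<theta>) + \<theta>\<^sup>2) / (1 - 2 * \<theta>)\<^sup>2"
    using assms by (intro divide_pos_pos add_pos_nonneg mult_pos_pos) auto
  have "\<kappa> * \<theta> < \<theta>"
    using t assms by simp
  moreover have "(1 + \<theta>) * (\<kappa> + \<theta>) + \<theta>\<^sup>2 = \<kappa> + \<theta> + \<kappa> * \<theta> + 2 * \<theta>\<^sup>2"
    by (simp add: power2_eq_square algebra_simps)
  moreover have "\<kappa> = 1 - 16 * \<theta>"
    using assms(3) by simp
  moreover have "(1 - 2 * \<theta>)\<^sup>2 = 1 - 4 * \<theta> + 4 * \<theta>\<^sup>2"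
    by (simp add: power2_eq_square algebra_simps)
  ultimately have "(1 + \<theta>) * (\<kappa> + \<theta>) + \<theta>\<^sup>2 < (1 - 2 * \<theta>)\<^sup>2"
    using t zero_le_power2[of \<theta>] by linarith
  then show "((1 + \<theta>) * (\<kappa> + \<theta>) + \<theta>\<^sup>2) / (1 - 2 * \<theta>)\<^sup>2 < 1"
    using t by (simp add: divide_less_eq_1)
qed

text \<open>The function \<open>g\<close> of the overview. The matrix of the last letter is left out
  by \<open>butlast\<close>: this letter only selects the vector against which the determinant is
  taken.\<close>

definition word_entry :: "('a \<Rightarrow> complex^2^2) \<Rightarrow> ('a \<Rightarrow> real^2) \<Rightarrow> ('a \<Rightarrow> real^2) \<Rightarrow> 'a list \<Rightarrow> complex" where
  "word_entry B v om xs = det2 (word_prod B (butlast xs) *v cvec (v (hd xs))) (cvec (om (last xs)))"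

text \<open>The frame of the unperturbed word is kept as coordinates for the perturbed matrices,
  whose steps become nearly diagonal. The start vector is the axis of the cone, so its dominant
  coordinate \<open>P\<close> never vanishes, and \<open>P\<close> is \<open>g\<close> up to bounded
  factors. The tolerance \<open>\<theta> * c ^ 4 / 8\<close> makes every coordinate error at most
  \<open>\<theta> * c\<close>, hence at most \<open>\<theta> * \<bar>a k\<bar>\<close>.\<close>

lemma perturbed_word:
  fixes \<kappa> c \<theta> :: real and B :: "'a \<Rightarrow> complex^2^2"
  assumes \<kappa>: "0 < \<kappa>" "\<kappa> < 1" and c: "0 < c" and \<theta>: "\<theta> = (1 - \<kappa>) / 16"
    and xs: "xs \<noteq> []" "hyperbolic_word A v om \<kappa> c xs"
    and near: "\<And>i r s. cmod (B i $ r $ s - of_real (A i $ r $ s)) \<le> \<theta> * c ^ 4 / 8"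
  defines "\<kappa>' \<equiv> ((1 + \<theta>) * (\<kappa> + \<theta>) + \<theta>\<^sup>2) / (1 - 2 * \<theta>)\<^sup>2"
  shows "word_entry B v om xs \<noteq> 0"
    and "cmod (det (word_prod B (butlast xs))) \<le> 2 / c ^ 7 * \<kappa>' ^ (length xs - 1) * (cmod (word_entry B v om xs))\<^sup>2"
    and "cmod ((word_prod B (butlast xs) *v x) $ i) \<le> 12 / c ^ 5 * cmod (word_entry B v om xs) * norm x"
proof -
  note \<theta>_facts = contraction_rate[OF \<kappa> \<theta>]
  obtain d w a b s where d0: "d 0 = v (hd xs)" and wn: "w (length xs - 1) = s *s om (last xs)"
    and s: "c \<le> \<bar>s\<bar>" "\<bar>s\<bar> \<le> 1 / c"
    and dw: "\<And>k. k < length xs \<Longrightarrow> norm (d k) \<le> 1 / c \<and> norm (w k) \<le> 1 / c \<and> c \<le> \<bar>det2 (d k) (w k)\<bar>"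
    and ab: "\<And>k. Suc k < length xs \<Longrightarrow>
        A (xs ! k) *v d k = a k *s d (Suc k) \<and> A (xs ! k) *v w k = b k *s w (Suc k) \<and>
        c \<le> \<bar>a k\<bar> \<and> \<bar>b k\<bar> \<le> \<kappa> * \<bar>a k\<bar>"
    using xs(2) unfolding hyperbolic_word_def by metis
  define \<Delta> where "\<Delta> k = det2 (cvec (d k)) (cvec (w k))" for k
  define \<alpha> where "\<alpha> k x = det2 x (cvec (w k)) / \<Delta> k" for k x
  define \<beta> where "\<beta> k x = det2 (cvec (d k)) x / \<Delta> k" for k x
  have \<Delta>: "c \<le> cmod (\<Delta> k)" "cmod (\<Delta> k) \<le> 2 / c\<^sup>2" "\<Delta> k \<noteq> 0" if "k < length xs" for k
  proof -
    show "c \<le> cmod (\<Delta> k)"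
      using dw[OF that] by (simp add: \<Delta>_def det2_cvec)
    then show "\<Delta> k \<noteq> 0"
      using c by auto
    have "cmod (\<Delta> k) \<le> 2 * norm (d k) * norm (w k)"
      using norm_det2_le[of "cvec (d k)" "cvec (w k)"] by (simp add: \<Delta>_def)
    also have "\<dots> \<le> 2 * (1 / c) * (1 / c)"
      using dw[OF that] c by (intro mult_mono) auto
    finally show "cmod (\<Delta> k) \<le> 2 / c\<^sup>2"
      by (simp add: power2_eq_square)
  qed
  have expand: "x = \<alpha> k x *s cvec (d k) + \<beta> k x *s cvec (w k)" if "k < length xs" for k x
  proof -
    have "\<Delta> k *s x = \<Delta> k *s (\<alpha> k x *s cvec (d k) + \<beta> k x *s cvec (w k))"
      using \<Delta>(3)[OF that] det2_expand[of "cvec (d k)" "cvec (w k)" x]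
      by (simp add: \<alpha>_def \<beta>_def vector_add_ldistrib vector_smult_assoc \<Delta>_def[symmetric])
    then show ?thesis
      using \<Delta>(3)[OF that] by (simp only: vector_mul_lcancel simp_thms)
  qed
  have lin: "\<alpha> k (x + y) = \<alpha> k x + \<alpha> k y" "\<alpha> k (t *s x) = t * \<alpha> k x"
    "\<beta> k (x + y) = \<beta> k x + \<beta> k y" "\<beta> k (t *s x) = t * \<beta> k x" for k x y t
    by (simp_all add: \<alpha>_def \<beta>_def det2_simps add_divide_distrib)
  have basis: "\<alpha> k (cvec (d k)) = 1" "\<alpha> k (cvec (w k)) = 0" "\<beta> k (cvec (d k)) = 0" "\<beta> k (cvec (w k)) = 1"
    if "k < length xs" for k
    using \<Delta>(3)[OF that] by (simp_all add: \<alpha>_def \<beta>_def \<Delta>_def)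
  define p where "p k = \<alpha> (Suc k) (B (xs ! k) *v cvec (d k))" for k
  define q where "q k = \<beta> (Suc k) (B (xs ! k) *v cvec (d k))" for k
  define r where "r k = \<alpha> (Suc k) (B (xs ! k) *v cvec (w k))" for k
  define s' where "s' k = \<beta> (Suc k) (B (xs ! k) *v cvec (w k))" for k
  have err: "norm (B j *v cvec x - cvec (A j *v x)) \<le> \<theta> * c ^ 3 / 2" if "norm x \<le> 1 / c" for j x
  proof -
    have "cmod ((B j *v cvec x - cvec (A j *v x)) $ i) \<le> \<theta> * c ^ 3 / 4" for i
    proof -
      have "(B j *v cvec x - cvec (A j *v x)) $ i = (\<Sum>l\<in>UNIV. (B j $ i $ l - of_real (A j $ i $ l)) * of_real (x $ l))"
        by (simp add: matrix_vector_mult_def sum_subtractf left_diff_distrib)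
      also have "cmod \<dots> \<le> (\<Sum>l\<in>(UNIV::2 set). \<theta> * c ^ 4 / 8 * (1 / c))"
      proof (rule order_trans[OF norm_sum], rule sum_mono)
        fix l :: 2
        have "\<bar>x $ l\<bar> \<le> 1 / c"
          using component_le_norm_cart[of x l] that by linarith
        then show "cmod ((B j $ i $ l - of_real (A j $ i $ l)) * of_real (x $ l)) \<le> \<theta> * c ^ 4 / 8 * (1 / c)"
          unfolding norm_mult using near[of j i l] c \<theta>_facts by (intro mult_mono) auto
      qed
      also have "\<dots> = \<theta> * c ^ 3 / 4"
        using c by (simp add: field_simps power4_eq_xxxx power3_eq_cube)
      finally show ?thesis .
    qed
    then have "(\<Sum>i\<in>(UNIV::2 set). cmod ((B j *v cvec x - cvec (A j *v x)) $ i)) \<le> (\<Sum>i\<in>(UNIV::2 set). \<theta> * c ^ 3 / 4)"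
      by (rule sum_mono)
    moreover have "norm (B j *v cvec x - cvec (A j *v x)) \<le> (\<Sum>i\<in>(UNIV::2 set). cmod ((B j *v cvec x - cvec (A j *v x)) $ i))"
      unfolding norm_vec_def by (rule L2_set_le_sum) auto
    ultimately show ?thesis
      by (simp add: sum_2)
  qed
  have coord: "cmod (\<alpha> k y) \<le> \<theta> * c" "cmod (\<beta> k y) \<le> \<theta> * c"
    if "norm y \<le> \<theta> * c ^ 3 / 2" "k < length xs" for y k
  proof -
    have bd: "cmod z / cmod (\<Delta> k) \<le> \<theta> * c" if "cmod z \<le> 2 * (\<theta> * c ^ 3 / 2) * (1 / c)" for z
    proof -
      have "cmod z / cmod (\<Delta> k) \<le> (2 * (\<theta> * c ^ 3 / 2) * (1 / c)) / c"
        using that \<Delta>(1)[OF \<open>k < length xs\<close>] c \<theta>_facts by (intro frac_le) auto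
      also have "\<dots> = \<theta> * c"
        using c by (simp add: power3_eq_cube)
      finally show ?thesis .
    qed
    have "cmod (det2 y (cvec (w k))) \<le> 2 * (\<theta> * c ^ 3 / 2) * (1 / c)"
      using dw[OF that(2)] c \<theta>_facts that(1)
      by (intro order_trans[OF norm_det2_le] mult_mono) auto
    then show "cmod (\<alpha> k y) \<le> \<theta> * c"
      unfolding \<alpha>_def norm_divide by (rule bd)
    have "cmod (det2 (cvec (d k)) y) \<le> 2 * (1 / c) * (\<theta> * c ^ 3 / 2)"
      using dw[OF that(2)] c \<theta>_facts that(1)
      by (intro order_trans[OF norm_det2_le] mult_mono) auto
    then show "cmod (\<beta> k y) \<le> \<theta> * c"
      unfolding \<beta>_def norm_divide by (intro bd) (simp add: mult_ac)
  qed
  have pqrs: "cmod (p k - of_real (a k)) \<le> \<theta> * \<bar>a k\<bar>" "cmod (q k) \<le> \<theta> * \<bar>a k\<bar>"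
    "cmod (r k) \<le> \<theta> * \<bar>a k\<bar>" "cmod (s' k - of_real (b k)) \<le> \<theta> * \<bar>a k\<bar>"
    if k: "Suc k < length xs" for k
  proof -
    have le: "\<theta> * c \<le> \<theta> * \<bar>a k\<bar>"
      using ab[OF k] \<theta>_facts by (intro mult_left_mono) auto
    define ed where "ed = B (xs ! k) *v cvec (d k) - cvec (A (xs ! k) *v d k)"
    define ew where "ew = B (xs ! k) *v cvec (w k) - cvec (A (xs ! k) *v w k)"
    have e: "norm ed \<le> \<theta> * c ^ 3 / 2" "norm ew \<le> \<theta> * c ^ 3 / 2"
      using err dw[of k] k by (simp_all add: ed_def ew_def)
    have "B (xs ! k) *v cvec (d k) = of_real (a k) *s cvec (d (Suc k)) + ed"
      "B (xs ! k) *v cvec (w k) = of_real (b k) *s cvec (w (Suc k)) + ew"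
      using ab[OF k] by (simp_all add: ed_def ew_def cvec_smult)
    then have "p k - of_real (a k) = \<alpha> (Suc k) ed" "q k = \<beta> (Suc k) ed"
      "r k = \<alpha> (Suc k) ew" "s' k - of_real (b k) = \<beta> (Suc k) ew"
      by (simp_all add: p_def q_def r_def s'_def lin basis[OF k])
    then show "cmod (p k - of_real (a k)) \<le> \<theta> * \<bar>a k\<bar>" "cmod (q k) \<le> \<theta> * \<bar>a k\<bar>"
      "cmod (r k) \<le> \<theta> * \<bar>a k\<bar>" "cmod (s' k - of_real (b k)) \<le> \<theta> * \<bar>a k\<bar>"
      using coord[OF e(1) k] coord[OF e(2) k] le by simp_all
  qed
  have step: "\<alpha> (Suc k) (B (xs ! k) *v x) = p k * \<alpha> k x + r k * \<beta> k x"
    "\<beta> (Suc k) (B (xs ! k) *v x) = q k * \<alpha> k x + s' k * \<beta> k x" if k: "Suc k < length xs" for k x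
  proof -
    have "B (xs ! k) *v x = \<alpha> k x *s (B (xs ! k) *v cvec (d k)) + \<beta> k x *s (B (xs ! k) *v cvec (w k))"
      using k by (subst expand[of k x]) (simp_all add: matrix_vector_right_distrib vector_scalar_commute)
    then show "\<alpha> (Suc k) (B (xs ! k) *v x) = p k * \<alpha> k x + r k * \<beta> k x"
      "\<beta> (Suc k) (B (xs ! k) *v x) = q k * \<alpha> k x + s' k * \<beta> k x"
      by (simp_all add: lin p_def q_def r_def s'_def)
  qed
  have word_prod_Suc: "word_prod B (take (Suc k) xs) = B (xs ! k) ** word_prod B (take k xs)" if "Suc k < length xs" for k
    using that by (simp add: take_Suc_conv_app_nth word_prod_append)
  \<comment> \<open>Guaranteed growth of the dominant coordinate of a vector that starts in the
    cone.\<close>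
  define pra where "pra k = (\<Prod>j<k. (1 - 2 * \<theta>) * \<bar>a j\<bar>)" for k
  have pra_Suc: "pra (Suc k) = pra k * ((1 - 2 * \<theta>) * \<bar>a k\<bar>)" for k
    by (simp add: pra_def)
  have cone: "k < length xs \<Longrightarrow> cmod (\<beta> 0 x) \<le> cmod (\<alpha> 0 x) \<Longrightarrow>
      cmod (\<beta> k (word_prod B (take k xs) *v x)) \<le> cmod (\<alpha> k (word_prod B (take k xs) *v x)) \<and>
      pra k * cmod (\<alpha> 0 x) \<le> cmod (\<alpha> k (word_prod B (take k xs) *v x)) \<and> 0 < pra k" for k x
  proof (induction k)
    case (Suc k)
    define y where "y = word_prod B (take k xs) *v x"
    have IH: "cmod (\<beta> k y) \<le> cmod (\<alpha> k y)" "pra k * cmod (\<alpha> 0 x) \<le> cmod (\<alpha> k y)" "0 < pra k"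
      using Suc by (auto simp: y_def)
    have y: "word_prod B (take (Suc k) xs) *v x = B (xs ! k) *v y"
      unfolding y_def word_prod_Suc[OF Suc.prems(1)] by (simp add: matrix_vector_mul_assoc)
    note cs = cone_step(1,2)[OF \<kappa> \<theta> pqrs[OF Suc.prems(1)], where x = "\<alpha> k y" and y = "\<beta> k y"]
    have "\<bar>b k\<bar> \<le> \<kappa> * \<bar>a k\<bar>" and ak: "0 < \<bar>a k\<bar>"
      using ab[OF Suc.prems(1)] c by auto
    then have 1: "(1 - 2 * \<theta>) * \<bar>a k\<bar> * cmod (\<alpha> k y) \<le> cmod (p k * \<alpha> k y + r k * \<beta> k y)"
      and 2: "cmod (q k * \<alpha> k y + s' k * \<beta> k y) \<le> cmod (p k * \<alpha> k y + r k * \<beta> k y)"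
      using cs IH(1) by auto
    have "pra (Suc k) * cmod (\<alpha> 0 x) = (1 - 2 * \<theta>) * \<bar>a k\<bar> * (pra k * cmod (\<alpha> 0 x))"
      by (simp add: pra_Suc)
    also have "\<dots> \<le> (1 - 2 * \<theta>) * \<bar>a k\<bar> * cmod (\<alpha> k y)"
      using IH(2) \<theta>_facts by (intro mult_left_mono) auto
    also note 1
    finally show ?case
      using 2 IH(3) ak \<theta>_facts by (simp add: y step[OF Suc.prems(1)] pra_Suc)
  qed (simp add: pra_def)
  have k0: "\<kappa>' > 0"
    using \<theta>_facts by (simp add: \<kappa>'_def)
  \<comment> \<open>The areas \<open>\<Delta> k\<close> of the frames telescope: what remains are
    the coordinate determinants of the steps and the two end factors.\<close>
  have dets: "k < length xs \<Longrightarrow>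
      cmod (det (word_prod B (take k xs))) * cmod (\<Delta> 0) \<le> \<kappa>' ^ k * (pra k)\<^sup>2 * cmod (\<Delta> k)" for k
  proof (induction k)
    case (Suc k)
    have k: "k < length xs" "Suc k < length xs"
      using Suc.prems by auto
    have "det (B (xs ! k)) * \<Delta> k = det2 (B (xs ! k) *v cvec (d k)) (B (xs ! k) *v cvec (w k))"
      by (simp add: det2_mult \<Delta>_def)
    also have "B (xs ! k) *v cvec (d k) = p k *s cvec (d (Suc k)) + q k *s cvec (w (Suc k))"
      unfolding p_def q_def by (rule expand[OF k(2)])
    also have "B (xs ! k) *v cvec (w k) = r k *s cvec (d (Suc k)) + s' k *s cvec (w (Suc k))"
      unfolding r_def s'_def by (rule expand[OF k(2)])
    also have "det2 (p k *s cvec (d (Suc k)) + q k *s cvec (w (Suc k))) (r k *s cvec (d (Suc k)) + s' k *s cvec (w (Suc k)))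
        = (p k * s' k - q k * r k) * \<Delta> (Suc k)"
      by (simp add: det2_simps \<Delta>_def det2_commute[of "cvec (w (Suc k))" "cvec (d (Suc k))"] algebra_simps)
    finally have *: "det (B (xs ! k)) * \<Delta> k = (p k * s' k - q k * r k) * \<Delta> (Suc k)" .
    have "cmod (p k * s' k - q k * r k) \<le> ((1 + \<theta>) * (\<kappa> + \<theta>) + \<theta>\<^sup>2) * \<bar>a k\<bar>\<^sup>2"
      using ab[OF k(2)] by (intro cone_step[OF \<kappa> \<theta> pqrs[OF k(2)]]) auto
    also have "\<dots> = \<kappa>' * ((1 - 2 * \<theta>) * \<bar>a k\<bar>)\<^sup>2"
      using \<theta>_facts by (simp add: \<kappa>'_def power_mult_distrib)
    finally have **: "cmod (p k * s' k - q k * r k) \<le> \<kappa>' * ((1 - 2 * \<theta>) * \<bar>a k\<bar>)\<^sup>2" .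
    have "cmod (det (word_prod B (take (Suc k) xs))) * cmod (\<Delta> 0) * cmod (\<Delta> k) =
        (cmod (det (word_prod B (take k xs))) * cmod (\<Delta> 0)) * cmod (det (B (xs ! k)) * \<Delta> k)"
      by (simp add: word_prod_Suc[OF k(2)] det_mul norm_mult)
    also have "\<dots> \<le> (\<kappa>' ^ k * (pra k)\<^sup>2 * cmod (\<Delta> k)) * (\<kappa>' * ((1 - 2 * \<theta>) * \<bar>a k\<bar>)\<^sup>2 * cmod (\<Delta> (Suc k)))"
    proof (rule mult_mono[OF Suc.IH[OF k(1)]])
      show "cmod (det (B (xs ! k)) * \<Delta> k) \<le> \<kappa>' * ((1 - 2 * \<theta>) * \<bar>a k\<bar>)\<^sup>2 * cmod (\<Delta> (Suc k))"
        unfolding * norm_mult by (rule mult_right_mono[OF **]) simp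
    qed (use k0 in auto)
    also have "\<dots> = \<kappa>' ^ Suc k * (pra (Suc k))\<^sup>2 * cmod (\<Delta> (Suc k)) * cmod (\<Delta> k)"
      by (simp add: pra_Suc power_mult_distrib)
    finally show ?case
      using \<Delta>(3)[OF k(1)] by simp
  qed (simp add: pra_def)
  define n where "n = length xs - 1"
  have n: "n < length xs"
    using xs(1) by (simp add: n_def)
  define M where "M = word_prod B (take n xs)"
  have M: "word_prod B (butlast xs) = M"
    by (simp add: M_def n_def butlast_conv_take)
  define P where "P = \<alpha> n (M *v cvec (d 0))"
  define Q where "Q = \<beta> n (M *v cvec (d 0))"
  define R where "R = \<alpha> n (M *v cvec (w 0))"
  define S where "S = \<beta> n (M *v cvec (w 0))"
  have len: "0 < length xs"
    using xs(1) by simp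
  have D0: "cmod Q \<le> cmod P" "pra n \<le> cmod P" "0 < pra n"
    using cone[OF n, of "cvec (d 0)"] basis[OF len] by (auto simp: P_def Q_def M_def)
  \<comment> \<open>The vectors \<open>d 0 + t * w 0\<close> with \<open>cmod t \<le> 1\<close> all
    start in the cone. Varying \<open>t\<close> controls the image of \<open>w 0\<close>, which
    itself lies outside the cone.\<close>
  have comb: "\<alpha> n (M *v (cvec (d 0) + t *s cvec (w 0))) = P + t * R"
     "\<beta> n (M *v (cvec (d 0) + t *s cvec (w 0))) = Q + t * S" for t
    by (simp_all add: P_def Q_def R_def S_def matrix_vector_right_distrib vector_scalar_commute lin)
  have cone': "cmod (Q + t * S) \<le> cmod (P + t * R)" "P + t * R \<noteq> 0" if "cmod t \<le> 1" for t
  proof -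
    have "cmod (Q + t * S) \<le> cmod (P + t * R) \<and> pra n * cmod (1 + t * 0) \<le> cmod (P + t * R)"
      using cone[OF n, of "cvec (d 0) + t *s cvec (w 0)"] that basis[OF len]
      unfolding M_def[symmetric] comb by (simp add: lin)
    then show "cmod (Q + t * S) \<le> cmod (P + t * R)" "P + t * R \<noteq> 0"
      using D0(3) by auto
  qed
  \<comment> \<open>\<open>P + t * R\<close> has no zero \<open>t\<close> in the complex unit disc.\<close>
  have RP: "cmod R \<le> cmod P"
  proof (rule ccontr)
    assume "\<not> cmod R \<le> cmod P"
    then have "R \<noteq> 0" "cmod (- P / R) \<le> 1"
      by (auto simp: norm_divide divide_le_eq)
    then show False
      using cone'(2)[of "- P / R"] by simp
  qed
  \<comment> \<open>\<open>S\<close> is \<open>(Q + S) - Q\<close>, whose modulus is at most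
    \<open>cmod (P + R) + cmod P\<close>.\<close>
  have SP: "cmod S \<le> 3 * cmod P"
    using cone'(1)[of 1] norm_triangle_ineq[of P R] norm_triangle_ineq4[of "Q + S" Q] RP D0(1)
    by simp
  \<comment> \<open>\<open>w n\<close> lies on the line of \<open>om\<close>, so the determinant
    against \<open>om\<close> reads off the dominant coordinate.\<close>
  have g: "P * \<Delta> n = of_real s * word_entry B v om xs"
  proof -
    have "P * \<Delta> n = det2 (M *v cvec (d 0)) (cvec (w n))"
      using \<Delta>(3)[OF n] by (simp add: P_def \<alpha>_def)
    also have "\<dots> = of_real s * word_entry B v om xs"
      using wn d0 by (simp add: n_def cvec_smult det2_simps word_entry_def M[unfolded M_def n_def] M_def)
    finally show ?thesis .
  qed
  have Pg: "cmod P \<le> cmod (word_entry B v om xs) / c\<^sup>2"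
  proof -
    have "cmod P * c \<le> cmod P * cmod (\<Delta> n)"
      using \<Delta>(1)[OF n] by (intro mult_left_mono) auto
    also have "\<dots> = \<bar>s\<bar> * cmod (word_entry B v om xs)"
      using arg_cong[OF g, of cmod] by (simp add: norm_mult)
    also have "\<dots> \<le> 1 / c * cmod (word_entry B v om xs)"
      using s by (intro mult_right_mono) auto
    finally show ?thesis
      using c by (simp add: field_simps power2_eq_square)
  qed
  show "word_entry B v om xs \<noteq> 0"
    using g \<Delta>(3)[OF n] D0 by auto
  show "cmod (det (word_prod B (butlast xs))) \<le> 2 / c ^ 7 * \<kappa>' ^ (length xs - 1) * (cmod (word_entry B v om xs))\<^sup>2"
  proof -
    have "cmod (det M) * c \<le> cmod (det M) * cmod (\<Delta> 0)"
      using \<Delta>(1)[OF len] by (intro mult_left_mono) auto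
    also have "\<dots> \<le> \<kappa>' ^ n * (pra n)\<^sup>2 * cmod (\<Delta> n)"
      using dets[OF n] by (simp add: M_def)
    \<comment> \<open>The exponent 7 of the claim collects 4 from the square of \<open>Pg\<close>, 2
      from \<open>\<Delta> n\<close> and 1 from the lower bound on
      \<open>\<Delta> 0\<close>.\<close>
    also have "\<dots> \<le> \<kappa>' ^ n * (cmod (word_entry B v om xs) / c\<^sup>2)\<^sup>2 * (2 / c\<^sup>2)"
      using k0 D0(2,3) Pg \<Delta>(2)[OF n] by (intro mult_mono power_mono) auto
    also have "\<dots> = (2 / c ^ 7 * \<kappa>' ^ n * (cmod (word_entry B v om xs))\<^sup>2) * c"
      using c by (simp add: power_divide field_simps flip: power_mult power_add power_Suc)
    finally have "cmod (det M) * c \<le> (2 / c ^ 7 * \<kappa>' ^ n * (cmod (word_entry B v om xs))\<^sup>2) * c" .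
    then show ?thesis
      using c unfolding M n_def by (rule mult_right_le_imp_le)
  qed
  show "cmod ((word_prod B (butlast xs) *v x) $ i) \<le> 12 / c ^ 5 * cmod (word_entry B v om xs) * norm x"
  proof -
    have bd: "cmod z / cmod (\<Delta> 0) \<le> 2 / c\<^sup>2 * norm x" if "cmod z \<le> 2 * (1 / c) * norm x" for z
    proof -
      have "cmod z / cmod (\<Delta> 0) \<le> (2 * (1 / c) * norm x) / c"
        using that \<Delta>(1)[OF len] c by (intro frac_le) auto
      then show ?thesis
        by (simp add: power2_eq_square)
    qed
    have "cmod (det2 x (cvec (w 0))) \<le> 2 * norm x * (1 / c)"
      using dw[OF len] by (intro order_trans[OF norm_det2_le] mult_left_mono) auto
    then have \<alpha>0: "cmod (\<alpha> 0 x) \<le> 2 / c\<^sup>2 * norm x"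
      unfolding \<alpha>_def norm_divide by (intro bd) (simp add: mult_ac)
    have "cmod (det2 (cvec (d 0)) x) \<le> 2 * (1 / c) * norm x"
      using dw[OF len] by (intro order_trans[OF norm_det2_le] mult_right_mono mult_left_mono) auto
    then have \<beta>0: "cmod (\<beta> 0 x) \<le> 2 / c\<^sup>2 * norm x"
      unfolding \<beta>_def norm_divide by (rule bd)
    have nth: "cmod (cvec (d n) $ i) \<le> 1 / c" "cmod (cvec (w n) $ i) \<le> 1 / c"
      using dw[OF n] component_le_norm_cart[of "d n" i] component_le_norm_cart[of "w n" i] by auto
    have Md: "cmod ((M *v cvec (d 0)) $ i) \<le> 2 * cmod P * (1 / c)"
    proof -
      have "(M *v cvec (d 0)) $ i = P * cvec (d n) $ i + Q * cvec (w n) $ i"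
        using arg_cong[OF expand[OF n, of "M *v cvec (d 0)"], of "\<lambda>y. y $ i"] by (simp add: P_def Q_def)
      also have "cmod \<dots> \<le> cmod P * cmod (cvec (d n) $ i) + cmod Q * cmod (cvec (w n) $ i)"
        by (metis norm_mult norm_triangle_ineq)
      also have "\<dots> \<le> cmod P * (1 / c) + cmod P * (1 / c)"
        using nth D0(1) c by (intro add_mono mult_mono) auto
      finally show ?thesis
        by simp
    qed
    have Mw: "cmod ((M *v cvec (w 0)) $ i) \<le> 4 * cmod P * (1 / c)"
    proof -
      have "(M *v cvec (w 0)) $ i = R * cvec (d n) $ i + S * cvec (w n) $ i"
        using arg_cong[OF expand[OF n, of "M *v cvec (w 0)"], of "\<lambda>y. y $ i"] by (simp add: R_def S_def)
      also have "cmod \<dots> \<le> cmod R * cmod (cvec (d n) $ i) + cmod S * cmod (cvec (w n) $ i)"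
        by (metis norm_mult norm_triangle_ineq)
      also have "\<dots> \<le> cmod P * (1 / c) + 3 * cmod P * (1 / c)"
        using nth RP SP c by (intro add_mono mult_mono) auto
      finally show ?thesis
        by simp
    qed
    have "M *v x = \<alpha> 0 x *s (M *v cvec (d 0)) + \<beta> 0 x *s (M *v cvec (w 0))"
      by (subst expand[OF len, of x]) (simp add: matrix_vector_right_distrib vector_scalar_commute)
    then have "(M *v x) $ i = \<alpha> 0 x * (M *v cvec (d 0)) $ i + \<beta> 0 x * (M *v cvec (w 0)) $ i"
      by simp
    then have "cmod ((M *v x) $ i) \<le> cmod (\<alpha> 0 x) * cmod ((M *v cvec (d 0)) $ i) + cmod (\<beta> 0 x) * cmod ((M *v cvec (w 0)) $ i)"
      by (metis norm_mult norm_triangle_ineq)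
    \<comment> \<open>The dominant and weak parts contribute 2 + 4, each multiplied by a coordinate
      of size \<open>2 / c^2\<close>; passing from \<open>P\<close> to \<open>g\<close> costs
      another \<open>1 / c^2\<close>.\<close>
    also have "\<dots> \<le> (2 / c\<^sup>2 * norm x) * (2 * cmod P * (1 / c)) + (2 / c\<^sup>2 * norm x) * (4 * cmod P * (1 / c))"
      using \<alpha>0 \<beta>0 Md Mw by (intro add_mono mult_mono) auto
    also have "\<dots> = 12 / c ^ 3 * norm x * cmod P"
      by (simp add: power2_eq_square power3_eq_cube field_simps)
    also have "\<dots> \<le> 12 / c ^ 3 * norm x * (cmod (word_entry B v om xs) / c\<^sup>2)"
      using Pg c by (intro mult_left_mono) auto
    also have "\<dots> = 12 / c ^ 5 * cmod (word_entry B v om xs) * norm x"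
      using c by (simp add: field_simps flip: power_add)
    finally show ?thesis
      by (simp add: M)
  qed
qed

section \<open>Stationary vectors of irreducible chains\<close>

text \<open>The all-ones matrix added to the transpose of \<open>1 - P\<close> builds the normalisation into the linear
  system: for stochastic \<open>P\<close> the solution of \<open>stat_matrix P *v x = 1\<close> is the stationary vector of mass \<open>1\<close>.\<close>

definition stat_matrix :: "('a::finite \<Rightarrow> 'a \<Rightarrow> 'b::comm_ring_1) \<Rightarrow> 'b^'a^'a" where
  "stat_matrix P = (\<chi> j i. (if i = j then 1 else 0) - P i j + 1)"

text \<open>Cramer's rule for the system above. The explicit quotient makes the stationary vector a
  rational, hence holomorphic, function of the transition entries.\<close>

definition stat_vec :: "('a::finite \<Rightarrow> 'a \<Rightarrow> 'b::field) \<Rightarrow> 'a \<Rightarrow> 'b" where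
  "stat_vec P k = det (\<chi> i j. if j = k then 1 else stat_matrix P $ i $ j) / det (stat_matrix P)"

lemma stat_matrix_mult:
  "(stat_matrix P *v x) $ j = x $ j - (\<Sum>i\<in>UNIV. x $ i * P i j) + (\<Sum>i\<in>UNIV. x $ i)"
  by (simp add: stat_matrix_def matrix_vector_mult_def algebra_simps sum.distrib sum_subtractf
      if_distrib[where f = "\<lambda>y. _ * y"] cong: if_cong)

lemma transpose_stat_matrix_mult:
  "(transpose (stat_matrix P) *v x) $ i = x $ i - (\<Sum>j\<in>UNIV. P i j * x $ j) + (\<Sum>j\<in>UNIV. x $ j)"
  by (simp add: stat_matrix_def transpose_def matrix_vector_mult_def algebra_simps sum.distrib sum_subtractf
      if_distrib[where f = "\<lambda>y. _ * y"] cong: if_cong)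

lemma stat_vec_unique:
  fixes P :: "'a::finite \<Rightarrow> 'a \<Rightarrow> 'b::field"
  assumes "det (stat_matrix P) \<noteq> 0"
  shows "(\<forall>j. x j - (\<Sum>i\<in>UNIV. x i * P i j) + (\<Sum>i\<in>UNIV. x i) = 1) \<longleftrightarrow> x = stat_vec P"
proof -
  have "stat_matrix P *v (\<chi> i. x i) = (\<chi> i. 1) \<longleftrightarrow> (\<chi> i. x i) = (\<chi> k. stat_vec P k)"
    using cramer[OF assms, of "\<chi> i. x i" "\<chi> i. 1"] by (simp only: stat_vec_def vec_lambda_beta)
  then show ?thesis
    by (auto simp: vec_eq_iff stat_matrix_mult fun_eq_iff)
qed

text \<open>Summing the linear equations over \<open>j\<close> cancels their first two terms because
  rows add up to 1. This forces mass 1, and each equation then reduces to invariance.\<close>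

lemma stat_vec_stationary:
  fixes P :: "'a::finite \<Rightarrow> 'a \<Rightarrow> 'b::field_char_0"
  assumes "det (stat_matrix P) \<noteq> 0" and rows: "\<And>i. (\<Sum>j\<in>UNIV. P i j) = 1"
  shows "(\<Sum>i\<in>UNIV. stat_vec P i) = 1" and "(\<Sum>i\<in>UNIV. stat_vec P i * P i j) = stat_vec P j"
proof -
  let ?p = "stat_vec P"
  have eq: "?p j - (\<Sum>i\<in>UNIV. ?p i * P i j) + (\<Sum>i\<in>UNIV. ?p i) = 1" for j
    using stat_vec_unique[OF assms(1)] by blast
  have "(\<Sum>j\<in>UNIV. \<Sum>i\<in>UNIV. ?p i * P i j) = (\<Sum>i\<in>UNIV. ?p i)"
    by (subst sum.swap) (simp add: sum_distrib_left[symmetric] rows)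
  moreover have "(\<Sum>j\<in>UNIV. ?p j - (\<Sum>i\<in>UNIV. ?p i * P i j) + (\<Sum>i\<in>UNIV. ?p i)) = of_nat CARD('a)"
    using eq by simp
  ultimately have "of_nat CARD('a) * (\<Sum>i\<in>UNIV. ?p i) = of_nat CARD('a)"
    by (simp add: sum.distrib sum_subtractf)
  then show "(\<Sum>i\<in>UNIV. ?p i) = 1"
    by simp
  then show "(\<Sum>i\<in>UNIV. stat_vec P i * P i j) = stat_vec P j"
    using eq[of j] by simp
qed

locale irreducible_chain =
  fixes P :: "'a::finite \<Rightarrow> 'a \<Rightarrow> real"
  assumes nonneg: "P i j \<ge> 0" and rows: "(\<Sum>j\<in>UNIV. P i j) = 1"
    and irreducible: "(i, j) \<in> {(i, j). P i j > 0}\<^sup>*"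
begin

text \<open>\<open>\<bar>q\<bar>\<close> is pointwise at most its image under \<open>P\<close>, and
  both have the same total, so they agree.\<close>

lemma abs_invariant:
  assumes "\<And>j. (\<Sum>i\<in>UNIV. q i * P i j) = q j"
  shows "(\<Sum>i\<in>UNIV. \<bar>q i\<bar> * P i j) = \<bar>q j\<bar>"
proof -
  have le: "\<bar>q j\<bar> \<le> (\<Sum>i\<in>UNIV. \<bar>q i\<bar> * P i j)" for j
    using sum_abs[of "\<lambda>i. q i * P i j" UNIV] nonneg by (simp add: assms abs_mult)
  have "(\<Sum>j\<in>UNIV. (\<Sum>i\<in>UNIV. \<bar>q i\<bar> * P i j) - \<bar>q j\<bar>) = 0"
    unfolding sum_subtractf by (subst sum.swap) (simp add: sum_distrib_left[symmetric] rows)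
  then have "\<forall>j\<in>UNIV. (\<Sum>i\<in>UNIV. \<bar>q i\<bar> * P i j) - \<bar>q j\<bar> = 0"
    using le by (subst (asm) sum_nonneg_eq_0_iff) auto
  then show ?thesis
    by simp
qed

lemma invariant_positive:
  assumes inv: "\<And>j. (\<Sum>i\<in>UNIV. u i * P i j) = u j" and "\<And>i. u i \<ge> 0" and "u i > 0"
  shows "u k > 0"
  using irreducible[of i k]
proof (induction rule: rtrancl_induct)
  case (step j k)
  have "0 < u j * P j k"
    using step by simp
  also have "\<dots> \<le> (\<Sum>i\<in>UNIV. u i * P i k)"
    using assms(2) nonneg by (intro member_le_sum) auto
  finally show ?case
    using inv by simp
qed (use assms in auto)

text \<open>If \<open>q\<close> took both signs, \<open>\<bar>q\<bar> + q\<close> would be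
  nonnegative, invariant and positive somewhere, yet zero where \<open>q\<close> is negative,
  against irreducibility.\<close>

lemma invariant_sum_zero:
  assumes inv: "\<And>j. (\<Sum>i\<in>UNIV. q i * P i j) = q j" and sum: "(\<Sum>i\<in>UNIV. q i) = 0"
  shows "q i = 0"
proof -
  have no_pos: "\<not> (\<exists>i. q i > 0)" if inv: "\<And>j. (\<Sum>i\<in>UNIV. q i * P i j) = q j"
    and sum: "(\<Sum>i\<in>UNIV. q i) = 0" for q
  proof
    assume "\<exists>i. q i > 0"
    then obtain i where i: "q i > 0" ..
    have "\<exists>k. q k < 0"
    proof (rule ccontr)
      assume "\<nexists>k. q k < 0"
      then have "q i \<le> (\<Sum>i\<in>UNIV. q i)"
        by (intro member_le_sum) (auto simp: not_less)
      then show False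
        using i sum by simp
    qed
    then obtain k where k: "q k < 0" ..
    have "0 < \<bar>q k\<bar> + q k"
    proof (rule invariant_positive[of "\<lambda>i. \<bar>q i\<bar> + q i" i k])
      show "(\<Sum>i\<in>UNIV. (\<bar>q i\<bar> + q i) * P i j) = \<bar>q j\<bar> + q j" for j
        by (simp add: distrib_right sum.distrib inv abs_invariant)
    qed (use i in auto)
    then show False
      using k by simp
  qed
  have "\<not> (\<exists>i. - q i > 0)"
    by (rule no_pos) (simp_all add: sum_negf inv sum)
  then have "\<not> - q i > 0" "\<not> q i > 0"
    using no_pos[OF inv sum] by blast+
  then show ?thesis
    by simp
qed

text \<open>A kernel vector has total 0, by summing its equations; it is then invariant and vanishes
  by \<open>invariant_sum_zero\<close>.\<close>

lemma det_stat_matrix: "det (stat_matrix P) \<noteq> 0"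
proof -
  have "x = 0" if "stat_matrix P *v x = 0" for x
  proof -
    have eq: "x $ j - (\<Sum>i\<in>UNIV. x $ i * P i j) + (\<Sum>i\<in>UNIV. x $ i) = 0" for j
      using that by (simp add: vec_eq_iff stat_matrix_mult)
    have "(\<Sum>j\<in>UNIV. \<Sum>i\<in>UNIV. x $ i * P i j) = (\<Sum>i\<in>UNIV. x $ i)"
      by (subst sum.swap) (simp add: sum_distrib_left[symmetric] rows)
    moreover have "(\<Sum>j\<in>UNIV. x $ j - (\<Sum>i\<in>UNIV. x $ i * P i j) + (\<Sum>i\<in>UNIV. x $ i)) = 0"
      using eq by simp
    ultimately have 0: "(\<Sum>i\<in>UNIV. x $ i) = 0"
      by (simp add: sum.distrib sum_subtractf)
    have "(\<Sum>i\<in>UNIV. x $ i * P i j) = x $ j" for j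
      using eq[of j] 0 by linarith
    then have "x $ i = 0" for i
      by (rule invariant_sum_zero[of "\<lambda>i. x $ i"]) (rule 0)
    then show ?thesis
      by (simp add: vec_eq_iff)
  qed
  then obtain B where "B ** stat_matrix P = mat 1"
    using matrix_left_invertible_ker[of "stat_matrix P"] by blast
  then have "det B * det (stat_matrix P) = 1"
    using det_mul[of B "stat_matrix P"] by simp
  then show ?thesis
    by auto
qed

text \<open>Nonnegativity comes from uniqueness: the normalised absolute values solve the same
  linear system.\<close>

lemma stationary_stat_vec: "stationary_vec P (stat_vec P)"
proof -
  let ?p = "stat_vec P"
  note st = stat_vec_stationary[OF det_stat_matrix rows]
  define S where "S = (\<Sum>i\<in>UNIV. \<bar>?p i\<bar>)"
  have "S \<ge> 1"
    using sum_abs[of ?p UNIV] st(1) by (simp add: S_def)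
  moreover have "(\<Sum>i\<in>UNIV. \<bar>?p i\<bar> / S * P i j) = \<bar>?p j\<bar> / S" for j
    using abs_invariant[of ?p j] st(2) by (simp add: sum_divide_distrib[symmetric])
  moreover have "(\<Sum>i\<in>UNIV. \<bar>?p i\<bar> / S) = 1"
    using \<open>S \<ge> 1\<close> by (simp add: sum_divide_distrib[symmetric] S_def)
  ultimately have "(\<lambda>i. \<bar>?p i\<bar> / S) = ?p"
    using stat_vec_unique[OF det_stat_matrix, of "\<lambda>i. \<bar>?p i\<bar> / S"] by auto
  then have "?p i \<ge> 0" for i
  proof -
    have "?p i = \<bar>?p i\<bar> / S"
      using fun_cong[OF \<open>(\<lambda>i. \<bar>?p i\<bar> / S) = ?p\<close>, of i] by simp
    also have "\<dots> \<ge> 0"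
      using \<open>S \<ge> 1\<close> by (intro divide_nonneg_nonneg) auto
    finally show ?thesis .
  qed
  then show ?thesis
    using st by (simp add: stationary_vec_def)
qed

lemma stationary_vec_eq: "stationary_vec P p \<longleftrightarrow> p = stat_vec P"
  using stat_vec_unique[OF det_stat_matrix, of p] stationary_stat_vec
  by (auto simp: stationary_vec_def)

text \<open>The transposed normalised system is solvable for every right-hand side. Pairing it with
  \<open>p\<close> shows that the solution has total 0, so the normalising term drops out.\<close>

lemma poisson_equation:
  assumes p: "stationary_vec P p" and "(\<Sum>i\<in>UNIV. p i * f i) = 0"
  obtains h where "\<And>i. h i - (\<Sum>j\<in>UNIV. P i j * h j) = f i"
proof -
  have "det (transpose (stat_matrix P)) \<noteq> 0"
    using det_stat_matrix by (simp add: det_transpose)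
  then obtain h where h: "transpose (stat_matrix P) *v h = (\<chi> i. f i)"
    using cramer by blast
  have eq: "h $ i - (\<Sum>j\<in>UNIV. P i j * h $ j) + (\<Sum>j\<in>UNIV. h $ j) = f i" for i
    using arg_cong[OF h, of "\<lambda>x. x $ i"] by (simp only: transpose_stat_matrix_mult vec_lambda_beta)
  have "(\<Sum>i\<in>UNIV. p i * (\<Sum>j\<in>UNIV. P i j * h $ j)) = (\<Sum>j\<in>UNIV. (\<Sum>i\<in>UNIV. p i * P i j) * h $ j)"
    by (simp add: sum_distrib_left sum_distrib_right mult.assoc) (rule sum.swap)
  also have "\<dots> = (\<Sum>j\<in>UNIV. p j * h $ j)"
    using p by (simp add: stationary_vec_def)
  finally have 1: "(\<Sum>i\<in>UNIV. p i * (\<Sum>j\<in>UNIV. P i j * h $ j)) = (\<Sum>j\<in>UNIV. p j * h $ j)" .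
  have "0 = (\<Sum>i\<in>UNIV. p i * (h $ i - (\<Sum>j\<in>UNIV. P i j * h $ j) + (\<Sum>j\<in>UNIV. h $ j)))"
    using assms(2) by (simp add: eq)
  also have "\<dots> = (\<Sum>i\<in>UNIV. p i) * (\<Sum>j\<in>UNIV. h $ j)"
    using 1 by (simp add: distrib_left right_diff_distrib sum.distrib sum_subtractf sum_distrib_right)
  finally have "(\<Sum>j\<in>UNIV. h $ j) = 0"
    using p by (simp add: stationary_vec_def)
  with eq show ?thesis
    by (intro that[of "\<lambda>i. h $ i"]) simp
qed

end

section \<open>Existence of Markov measures\<close>

text \<open>A Markov chain is driven by independent random maps: the state after step \<open>k\<close> is the image of
  the state before it under a random map whose value at \<open>i\<close> has distribution \<open>P i\<close>.\<close>

primrec trajectory :: "(nat \<Rightarrow> 'a \<Rightarrow> 'a) \<Rightarrow> nat \<Rightarrow> 'a" where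
  "trajectory \<omega> 0 = \<omega> 0 undefined"
| "trajectory \<omega> (Suc k) = \<omega> (Suc k) (trajectory \<omega> k)"

lemma finite_pmf:
  fixes p :: "'a::finite \<Rightarrow> real"
  assumes "\<And>i. p i \<ge> 0" "(\<Sum>i\<in>UNIV. p i) = 1"
  obtains q where "\<And>i. pmf q i = p i"
proof (rule that[of "embed_pmf p"], rule pmf_embed_pmf)
  show "(\<integral>\<^sup>+ x. ennreal (p x) \<partial>count_space UNIV) = 1"
    using assms by (simp add: nn_integral_count_space_finite sum_ennreal)
qed (use assms in auto)

lemma markov_measure_exists:
  fixes P :: "'a::finite \<Rightarrow> 'a \<Rightarrow> real"
  assumes p: "stationary_vec P p" and nonneg: "\<And>i j. P i j \<ge> 0" and rows: "\<And>i. (\<Sum>j\<in>UNIV. P i j) = 1"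
  shows "\<exists>\<mu>. markov_measure P p \<mu>"
proof -
  obtain pp where pp: "\<And>i. pmf pp i = p i"
    using finite_pmf[of p] p by (auto simp: stationary_vec_def)
  have "\<forall>i. \<exists>q. \<forall>j. pmf q j = P i j"
    using finite_pmf nonneg rows by metis
  then obtain q where q: "\<And>i j. pmf (q i) j = P i j"
    by metis
  \<comment> \<open>The map at time 0 is constant with a random value, so its value at the arbitrary
    argument \<open>undefined\<close> is the initial state.\<close>
  define F :: "nat \<Rightarrow> ('a \<Rightarrow> 'a) pmf" where
    "F n = (if n = 0 then map_pmf (\<lambda>i _. i) pp else Pi_pmf UNIV undefined q)" for n
  define N where "N = PiM UNIV (\<lambda>n. measure_pmf (F n))"
  interpret product_prob_space "\<lambda>n. measure_pmf (F n)" UNIV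
    by unfold_locales
  have space_N: "space N = UNIV"
    by (simp add: N_def space_PiM)
  interpret N: prob_space N
    unfolding N_def by (rule P.prob_space_axioms)
  have coord: "(\<lambda>\<omega>. \<omega> n i) \<in> measurable N (count_space UNIV)" for n i
  proof -
    have "(\<lambda>\<omega>. \<omega> n) \<in> measurable N (measure_pmf (F n))"
      unfolding N_def by (rule measurable_component_singleton) simp
    moreover have "(\<lambda>h. h i) \<in> measurable (measure_pmf (F n)) (count_space UNIV)"
      by simp
    ultimately show ?thesis
      by (rule measurable_compose)
  qed
  have traj: "(\<lambda>\<omega>. trajectory \<omega> k) \<in> measurable N (count_space UNIV)" for k
  proof (induction k)
    case 0
    then show ?case
      using coord[of 0 undefined] by simp
  next
    case (Suc k)
    then show ?case
      using measurable_compose_countable[of "\<lambda>i \<omega>. \<omega> (Suc k) i" N "count_space UNIV", OF coord Suc] by simp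
  qed
  have meas: "trajectory \<in> measurable N (PiM UNIV (\<lambda>_. count_space UNIV))"
    using traj by (intro measurable_PiM_single') (auto simp: space_PiM)
  define \<mu> where "\<mu> = distr N (PiM UNIV (\<lambda>_. count_space (UNIV :: 'a set))) trajectory"
  have "measure \<mu> {x. \<forall>k\<le>n. x k = w k} = p (w 0) * (\<Prod>k<n. P (w k) (w (Suc k)))" for n w
  proof -
    \<comment> \<open>As long as the path follows \<open>w\<close>, only the value of the next map
      at the current letter matters; this turns a cylinder of paths into a product event for the
      maps.\<close>
    define B where "B k = (case k of 0 \<Rightarrow> {h. h undefined = w 0} | Suc k' \<Rightarrow> {h. h (w k') = w (Suc k')})" for k
    have B: "measure (measure_pmf (F k)) (B k) = (case k of 0 \<Rightarrow> p (w 0) | Suc k' \<Rightarrow> P (w k') (w (Suc k')))" for k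
    proof (cases k)
      case 0
      have "(\<lambda>i _. i) -` B 0 = {w 0}"
        by (auto simp: B_def)
      then show ?thesis
        using 0 by (simp add: F_def measure_map_pmf measure_pmf_single pp)
    next
      case (Suc k')
      have "B k = (\<lambda>h. h (w k')) -` {w (Suc k')}"
        using Suc by (auto simp: B_def)
      then have "measure (measure_pmf (F k)) (B k) = pmf (map_pmf (\<lambda>h. h (w k')) (Pi_pmf UNIV undefined q)) (w (Suc k'))"
        using Suc by (simp add: F_def pmf_map)
      also have "\<dots> = P (w k') (w (Suc k'))"
        by (subst Pi_pmf_component) (simp_all add: q)
      finally show ?thesis
        using Suc by simp
    qed
    have set_eq: "(\<forall>k\<le>n. trajectory \<omega> k = w k) \<longleftrightarrow> (\<forall>k\<le>n. \<omega> k \<in> B k)" for \<omega>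
    proof (induction n)
      case (Suc n)
      have "(\<forall>k\<le>Suc n. trajectory \<omega> k = w k) \<longleftrightarrow> (\<forall>k\<le>n. trajectory \<omega> k = w k) \<and> trajectory \<omega> (Suc n) = w (Suc n)"
        by (auto simp: le_Suc_eq)
      also have "\<dots> \<longleftrightarrow> (\<forall>k\<le>n. trajectory \<omega> k = w k) \<and> \<omega> (Suc n) \<in> B (Suc n)"
        by (auto simp: B_def)
      also have "\<dots> \<longleftrightarrow> (\<forall>k\<le>Suc n. \<omega> k \<in> B k)"
        unfolding Suc by (auto simp: le_Suc_eq)
      finally show ?case .
    qed (simp add: B_def)
    have "{x. \<forall>k\<le>n. x k = w k} = (\<Pi>\<^sub>E k\<in>UNIV. if k \<le> n then {w k} else UNIV)"
      by (auto simp: PiE_def Pi_def split: if_splits)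
    also have "\<dots> \<in> sets (PiM UNIV (\<lambda>_. count_space (UNIV :: 'a set)))"
      by (rule sets_PiM_I_countable) auto
    finally have sets: "{x. \<forall>k\<le>n. x k = w k} \<in> sets (PiM UNIV (\<lambda>_. count_space (UNIV :: 'a set)))" .
    have "measure \<mu> {x. \<forall>k\<le>n. x k = w k} = measure N (trajectory -` {x. \<forall>k\<le>n. x k = w k} \<inter> space N)"
      unfolding \<mu>_def by (rule measure_distr[OF meas sets])
    also have "trajectory -` {x. \<forall>k\<le>n. x k = w k} \<inter> space N
        = prod_emb UNIV (\<lambda>n. measure_pmf (F n)) {..n} (PiE {..n} B)"
      by (auto simp: space_N prod_emb_def set_eq PiE_def Pi_def)
    also have "measure N \<dots> = (\<Prod>k\<le>n. measure (measure_pmf (F k)) (B k))"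
      unfolding N_def by (rule measure_PiM_emb) auto
    also have "\<dots> = (\<Prod>k\<le>n. case k of 0 \<Rightarrow> p (w 0) | Suc k' \<Rightarrow> P (w k') (w (Suc k')))"
      by (simp add: B)
    also have "\<dots> = p (w 0) * (\<Prod>k<n. P (w k) (w (Suc k)))"
      by (simp add: prod.atMost_shift)
    finally show ?thesis .
  qed
  moreover have "prob_space \<mu>"
    unfolding \<mu>_def by (rule N.prob_space_distr[OF meas])
  ultimately show ?thesis
    by (intro exI[of _ \<mu>]) (simp add: markov_measure_def \<mu>_def)
qed

section \<open>Law of large numbers for words of a Markov chain\<close>

abbreviation words :: "nat \<Rightarrow> 'a list set" where
  "words n \<equiv> {u. length u = n}"

lemma finite_words [simp]: "finite (words n :: 'a::finite list set)"
  using finite_lists_length_eq[of "UNIV :: 'a set" n] by simp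

lemma sum_words_Cons: "(\<Sum>u\<in>words (Suc n). f u) = (\<Sum>i\<in>UNIV. \<Sum>u\<in>words n. f (i # u))"
  for f :: "'a::finite list \<Rightarrow> 'b::comm_monoid_add"
proof -
  have "(\<Sum>u\<in>words (Suc n). f u) = (\<Sum>(i, u)\<in>UNIV \<times> words n. f (i # u))"
    by (rule sum.reindex_bij_witness[where i = "\<lambda>(i, u). i # u" and j = "\<lambda>u. (hd u, tl u)"])
      (auto simp: length_Suc_conv)
  then show ?thesis
    by (simp add: sum.cartesian_product)
qed

lemma sum_words_snoc: "(\<Sum>u\<in>words (Suc n). f u) = (\<Sum>u\<in>words n. \<Sum>j\<in>UNIV. f (u @ [j]))"
  for f :: "'a::finite list \<Rightarrow> 'b::comm_monoid_add"
proof -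
  have "(\<Sum>u\<in>words (Suc n). f u) = (\<Sum>(u, j)\<in>words n \<times> UNIV. f (u @ [j]))"
    by (rule sum.reindex_bij_witness[where i = "\<lambda>(u, j). u @ [j]" and j = "\<lambda>u. (butlast u, last u)"])
      (auto intro!: append_butlast_last_id arg_cong[where f = f])
  then show ?thesis
    by (simp add: sum.cartesian_product)
qed

fun trans_prod :: "('a \<Rightarrow> 'a \<Rightarrow> 'b::comm_semiring_1) \<Rightarrow> 'a list \<Rightarrow> 'b" where
  "trans_prod P (i # j # u) = P i j * trans_prod P (j # u)"
| "trans_prod P _ = 1"

definition path_weight :: "('a \<Rightarrow> 'b::comm_semiring_1) \<Rightarrow> ('a \<Rightarrow> 'a \<Rightarrow> 'b) \<Rightarrow> 'a list \<Rightarrow> 'b" where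
  "path_weight p P u = p (hd u) * trans_prod P u"

lemma trans_prod_Cons: "u \<noteq> [] \<Longrightarrow> trans_prod P (i # u) = P i (hd u) * trans_prod P u"
  by (cases u) auto

lemma trans_prod_snoc: "u \<noteq> [] \<Longrightarrow> trans_prod P (u @ [j]) = trans_prod P u * P (last u) j"
  by (induction P u rule: trans_prod.induct) (auto simp: mult.assoc)

lemma trans_prod_eq_prod: "trans_prod P (map x [0..<Suc n]) = (\<Prod>k<n. P (x k) (x (Suc k)))"
proof (induction n)
  case (Suc n)
  have "map x [0..<Suc (Suc n)] = map x [0..<Suc n] @ [x (Suc n)]"
    by simp
  then show ?case
    using Suc by (simp add: trans_prod_snoc del: upt_Suc) simp
qed simp

lemma path_weight_snoc: "u \<noteq> [] \<Longrightarrow> path_weight p P (u @ [j]) = path_weight p P u * P (last u) j"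
  by (simp add: path_weight_def trans_prod_snoc mult.assoc)

lemma sum_path_weight_Cons:
  fixes p :: "'a::finite \<Rightarrow> 'b::comm_semiring_1"
  assumes "\<And>j. (\<Sum>i\<in>UNIV. p i * P i j) = p j" "u \<noteq> []"
  shows "(\<Sum>i\<in>UNIV. path_weight p P (i # u)) = path_weight p P u"
  using assms by (simp add: path_weight_def trans_prod_Cons mult.assoc[symmetric] sum_distrib_right[symmetric])

text \<open>From \<open>j^2\<close> to a time before the next square there are at most
  \<open>2 * j\<close> steps, so bounded increments change \<open>s\<close> by at most
  \<open>2 * C * j\<close>, which is negligible against \<open>j^2\<close>.\<close>

lemma averages_tendsto_0_of_squares:
  fixes s :: "nat \<Rightarrow> real"
  assumes inc: "\<And>n. \<bar>s (Suc n) - s n\<bar> \<le> C"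
    and sq: "(\<lambda>j. s ((Suc j)\<^sup>2) / real ((Suc j)\<^sup>2)) \<longlonglongrightarrow> 0"
  shows "(\<lambda>n. s n / real n) \<longlonglongrightarrow> 0"
proof -
  have C: "C \<ge> 0"
    using inc[of 0] by linarith
  have lip: "\<bar>s (m + k) - s m\<bar> \<le> C * real k" for m k
  proof (induction k)
    case (Suc k)
    then show ?case
      using inc[of "m + k"] by (simp add: algebra_simps)
  qed simp
  define g where "g j = \<bar>s (j\<^sup>2) / real (j\<^sup>2)\<bar> + 2 * C / real j" for j
  have "(\<lambda>j. g (Suc j)) \<longlonglongrightarrow> \<bar>0\<bar> + 0"
    unfolding g_def
    by (intro tendsto_add tendsto_rabs sq LIMSEQ_Suc[OF lim_const_over_n])
  then have g: "g \<longlonglongrightarrow> 0"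
    by (simp add: filterlim_sequentially_Suc)
  have "filterlim floor_sqrt at_top sequentially"
    unfolding filterlim_at_top eventually_at_top_linorder le_floor_sqrt_iff by blast
  then have lim: "(\<lambda>n. g (floor_sqrt n)) \<longlonglongrightarrow> 0"
    by (rule filterlim_compose[OF g])
  have "\<bar>s n / real n\<bar> \<le> g (floor_sqrt n)" if n: "n \<ge> 1" for n
  proof -
    define j where "j = floor_sqrt n"
    have j: "j\<^sup>2 \<le> n" "n < (Suc j)\<^sup>2" "j \<ge> 1"
      using n Suc_floor_sqrt_power2_gt[of n] by (auto simp: j_def Suc_le_eq)
    define k where "k = n - j\<^sup>2"
    have k: "n = j\<^sup>2 + k" "k \<le> 2 * j"
      using j by (auto simp: k_def power2_eq_square)
    have jpos: "0 < real (j\<^sup>2)"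
      using j(3) by simp
    have "\<bar>s n\<bar> \<le> \<bar>s (j\<^sup>2)\<bar> + C * real k"
      using lip[of "j\<^sup>2" k] unfolding k(1) by linarith
    also have "\<dots> \<le> \<bar>s (j\<^sup>2)\<bar> + C * (2 * real j)"
      using k(2) C by (intro add_left_mono mult_left_mono) auto
    finally have "\<bar>s n\<bar> / real n \<le> (\<bar>s (j\<^sup>2)\<bar> + C * (2 * real j)) / real (j\<^sup>2)"
      using j jpos n C by (intro frac_le) (auto simp del: of_nat_power)
    also have "\<dots> = g j"
      using j(3) jpos by (simp add: g_def abs_divide add_divide_distrib power2_eq_square)
    finally show ?thesis
      by (simp add: j_def)
  qed
  then show ?thesis
    by (intro Lim_null_comparison[OF _ lim]) (auto simp: eventually_at_top_linorder)
qed

text \<open>Orthogonality bounds the second moment of the sum by \<open>n * C^2\<close>. The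
  averages at square times therefore have summable second moments and converge almost surely;
  bounded increments fill the gaps.\<close>

lemma (in prob_space) slln_orthogonal:
  fixes D :: "nat \<Rightarrow> 'a \<Rightarrow> real"
  assumes [measurable]: "\<And>k. D k \<in> borel_measurable M" and bd: "\<And>k x. \<bar>D k x\<bar> \<le> C"
    and orth: "\<And>k l. k < l \<Longrightarrow> (\<integral>x. D k x * D l x \<partial>M) = 0"
  shows "AE x in M. (\<lambda>n. (\<Sum>k<n. D k x) / real n) \<longlonglongrightarrow> 0"
proof -
  define S where "S n x = (\<Sum>k<n. D k x)" for n x
  have [measurable]: "S n \<in> borel_measurable M" for n
    by (simp add: S_def[abs_def])
  have C: "C \<ge> 0"
    using bd[of 0 undefined] by linarith
  have S_bd: "\<bar>S n x\<bar> \<le> real n * C" for n x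
    unfolding S_def using sum_bounded_above[of "{..<n}" "\<lambda>k. \<bar>D k x\<bar>" C] bd
    by (intro order_trans[OF sum_abs]) simp
  have int: "integrable M (\<lambda>x. D k x * D l x)" for k l
    by (rule integrable_const_bound[where B = "C * C"]) (auto simp: abs_mult intro!: AE_I2 mult_mono bd C)
  have int_SD: "integrable M (\<lambda>x. S n x * D k x)" for n k
    unfolding S_def sum_distrib_right by (intro Bochner_Integration.integrable_sum int)
  have int_S: "integrable M (\<lambda>x. (S n x)\<^sup>2)" for n
    by (rule integrable_const_bound[where B = "(real n * C)\<^sup>2"])
      (auto intro!: AE_I2 S_bd simp: abs_le_square_iff[symmetric] C)
  have var: "(\<integral>x. (S n x)\<^sup>2 \<partial>M) \<le> real n * C\<^sup>2" for n
  proof (induction n)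
    case (Suc n)
    have SD: "(\<integral>x. S n x * D n x \<partial>M) = 0"
      unfolding S_def sum_distrib_right using int orth by (subst Bochner_Integration.integral_sum) auto
    have D2: "(\<integral>x. D n x * D n x \<partial>M) \<le> C\<^sup>2"
    proof -
      have "(\<integral>x. D n x * D n x \<partial>M) \<le> (\<integral>x. C\<^sup>2 \<partial>M)"
        using bd abs_le_square_iff[of "D n _" C] C
        by (intro integral_mono int) (auto simp: power2_eq_square[symmetric])
      then show ?thesis
        by (simp add: prob_space)
    qed
    have "(S (Suc n) x)\<^sup>2 = (S n x)\<^sup>2 + (2 * (S n x * D n x) + D n x * D n x)" for x
      by (simp add: S_def power2_eq_square algebra_simps)
    then have "(\<integral>x. (S (Suc n) x)\<^sup>2 \<partial>M) = (\<integral>x. (S n x)\<^sup>2 \<partial>M) + (2 * (\<integral>x. S n x * D n x \<partial>M) + (\<integral>x. D n x * D n x \<partial>M))"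
      using int_S int_SD int by simp
    then show ?case
      using Suc SD D2 by (simp add: algebra_simps)
  qed (simp add: S_def)
  define Y where "Y j x = (S ((Suc j)\<^sup>2) x / real ((Suc j)\<^sup>2))\<^sup>2" for j x
  have [measurable]: "Y j \<in> borel_measurable M" for j
    by (simp add: Y_def[abs_def])
  have Y_int: "(\<integral>\<^sup>+ x. ennreal (Y j x) \<partial>M) \<le> ennreal (C\<^sup>2 * (1 / real ((Suc j)\<^sup>2)))" for j
  proof -
    define m where "m = (Suc j)\<^sup>2"
    have m: "real m > 0"
      by (simp add: m_def)
    have Y: "Y j = (\<lambda>x. (S m x)\<^sup>2 / (real m)\<^sup>2)"
      by (simp add: Y_def m_def power_divide fun_eq_iff)
    have "(\<integral>\<^sup>+ x. ennreal (Y j x) \<partial>M) = ennreal (\<integral>x. Y j x \<partial>M)"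
      unfolding Y by (intro nn_integral_eq_integral integrable_divide int_S) auto
    also have "(\<integral>x. Y j x \<partial>M) = (\<integral>x. (S m x)\<^sup>2 \<partial>M) / (real m)\<^sup>2"
      unfolding Y by simp
    also have "\<dots> \<le> (real m * C\<^sup>2) / (real m)\<^sup>2"
      using var[of m] by (intro divide_right_mono) auto
    also have "\<dots> = C\<^sup>2 * (1 / real m)"
      using m by (simp add: power2_eq_square)
    finally show ?thesis
      by (simp add: m_def ennreal_leI)
  qed
  have "summable (\<lambda>j. 1 / real ((Suc j)\<^sup>2))"
  proof -
    have "summable (\<lambda>j. inverse (real (Suc j) ^ 2))"
      by (subst summable_Suc_iff) (rule inverse_power_summable, simp)
    then show ?thesis
      by (simp only: inverse_eq_divide of_nat_power)
  qed
  then have sm: "summable (\<lambda>j. C\<^sup>2 * (1 / real ((Suc j)\<^sup>2)))"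
    by (rule summable_mult)
  have "(\<integral>\<^sup>+ x. (\<Sum>j. ennreal (Y j x)) \<partial>M) = (\<Sum>j. \<integral>\<^sup>+ x. ennreal (Y j x) \<partial>M)"
    by (rule nn_integral_suminf) simp
  also have "\<dots> \<le> (\<Sum>j. ennreal (C\<^sup>2 * (1 / real ((Suc j)\<^sup>2))))"
    by (intro suminf_le Y_int) auto
  also have "\<dots> = ennreal (\<Sum>j. C\<^sup>2 * (1 / real ((Suc j)\<^sup>2)))"
    by (intro suminf_ennreal2 sm) auto
  also have "\<dots> < \<infinity>"
    by simp
  finally have "AE x in M. (\<Sum>j. ennreal (Y j x)) \<noteq> \<infinity>"
    by (intro nn_integral_PInf_AE) auto
  then show ?thesis
  proof (rule AE_mp, intro AE_I2 impI)
    fix x assume "(\<Sum>j. ennreal (Y j x)) \<noteq> \<infinity>"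
    then have "summable (\<lambda>j. Y j x)"
      by (intro summable_suminf_not_top) (auto simp: Y_def)
    then have "(\<lambda>j. Y j x) \<longlonglongrightarrow> 0"
      by (rule summable_LIMSEQ_zero)
    then have "(\<lambda>j. sqrt (Y j x)) \<longlonglongrightarrow> sqrt 0"
      by (rule tendsto_real_sqrt)
    then have "(\<lambda>j. \<bar>S ((Suc j)\<^sup>2) x / real ((Suc j)\<^sup>2)\<bar>) \<longlonglongrightarrow> 0"
      by (simp add: Y_def)
    then have sq: "(\<lambda>j. S ((Suc j)\<^sup>2) x / real ((Suc j)\<^sup>2)) \<longlonglongrightarrow> 0"
      by (rule tendsto_rabs_zero_cancel)
    have "(\<lambda>n. S n x / real n) \<longlonglongrightarrow> 0"
      by (rule averages_tendsto_0_of_squares[OF _ sq]) (use bd in \<open>simp add: S_def\<close>)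
    then show "(\<lambda>n. (\<Sum>k<n. D k x) / real n) \<longlonglongrightarrow> 0"
      by (simp add: S_def)
  qed
qed

locale markov_chain = irreducible_chain P for P :: "'a::finite \<Rightarrow> 'a \<Rightarrow> real" +
  fixes p :: "'a \<Rightarrow> real" and \<mu> :: "(nat \<Rightarrow> 'a) measure"
  assumes stationary: "stationary_vec P p" and markov: "markov_measure P p \<mu>"
begin

lemma stationary': "(\<Sum>i\<in>UNIV. p i * P i j) = p j"
  using stationary by (simp add: stationary_vec_def)

sublocale prob_space \<mu>
  using markov by (simp add: markov_measure_def)

lemma sets_mu [measurable_cong]: "sets \<mu> = sets (PiM UNIV (\<lambda>_. count_space (UNIV :: 'a set)))"
  using markov by (simp add: markov_measure_def)

lemma space_mu [simp]: "space \<mu> = UNIV"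
  using sets_eq_imp_space_eq[OF sets_mu] by (simp add: space_PiM)

lemma measurable_nth [measurable]: "(\<lambda>x. x k) \<in> measurable \<mu> (count_space UNIV)"
  unfolding measurable_cong_sets[OF sets_mu refl] by (rule measurable_component_singleton) simp

lemma sets_word: "{x. map x [k..<k + n] = u} \<in> sets \<mu>"
proof (induction n arbitrary: u)
  case (Suc n)
  have "{x. map x [k..<k + Suc n] = u} =
      (if u = [] then {} else {x. map x [k..<k + n] = butlast u} \<inter> {x. x (k + n) = last u})"
    by (cases u rule: rev_cases) auto
  moreover have "{x. x (k + n) = last u} \<in> sets \<mu>"
  proof -
    have "(\<lambda>x. x (k + n)) -` {last u} \<inter> space \<mu> \<in> sets \<mu>"
      by (rule measurable_sets[OF measurable_nth]) simp
    then show ?thesis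
      by (simp add: vimage_def)
  qed
  ultimately show ?case
    using Suc by auto
next
  case 0
  then show ?case
    using sets.top[of \<mu>] by (cases "u = []") auto
qed

lemma measurable_word: "(\<lambda>x. H (map x [k..<k + n]) :: real) \<in> borel_measurable \<mu>"
proof -
  have H: "H (map x [k..<k + n]) = (\<Sum>u\<in>words n. H u * indicator {x. map x [k..<k + n] = u} x)" for x
    by (simp add: indicator_def if_distrib[where f = "\<lambda>y. _ * y"] cong: if_cong)
  show ?thesis
    unfolding H
    by (intro borel_measurable_sum borel_measurable_times borel_measurable_const borel_measurable_indicator sets_word)
qed

lemma measure_word: "length u = Suc n \<Longrightarrow> measure \<mu> {x. map x [0..<Suc n] = u} = path_weight p P u"
proof -
  assume u: "length u = Suc n"
  have u_eq: "u = map (\<lambda>k. u ! k) [0..<Suc n]"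
    using map_nth[of u] u by simp
  have "{x. map x [0..<Suc n] = u} = {x. \<forall>k\<le>n. x k = u ! k}"
  proof (intro set_eqI iffI CollectI)
    fix x assume "x \<in> {x. map x [0..<Suc n] = u}"
    then have *: "u = map x [0..<Suc n]"
      by blast
    show "\<forall>k\<le>n. x k = u ! k"
      unfolding * by (simp del: upt_Suc)
  next
    fix x assume "x \<in> {x. \<forall>k\<le>n. x k = u ! k}"
    then show "map x [0..<Suc n] = u"
      using u by (intro nth_equalityI) (auto simp del: upt_Suc)
  qed
  then have "measure \<mu> {x. map x [0..<Suc n] = u} = p (u ! 0) * (\<Prod>k<n. P (u ! k) (u ! Suc k))"
    using markov by (simp add: markov_measure_def)
  also have "\<dots> = path_weight p P u"
    using u trans_prod_eq_prod[of P "\<lambda>k. u ! k" n] unfolding u_eq[symmetric]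
    by (cases u) (simp_all add: path_weight_def)
  finally show ?thesis .
qed

lemma expectation_word:
  "expectation (\<lambda>x. H (map x [0..<Suc n])) = (\<Sum>u\<in>words (Suc n). path_weight p P u * H u)" for H :: "'a list \<Rightarrow> real"
proof -
  have H: "H (map x [0..<Suc n]) = (\<Sum>u\<in>words (Suc n). indicator {x. map x [0..<Suc n] = u} x * H u)" for x
    by (simp add: indicator_def if_distrib[where f = "\<lambda>y. y * _"] cong: if_cong del: upt_Suc)
  have sets: "{x. map x [0..<Suc n] = u} \<in> sets \<mu>" for u
    using sets_word[of 0 "Suc n" u] by simp
  have "expectation (\<lambda>x. H (map x [0..<Suc n])) =
      (\<Sum>u\<in>words (Suc n). expectation (\<lambda>x. indicator {x. map x [0..<Suc n] = u} x * H u))"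
    unfolding H using sets by (intro Bochner_Integration.integral_sum) (auto simp del: upt_Suc simp: less_top[symmetric])
  also have "\<dots> = (\<Sum>u\<in>words (Suc n). path_weight p P u * H u)"
    using sets measure_word by (intro sum.cong) (auto simp del: upt_Suc)
  finally show ?thesis .
qed

text \<open>For \<open>k < l\<close> the window at \<open>l\<close> ends with a letter that the
  window at \<open>k\<close> does not reach. Summing over this letter first annihilates the product,
  which is the required orthogonality.\<close>

lemma slln_martingale_difference:
  fixes f :: "'a list \<Rightarrow> real"
  assumes mean: "\<And>u. length u = Suc m \<Longrightarrow> (\<Sum>j\<in>UNIV. P (last u) j * f (u @ [j])) = 0"
  shows "AE x in \<mu>. (\<lambda>n. (\<Sum>k<n. f (map x [k..<k + Suc (Suc m)])) / real n) \<longlonglongrightarrow> 0"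
proof (rule slln_orthogonal[where C = "\<Sum>u\<in>words (Suc (Suc m)). \<bar>f u\<bar>"])
  show "(\<lambda>x. f (map x [k..<k + Suc (Suc m)])) \<in> borel_measurable \<mu>" for k
    by (rule measurable_word)
  show "\<bar>f (map x [k..<k + Suc (Suc m)])\<bar> \<le> (\<Sum>u\<in>words (Suc (Suc m)). \<bar>f u\<bar>)" for k x
    by (rule member_le_sum) auto
next
  fix k l :: nat assume kl: "k < l"
  \<comment> \<open>The index of the last letter of the later window, so that words of length
    \<open>Suc N\<close> contain both windows and end with that letter.\<close>
  define N where "N = l + Suc m"
  define H where "H u = f (take (Suc (Suc m)) (drop k u)) * f (drop l u)" for u
  have "f (map x [k..<k + Suc (Suc m)]) * f (map x [l..<l + Suc (Suc m)]) = H (map x [0..<Suc N])" for x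
  proof -
    have "drop l (map x [0..<Suc N]) = map x [l..<l + Suc (Suc m)]"
      by (simp add: N_def drop_map del: upt_Suc)
    moreover have "take (Suc (Suc m)) (drop k (map x [0..<Suc N])) = map x [k..<k + Suc (Suc m)]"
      using kl by (simp add: N_def drop_map take_map del: upt_Suc)
    ultimately show ?thesis
      by (simp add: H_def)
  qed
  then have "expectation (\<lambda>x. f (map x [k..<k + Suc (Suc m)]) * f (map x [l..<l + Suc (Suc m)])) =
      (\<Sum>u\<in>words (Suc N). path_weight p P u * H u)"
    by (simp only: expectation_word)
  also have "\<dots> = (\<Sum>u\<in>words N. \<Sum>j\<in>UNIV. path_weight p P (u @ [j]) * H (u @ [j]))"
    by (rule sum_words_snoc)
  also have "\<dots> = 0"
  proof (rule sum.neutral, rule ballI)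
    fix u :: "'a list" assume "u \<in> words N"
    then have u: "length u = l + Suc m"
      by (simp add: N_def)
    then have ne: "u \<noteq> []"
      by auto
    have "H (u @ [j]) = f (take (Suc (Suc m)) (drop k u)) * f (drop l u @ [j])" for j
      using u kl by (simp add: H_def)
    then have "(\<Sum>j\<in>UNIV. path_weight p P (u @ [j]) * H (u @ [j])) =
        path_weight p P u * f (take (Suc (Suc m)) (drop k u)) * (\<Sum>j\<in>UNIV. P (last (drop l u)) j * f (drop l u @ [j]))"
      using ne u by (simp add: path_weight_snoc sum_distrib_left mult_ac last_drop)
    then show "(\<Sum>j\<in>UNIV. path_weight p P (u @ [j]) * H (u @ [j])) = 0"
      using mean[of "drop l u"] u by simp
  qed
  finally show "expectation (\<lambda>x. f (map x [k..<k + Suc (Suc m)]) * f (map x [l..<l + Suc (Suc m)])) = 0" .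
qed

text \<open>With \<open>f - c = h - P h\<close> the sum of \<open>f\<close> is \<open>n * c\<close>
  plus a sum of martingale differences plus the bounded boundary term
  \<open>h (x 0) - h (x n)\<close>.\<close>

lemma slln_one_letter:
  "AE x in \<mu>. (\<lambda>n. (\<Sum>k<n. f (x k)) / real n) \<longlonglongrightarrow> (\<Sum>i\<in>UNIV. p i * f i)"
proof -
  define c where "c = (\<Sum>i\<in>UNIV. p i * f i)"
  have "(\<Sum>i\<in>UNIV. p i * (f i - c)) = 0"
    using stationary by (simp add: right_diff_distrib sum_subtractf sum_distrib_right[symmetric] c_def stationary_vec_def)
  then obtain h where h: "\<And>i. h i - (\<Sum>j\<in>UNIV. P i j * h j) = f i - c"
    using poisson_equation[OF stationary, of "\<lambda>i. f i - c"] by blast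
  define F where "F u = h (u ! 1) - (\<Sum>j\<in>UNIV. P (u ! 0) j * h j)" for u
  have "AE x in \<mu>. (\<lambda>n. (\<Sum>k<n. F (map x [k..<k + Suc (Suc 0)])) / real n) \<longlonglongrightarrow> 0"
  proof (rule slln_martingale_difference)
    fix u :: "'a list" assume "length u = Suc 0"
    then obtain i where u: "u = [i]"
      by (auto simp: length_Suc_conv)
    have "(\<Sum>j\<in>UNIV. P i j * (h j - (\<Sum>j\<in>UNIV. P i j * h j))) = 0"
      using rows[of i] by (simp add: right_diff_distrib sum_subtractf sum_distrib_right[symmetric])
    then show "(\<Sum>j\<in>UNIV. P (last u) j * F (u @ [j])) = 0"
      by (simp add: u F_def)
  qed
  then show ?thesis
  proof (rule AE_mp, intro AE_I2 impI)
    fix x assume lim: "(\<lambda>n. (\<Sum>k<n. F (map x [k..<k + Suc (Suc 0)])) / real n) \<longlonglongrightarrow> 0"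
    define H where "H = (\<Sum>i\<in>UNIV. \<bar>h i\<bar>)"
    have hH: "\<bar>h i\<bar> \<le> H" for i
      unfolding H_def by (rule member_le_sum) auto
    have sum: "(\<Sum>k<n. f (x k)) = real n * c + (\<Sum>k<n. F (map x [k..<k + Suc (Suc 0)])) + (h (x 0) - h (x n))" for n
    proof (induction n)
      case (Suc n)
      have "F (map x [n..<n + Suc (Suc 0)]) = h (x (Suc n)) - (\<Sum>j\<in>UNIV. P (x n) j * h j)"
        by (simp add: F_def)
      then show ?case
        using Suc h[of "x n"] by (simp add: algebra_simps del: upt_Suc)
    qed simp
    have "(\<lambda>n. (h (x 0) - h (x n)) / real n) \<longlonglongrightarrow> 0"
    proof (rule Lim_null_comparison[OF _ lim_const_over_n[of "2 * H"]], intro always_eventually allI)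
      fix n
      have "\<bar>h (x 0) - h (x n)\<bar> \<le> 2 * H"
        using hH[of "x 0"] hH[of "x n"] by linarith
      then show "norm ((h (x 0) - h (x n)) / real n) \<le> 2 * H / real n"
        by (simp add: divide_right_mono)
    qed
    then have "(\<lambda>n. c + (\<Sum>k<n. F (map x [k..<k + Suc (Suc 0)])) / real n + (h (x 0) - h (x n)) / real n) \<longlonglongrightarrow> c + 0 + 0"
      by (intro tendsto_add tendsto_const lim)
    moreover have "\<forall>\<^sub>F n in sequentially. c + (\<Sum>k<n. F (map x [k..<k + Suc (Suc 0)])) / real n + (h (x 0) - h (x n)) / real n
        = (\<Sum>k<n. f (x k)) / real n"
      using eventually_gt_at_top[of 0] by eventually_elim (simp add: sum add_divide_distrib del: upt_Suc)
    ultimately show "(\<lambda>n. (\<Sum>k<n. f (x k)) / real n) \<longlonglongrightarrow> (\<Sum>i\<in>UNIV. p i * f i)"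
      unfolding c_def[symmetric] add_0_right by (rule Lim_transform_eventually)
  qed
qed

text \<open>Subtracting the conditional expectation given all but the last letter leaves a martingale
  difference, which reduces the statement to words with one letter less; for single letters the
  Poisson equation plays the same role.\<close>

lemma slln_words:
  fixes f :: "'a list \<Rightarrow> real"
  shows "AE x in \<mu>. (\<lambda>n. (\<Sum>k<n. f (map x [k..<k + Suc m])) / real n) \<longlonglongrightarrow>
           (\<Sum>u\<in>words (Suc m). path_weight p P u * f u)"
proof (induction m arbitrary: f)
  case 0
  show ?case
    using slln_one_letter[of "\<lambda>i. f [i]"] by (simp add: sum_words_Cons path_weight_def)
next
  case (Suc m)
  define g where "g u = (\<Sum>j\<in>UNIV. P (last u) j * f (u @ [j]))" for u
  define F where "F u = f u - g (butlast u)" for u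
  have "AE x in \<mu>. (\<lambda>n. (\<Sum>k<n. F (map x [k..<k + Suc (Suc m)])) / real n) \<longlonglongrightarrow> 0"
  proof (rule slln_martingale_difference)
    fix u :: "'a list" assume "length u = Suc m"
    have "(\<Sum>j\<in>UNIV. P (last u) j * F (u @ [j])) = g u - (\<Sum>j\<in>UNIV. P (last u) j) * g u"
      by (simp add: F_def right_diff_distrib sum_subtractf sum_distrib_right g_def)
    then show "(\<Sum>j\<in>UNIV. P (last u) j * F (u @ [j])) = 0"
      by (simp add: rows)
  qed
  with Suc[of g] have "AE x in \<mu>. (\<lambda>n. (\<Sum>k<n. g (map x [k..<k + Suc m])) / real n +
      (\<Sum>k<n. F (map x [k..<k + Suc (Suc m)])) / real n) \<longlonglongrightarrow> (\<Sum>u\<in>words (Suc m). path_weight p P u * g u) + 0"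
    by eventually_elim (rule tendsto_add)
  moreover have "(\<Sum>k<n. g (map x [k..<k + Suc m])) / real n + (\<Sum>k<n. F (map x [k..<k + Suc (Suc m)])) / real n
      = (\<Sum>k<n. f (map x [k..<k + Suc (Suc m)])) / real n" for x n
  proof -
    have "F (map x [k..<k + Suc (Suc m)]) = f (map x [k..<k + Suc (Suc m)]) - g (map x [k..<k + Suc m])" for k
      by (simp add: F_def butlast_append)
    then show ?thesis
      by (simp add: sum_subtractf diff_divide_distrib del: upt_Suc)
  qed
  moreover have "(\<Sum>u\<in>words (Suc (Suc m)). path_weight p P u * f u) = (\<Sum>u\<in>words (Suc m). path_weight p P u * g u)"
  proof (subst sum_words_snoc, rule sum.cong)
    fix u :: "'a list" assume "u \<in> words (Suc m)"
    then have "u \<noteq> []"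
      by auto
    then show "(\<Sum>j\<in>UNIV. path_weight p P (u @ [j]) * f (u @ [j])) = path_weight p P u * g u"
      by (simp add: path_weight_snoc g_def sum_distrib_left mult.assoc)
  qed simp
  ultimately show ?case
    by (simp del: upt_Suc)
qed

lemma AE_admissible: "AE x in \<mu>. \<forall>n. 0 < P (x n) (x (Suc n))"
proof -
  have "AE x in \<mu>. 0 < P (x n) (x (Suc n))" for n
  proof -
    define H where "H u = (if 0 < P (last (butlast u)) (last u) then 0 else 1 :: real)" for u
    have zero: "path_weight p P u * H u = 0" if u: "length u = Suc (Suc n)" for u
    proof -
      define v where "v = butlast u"
      have v: "v \<noteq> []" "u = v @ [last u]"
        using u by (auto simp: v_def simp flip: length_greater_0_conv)
      have "path_weight p P u = path_weight p P v * P (last v) (last u)"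
        by (subst v(2)) (rule path_weight_snoc[OF v(1)])
      then show ?thesis
        using nonneg[of "last v" "last u"] by (simp add: H_def v_def[symmetric])
    qed
    have 0: "expectation (\<lambda>x. H (map x [0..<Suc (Suc n)])) = 0"
      unfolding expectation_word by (rule sum.neutral) (use zero in blast)
    have H: "H (map x [0..<Suc (Suc n)]) = (if 0 < P (x n) (x (Suc n)) then 0 else 1)" for x
      by (simp add: H_def butlast_append)
    have meas: "(\<lambda>x. H (map x [0..<0 + Suc (Suc n)])) \<in> borel_measurable \<mu>"
      by (rule measurable_word)
    have H01: "0 \<le> H u" "norm (H u) \<le> 1" for u
      by (simp_all add: H_def)
    have int: "integrable \<mu> (\<lambda>x. H (map x [0..<Suc (Suc n)]))"
      by (rule integrable_const_bound[where B = 1, OF AE_I2]) (rule H01, rule meas[unfolded add_0])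
    have "AE x in \<mu>. H (map x [0..<Suc (Suc n)]) = 0"
      using integral_nonneg_eq_0_iff_AE[OF int AE_I2[OF H01(1)]] 0 by blast
    moreover have "0 < P (x n) (x (Suc n))" if "H (map x [0..<Suc (Suc n)]) = 0" for x
      using that unfolding H by (cases "0 < P (x n) (x (Suc n))") simp_all
    ultimately show ?thesis
      by (rule eventually_mono)
  qed
  then show ?thesis
    by (simp add: AE_all_countable)
qed

end

section \<open>Real analytic and holomorphic functions\<close>

text \<open>Convergence of the series at the real point \<open>x + \<rho>\<close> forces convergence
  of the complexified series inside the disc of radius \<rho>.\<close>

lemma real_analytic_holomorphic_extension:
  assumes "real_analytic_on f J" "x \<in> J"
  obtains r F where "r > 0" "F holomorphic_on ball (of_real x) r"
    "\<And>y. \<bar>y - x\<bar> < r \<Longrightarrow> F (of_real y) = of_real (f y)"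
proof -
  obtain r c where r: "r > 0" and c: "\<And>y. \<bar>y - x\<bar> < r \<Longrightarrow> (\<lambda>n. c n * (y - x) ^ n) sums f y"
    using assms unfolding real_analytic_on_def by meson
  define F where "F z = (\<Sum>n. of_real (c n) * (z - of_real x) ^ n)" for z :: complex
  have sm: "summable (\<lambda>n. of_real (c n) * (w - of_real x :: complex) ^ n)"
    if w: "w \<in> ball (of_real x) r" for w
  proof -
    define \<rho> where "\<rho> = (cmod (w - of_real x) + r) / 2"
    have \<rho>: "cmod (w - of_real x) < \<rho>" "\<rho> < r" "\<rho> \<ge> 0"
      using w r by (auto simp: \<rho>_def dist_norm norm_minus_commute)
    have "summable (\<lambda>n. c n * \<rho> ^ n)"
      using c[of "x + \<rho>"] \<rho> by (auto intro: sums_summable)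
    then have "summable (\<lambda>n. of_real (c n * \<rho> ^ n) :: complex)"
      by (rule summable_of_real)
    then have "summable (\<lambda>n. of_real (c n) * (of_real \<rho> :: complex) ^ n)"
      by simp
    then show ?thesis
      by (rule powser_inside) (use \<rho> in simp)
  qed
  show ?thesis
  proof (rule that[OF r])
    show "F holomorphic_on ball (of_real x) r"
    proof (rule power_series_holomorphic)
      fix w :: complex assume "w \<in> ball (of_real x) r"
      then show "(\<lambda>n. of_real (c n) * (w - of_real x) ^ n) sums F w"
        unfolding F_def by (intro summable_sums sm)
    qed
    fix y assume y: "\<bar>y - x\<bar> < r"
    have "(\<lambda>n. of_real (c n * (y - x) ^ n) :: complex) sums of_real (f y)"
      using c[OF y] by (simp only: sums_of_real_iff)
    then show "F (of_real y) = of_real (f y)"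
      unfolding F_def by (simp add: sums_iff)
  qed
qed

text \<open>Taking real parts commutes with multiplication by the real powers
  \<open>(u - y) ^ n\<close>, so the Taylor series of \<open>F\<close> at a real centre yields one
  for \<open>f\<close>.\<close>

lemma real_analytic_on_Re_holomorphic:
  assumes F: "F holomorphic_on ball (of_real x) r"
    and f: "\<And>y. \<bar>y - x\<bar> < r \<Longrightarrow> f y = Re (F (of_real y))"
  shows "real_analytic_on f {y. \<bar>y - x\<bar> < r}"
  unfolding real_analytic_on_def
proof
  fix y assume "y \<in> {y. \<bar>y - x\<bar> < r}"
  then have y: "\<bar>y - x\<bar> < r"
    by simp
  define \<rho> where "\<rho> = r - \<bar>y - x\<bar>"
  define c where "c n = Re ((deriv ^^ n) F (of_real y) / fact n)" for n
  have sub: "ball (of_real y) \<rho> \<subseteq> ball (of_real x :: complex) r"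
  proof
    fix z :: complex assume "z \<in> ball (of_real y) \<rho>"
    moreover have "dist (of_real x) z \<le> dist (of_real x) (of_real y :: complex) + dist (of_real y) z"
      by (rule dist_triangle)
    moreover have "dist (of_real x) (of_real y :: complex) = \<bar>y - x\<bar>"
      by (simp add: dist_norm abs_minus_commute flip: of_real_diff)
    ultimately show "z \<in> ball (of_real x) r"
      by (simp add: \<rho>_def)
  qed
  have "(\<lambda>n. c n * (u - y) ^ n) sums f u" if u: "\<bar>u - y\<bar> < \<rho>" for u
  proof -
    have "of_real u \<in> ball (of_real y :: complex) \<rho>"
      using u by (simp add: dist_norm abs_minus_commute flip: of_real_diff)
    then have "(\<lambda>n. (deriv ^^ n) F (of_real y) / fact n * (of_real u - of_real y) ^ n) sums F (of_real u)"
      by (rule holomorphic_power_series[OF holomorphic_on_subset[OF F sub]])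
    then have "(\<lambda>n. Re ((deriv ^^ n) F (of_real y) / fact n * (of_real u - of_real y) ^ n)) sums Re (F (of_real u))"
      by (rule sums_Re)
    moreover have "Re ((deriv ^^ n) F (of_real y) / fact n * (of_real u - of_real y) ^ n) = c n * (u - y) ^ n" for n
      unfolding c_def of_real_diff[symmetric] of_real_power[symmetric] by (simp only: Re_complex_of_real mult.commute[of _ "of_real _"] scaleR_conv_of_real[symmetric] scaleR_complex.sel mult.commute)
    moreover have "f u = Re (F (of_real u))"
      using u by (intro f) (simp add: \<rho>_def)
    ultimately show ?thesis
      by simp
  qed
  then show "\<exists>r>0. \<exists>c. \<forall>u. \<bar>u - y\<bar> < r \<longrightarrow> (\<lambda>n. c n * (u - y) ^ n) sums f u"
    using y by (intro exI[of _ \<rho>] conjI exI[of _ c]) (auto simp: \<rho>_def)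
qed

section \<open>The Lyapunov exponent as a limit of mean logarithmic ratios\<close>

text \<open>Meant for the logarithm \<open>a n\<close> of the norm of a product, with
  \<open>s\<close> a sum over windows of fixed length. Each tolerance \<open>e\<close> may use its
  own windows; the shift \<open>m\<close> and the constant \<open>K\<close> disappear after division
  by \<open>n\<close>.\<close>

lemma tendsto_average_of_approximations:
  fixes a :: "nat \<Rightarrow> real"
  assumes approx: "\<And>e. e > 0 \<Longrightarrow> \<exists>m s l K. (\<lambda>n. s n / real n) \<longlonglongrightarrow> l \<and> \<bar>l - L\<bar> \<le> e \<and>
      (\<forall>n. \<bar>a (n + m) - s n\<bar> \<le> real n * e + K)"
  shows "(\<lambda>n. a n / real n) \<longlonglongrightarrow> L"
proof (rule LIMSEQ_I)
  fix e :: real assume "e > 0"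
  \<comment> \<open>Four errors of at most \<open>n * (e / 8)\<close> each add up to half of the
    tolerance.\<close>
  then have e: "e / 8 > 0"
    by simp
  obtain m s l K where s: "(\<lambda>n. s n / real n) \<longlonglongrightarrow> l" and l: "\<bar>l - L\<bar> \<le> e / 8"
    and as: "\<And>n. \<bar>a (n + m) - s n\<bar> \<le> real n * (e / 8) + K"
    using approx[OF e] by metis
  obtain N1 where N1: "\<And>n. n \<ge> N1 \<Longrightarrow> \<bar>s n / real n - l\<bar> < e / 8"
    using LIMSEQ_D[OF s e] by auto
  obtain N2 :: nat where N2: "(\<bar>K\<bar> + real m * \<bar>L\<bar>) / (e / 8) < real N2"
    using reals_Archimedean2 by blast
  show "\<exists>N0. \<forall>n\<ge>N0. norm (a n / real n - L) < e"
  proof (intro exI[of _ "m + max (Suc N1) (Suc N2)"] allI impI)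
    fix N assume N: "N \<ge> m + max (Suc N1) (Suc N2)"
    define n where "n = N - m"
    have n: "N = n + m" "n \<ge> N1" "n \<ge> N2" "n > 0"
      using N by (auto simp: n_def)
    have "\<bar>s n - real n * l\<bar> = real n * \<bar>s n / real n - l\<bar>"
    proof -
      have "s n - real n * l = real n * (s n / real n - l)"
        using n(4) by (simp add: right_diff_distrib)
      then show ?thesis
        by (simp add: abs_mult)
    qed
    also have "\<dots> \<le> real n * (e / 8)"
      using N1[OF n(2)] by (intro mult_left_mono) auto
    finally have 1: "\<bar>s n - real n * l\<bar> \<le> real n * (e / 8)" .
    have "\<bar>real n * l - real n * L\<bar> = real n * \<bar>l - L\<bar>"
      by (simp add: abs_mult right_diff_distrib[symmetric])
    also have "\<dots> \<le> real n * (e / 8)"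
      using l by (intro mult_left_mono) auto
    finally have 2: "\<bar>real n * l - real n * L\<bar> \<le> real n * (e / 8)" .
    have 3: "\<bar>real m * L\<bar> = real m * \<bar>L\<bar>"
      by (simp add: abs_mult)
    have "\<bar>K\<bar> + real m * \<bar>L\<bar> < real N2 * (e / 8)"
      using N2 \<open>e > 0\<close> by (simp add: field_simps)
    also have "\<dots> \<le> real n * (e / 8)"
      using n(3) \<open>e > 0\<close> by (intro mult_right_mono) auto
    finally have 4: "\<bar>K\<bar> + real m * \<bar>L\<bar> < real n * (e / 8)" .
    have "a N - real N * L = (a (n + m) - s n) + (s n - real n * l) + (real n * l - real n * L) - real m * L"
      by (simp add: n(1) algebra_simps)
    then have "\<bar>a N - real N * L\<bar> \<le> \<bar>a (n + m) - s n\<bar> + \<bar>s n - real n * l\<bar> + \<bar>real n * l - real n * L\<bar> + \<bar>real m * L\<bar>"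
      by linarith
    also have "\<dots> \<le> 4 * (real n * (e / 8))"
      using as[of n] 1 2 3 4 by linarith
    also have "\<dots> < real N * e"
      using n \<open>e > 0\<close> by (simp add: field_simps add_pos_nonneg)
    finally have "\<bar>a N - real N * L\<bar> / real N < e"
      using n by (simp add: divide_less_eq mult.commute)
    moreover have "\<bar>a N - real N * L\<bar> / real N = \<bar>a N / real N - L\<bar>"
    proof -
      have "(a N - real N * L) / real N = a N / real N - L"
        using n by (simp add: diff_divide_distrib)
      then show ?thesis
        by (metis abs_divide abs_of_nat)
    qed
    ultimately show "norm (a N / real N - L) < e"
      by simp
  qed
qed

definition log_ratio :: "('a list \<Rightarrow> real) \<Rightarrow> 'a list \<Rightarrow> real" where
  "log_ratio g u = ln (g u) - ln (g (butlast u))"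

definition mean_log_ratio ::
  "('a::finite \<Rightarrow> real) \<Rightarrow> ('a \<Rightarrow> 'a \<Rightarrow> real) \<Rightarrow> ('a list \<Rightarrow> real) \<Rightarrow> nat \<Rightarrow> real" where
  "mean_log_ratio p P g n = (\<Sum>u\<in>words n. path_weight p P u * log_ratio g u)"

text \<open>By stationarity, summing path weights over the first letter removes that letter, so the
  mean at \<open>n\<close> is also the mean of \<open>log_ratio g (tl u)\<close> over words of
  length \<open>Suc n\<close>.\<close>

lemma mean_log_ratio_Suc:
  assumes "\<And>j. (\<Sum>i\<in>UNIV. p i * P i j) = p j" "n \<ge> 1"
  shows "mean_log_ratio p P g (Suc n) - mean_log_ratio p P g n =
     (\<Sum>u\<in>words (Suc n). path_weight p P u * (log_ratio g u - log_ratio g (tl u)))"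
proof -
  have "(\<Sum>u\<in>words (Suc n). path_weight p P u * log_ratio g (tl u)) = (\<Sum>u\<in>words n. \<Sum>i\<in>UNIV. path_weight p P (i # u) * log_ratio g u)"
    unfolding sum_words_Cons by (subst sum.swap) simp
  also have "\<dots> = mean_log_ratio p P g n"
    unfolding mean_log_ratio_def sum_distrib_right[symmetric]
    by (intro sum.cong refl arg_cong2[where f = "(*)"] sum_path_weight_Cons) (use assms in auto)
  finally show ?thesis
    by (simp add: mean_log_ratio_def right_diff_distrib sum_subtractf)
qed

context irreducible_chain
begin

abbreviation "admissible u \<equiv> adm {(i, j). P i j > 0} u"

lemma path_weight_not_admissible: "u \<noteq> [] \<Longrightarrow> \<not> admissible u \<Longrightarrow> path_weight p P u = 0"
proof -
  have "trans_prod P u = 0" if "\<not> successively (\<lambda>i j. (i, j) \<in> {(i, j). P i j > 0}) u" for u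
    using that
  proof (induction u)
    case (Cons i u)
    show ?case
    proof (cases "u = [] \<or> P i (hd u) = 0")
      case False
      then have "\<not> successively (\<lambda>i j. (i, j) \<in> {(i, j). P i j > 0}) u"
        using Cons.prems nonneg[of i "hd u"] by (auto simp: successively_Cons less_le)
      then show ?thesis
        using False Cons.IH by (simp add: trans_prod_Cons)
    next
      case True
      moreover have "u \<noteq> []"
        using Cons.prems by auto
      ultimately show ?thesis
        by (simp add: trans_prod_Cons)
    qed
  qed simp
  then show "u \<noteq> [] \<Longrightarrow> \<not> admissible u \<Longrightarrow> path_weight p P u = 0"
    by (simp add: path_weight_def)
qed

end

text \<open>The last ratio of a long word depends on its remote past only up to a geometric tail.
  The telescoped sum of the ratios of prefixes is therefore, up to \<open>n * e\<close>, a sum over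
  windows of fixed length, to which \<open>slln_words\<close> applies; the assumption
  \<open>norm\<close> transfers the limit to the matrix norm.\<close>

lemma (in markov_chain) lyapunov_limit:
  fixes g :: "'a list \<Rightarrow> real" and A :: "'a \<Rightarrow> real^2^2"
  assumes \<kappa>: "0 < \<kappa>" "\<kappa> < 1" and C: "C \<ge> 0"
    and ratio: "\<And>u. admissible u \<Longrightarrow> length u \<ge> N \<Longrightarrow> \<bar>log_ratio g u - log_ratio g (tl u)\<bar> \<le> C * \<kappa> ^ length u"
    and norm: "\<And>u. admissible u \<Longrightarrow> \<bar>ln (mnorm (word_prod A (butlast u))) - ln (g u)\<bar> \<le> K"
    and L: "mean_log_ratio p P g \<longlonglongrightarrow> L"
  shows "AE x in \<mu>. (\<lambda>n. ln (mnorm (mprod A x n)) / real n) \<longlonglongrightarrow> L"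
proof -
  \<comment> \<open>The partial geometric sum, rather than its limit, is what the induction on
    \<open>v\<close> can carry.\<close>
  have tail: "\<bar>log_ratio g (v @ w) - log_ratio g w\<bar> \<le> C * \<kappa> ^ length w * ((1 - \<kappa> ^ length v) / (1 - \<kappa>))"
    if "admissible (v @ w)" "length w \<ge> N" "w \<noteq> []" for v w
    using that(1)
  proof (induction v)
    case (Cons i v)
    have adm: "admissible (v @ w)"
      using Cons.prems that(3) by (auto simp: successively_Cons)
    have "\<bar>log_ratio g (i # v @ w) - log_ratio g (v @ w)\<bar> \<le> C * \<kappa> ^ length (i # v @ w)"
      using ratio[of "i # v @ w"] Cons.prems that(2) by simp
    also have "\<dots> \<le> C * \<kappa> ^ (length w + length v)"
      using C \<kappa> by (intro mult_left_mono power_decreasing) auto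
    finally have 1: "\<bar>log_ratio g (i # v @ w) - log_ratio g (v @ w)\<bar> \<le> C * \<kappa> ^ length w * \<kappa> ^ length v"
      by (simp add: power_add)
    have "(1 - \<kappa> ^ length v) / (1 - \<kappa>) + \<kappa> ^ length v = (1 - \<kappa> ^ length (i # v)) / (1 - \<kappa>)"
      using \<kappa> by (simp add: field_simps)
    then have "C * \<kappa> ^ length w * ((1 - \<kappa> ^ length (i # v)) / (1 - \<kappa>)) =
        C * \<kappa> ^ length w * ((1 - \<kappa> ^ length v) / (1 - \<kappa>)) + C * \<kappa> ^ length w * \<kappa> ^ length v"
      by (metis distrib_left)
    then show ?case
      using 1 Cons.IH[OF adm] by simp
  qed simp
  have tail': "\<bar>log_ratio g (v @ w) - log_ratio g w\<bar> \<le> C * \<kappa> ^ length w / (1 - \<kappa>)"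
    if "admissible (v @ w)" "length w \<ge> N" "w \<noteq> []" for v w
  proof -
    have "C * \<kappa> ^ length w * ((1 - \<kappa> ^ length v) / (1 - \<kappa>)) \<le> C * \<kappa> ^ length w * (1 / (1 - \<kappa>))"
      using C \<kappa> by (intro mult_left_mono divide_right_mono) auto
    then show ?thesis
      using tail[OF that] by simp
  qed
  have "AE x in \<mu>. \<forall>m. (\<lambda>n. (\<Sum>k<n. log_ratio g (map x [k..<k + Suc m])) / real n) \<longlonglongrightarrow>
      mean_log_ratio p P g (Suc m)"
    unfolding AE_all_countable mean_log_ratio_def using slln_words by blast
  with AE_admissible show ?thesis
  proof eventually_elim
    case (elim x)
    have adm: "admissible (map x [k..<k + Suc n])" for k n
      using elim(1) by (induction n) (auto simp: successively_append_iff)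
    show ?case
    proof (rule tendsto_average_of_approximations)
      fix e :: real assume e: "e > 0"
      have "(\<lambda>m. C * \<kappa> ^ m / (1 - \<kappa>)) \<longlonglongrightarrow> C * 0 / (1 - \<kappa>)"
        using \<kappa> by (intro tendsto_divide tendsto_mult tendsto_const LIMSEQ_power_zero) auto
      then have "\<forall>\<^sub>F m in sequentially. C * \<kappa> ^ m / (1 - \<kappa>) < e"
        using e by (intro order_tendstoD(2)) auto
      moreover have "\<forall>\<^sub>F m in sequentially. dist (mean_log_ratio p P g m) L < e"
        using L e by (rule tendstoD)
      ultimately have "\<forall>\<^sub>F m in sequentially. C * \<kappa> ^ m / (1 - \<kappa>) < e \<and> dist (mean_log_ratio p P g m) L < e"
        by (rule eventually_conj)
      then obtain M where M: "\<And>m. m \<ge> M \<Longrightarrow> C * \<kappa> ^ m / (1 - \<kappa>) < e \<and> dist (mean_log_ratio p P g m) L < e"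
        unfolding eventually_at_top_linorder by blast
      define m where "m = max M N"
      have m: "C * \<kappa> ^ Suc (Suc m) / (1 - \<kappa>) < e" "\<bar>mean_log_ratio p P g (Suc (Suc m)) - L\<bar> < e"
        using M[of "Suc (Suc m)"] by (auto simp: m_def dist_real_def)
      have "N \<le> m"
        by (simp add: m_def)
      \<comment> \<open>The base word has \<open>m + 1\<close> letters, one more than the
        \<open>m\<close> matrices of its product. The \<open>k\<close>-th increment appends the
        letter \<open>k + m + 1\<close>, where the window of \<open>m + 2\<close> letters starting
        at \<open>k\<close> ends.\<close>
      define s where "s n = (\<Sum>k<n. log_ratio g (map x [k..<k + Suc (Suc m)]))" for n
      define B where "B = K + \<bar>ln (g (map x [0..<Suc m]))\<bar>"
      have tele: "ln (g (map x [0..<n + Suc m])) = ln (g (map x [0..<Suc m])) + (\<Sum>k<n. log_ratio g (map x [0..<k + Suc (Suc m)]))" for n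
        by (induction n) (simp_all add: log_ratio_def butlast_append)
      have "\<bar>ln (mnorm (mprod A x (n + m))) - s n\<bar> \<le> real n * e + B" for n
      proof -
        have "\<bar>log_ratio g (map x [0..<k + Suc (Suc m)]) - log_ratio g (map x [k..<k + Suc (Suc m)])\<bar> \<le> e" for k
        proof -
          have split: "map x [0..<k + Suc (Suc m)] = map x [0..<k] @ map x [k..<k + Suc (Suc m)]"
            by (subst upt_add_eq_append) (simp_all del: upt_Suc)
          have "admissible (map x [0..<k] @ map x [k..<k + Suc (Suc m)])"
            using adm[of 0 "k + Suc m"] unfolding split[symmetric] by simp
          then have "\<bar>log_ratio g (map x [0..<k + Suc (Suc m)]) - log_ratio g (map x [k..<k + Suc (Suc m)])\<bar>
              \<le> C * \<kappa> ^ Suc (Suc m) / (1 - \<kappa>)"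
            unfolding split using tail'[of "map x [0..<k]" "map x [k..<k + Suc (Suc m)]"] \<open>N \<le> m\<close> by (simp del: upt_Suc)
          then show ?thesis
            using m(1) by linarith
        qed
        then have "(\<Sum>k<n. \<bar>log_ratio g (map x [0..<k + Suc (Suc m)]) - log_ratio g (map x [k..<k + Suc (Suc m)])\<bar>) \<le> (\<Sum>k<n. e)"
          by (intro sum_mono) auto
        then have "\<bar>\<Sum>k<n. log_ratio g (map x [0..<k + Suc (Suc m)]) - log_ratio g (map x [k..<k + Suc (Suc m)])\<bar> \<le> real n * e"
          by (intro order_trans[OF sum_abs]) simp
        then have "\<bar>(ln (g (map x [0..<n + Suc m])) - ln (g (map x [0..<Suc m]))) - s n\<bar> \<le> real n * e"
          unfolding s_def tele sum_subtractf by simp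
        moreover have "\<bar>ln (mnorm (mprod A x (n + m))) - ln (g (map x [0..<n + Suc m]))\<bar> \<le> K"
          using norm[OF adm[of 0 "n + m"]] by (simp add: mprod_eq_word_prod butlast_append)
        ultimately show ?thesis
          unfolding B_def by linarith
      qed
      moreover have "(\<lambda>n. s n / real n) \<longlonglongrightarrow> mean_log_ratio p P g (Suc (Suc m))"
        unfolding s_def using elim(2) by blast
      ultimately show "\<exists>m s l K. (\<lambda>n. s n / real n) \<longlonglongrightarrow> l \<and> \<bar>l - L\<bar> \<le> e \<and>
          (\<forall>n. \<bar>ln (mnorm (mprod A x (n + m))) - s n\<bar> \<le> real n * e + K)"
        using m(2) less_imp_le by blast
    qed
  qed
qed

section \<open>Cross ratios\<close>

text \<open>The multiplicative second difference of \<open>g\<close> in the first and last letters: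
  where \<open>g\<close> does not vanish, the logarithm of its modulus is the
  \<open>log_ratio\<close> of the word minus that of its tail.\<close>

definition cross_ratio :: "('a list \<Rightarrow> complex) \<Rightarrow> 'a list \<Rightarrow> complex" where
  "cross_ratio g u = g u * g (butlast (tl u)) / (g (tl u) * g (butlast u))"

text \<open>The adjugate of \<open>B\<close> applied to \<open>w\<close>, that is, the adjoint of
  \<open>B\<close> for the form \<open>det2\<close>.\<close>

definition pullback_covector :: "'b::comm_ring_1^2^2 \<Rightarrow> 'b^2 \<Rightarrow> 'b^2" where
  "pullback_covector B w = vector [B $ 2 $ 2 * w $ 1 - B $ 1 $ 2 * w $ 2, B $ 1 $ 1 * w $ 2 - B $ 2 $ 1 * w $ 1]"

lemma det2_pullback: "det2 (B *v x) w = det2 x (pullback_covector B w)"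
  by (simp add: det2_def pullback_covector_def matrix_vector_mult_def sum_2 algebra_simps)

lemma det2_pluecker: "det2 x m * det2 y n - det2 y m * det2 x n = det2 x y * det2 m n"
  by (simp add: det2_def algebra_simps)

lemma norm_le_of_components:
  fixes x :: "complex^2"
  assumes "\<And>i. cmod (x $ i) \<le> b"
  shows "norm x \<le> 2 * b"
proof -
  have "norm x \<le> (\<Sum>i\<in>UNIV. cmod (x $ i))"
    unfolding norm_vec_def by (rule L2_set_le_sum) simp
  also have "\<dots> \<le> (\<Sum>i\<in>(UNIV :: 2 set). b)"
    by (rule sum_mono) (rule assms)
  finally show ?thesis
    by simp
qed

lemma norm_matrix_vector_le:
  fixes B :: "complex^2^2"
  assumes "\<And>r s. cmod (B $ r $ s) \<le> b"
  shows "norm (B *v x) \<le> 4 * b * norm x" and "norm (pullback_covector B x) \<le> 4 * b * norm x"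
proof -
  have b: "b \<ge> 0"
    using order_trans[OF norm_ge_zero assms[of 1 1]] .
  have le: "cmod (B $ r $ s * x $ i) \<le> b * norm x" for r s i
    unfolding norm_mult using assms b by (intro mult_mono Finite_Cartesian_Product.norm_nth_le) auto
  have "cmod ((B *v x) $ i) \<le> 2 * b * norm x" for i
    using norm_triangle_ineq[of "B $ i $ 1 * x $ 1" "B $ i $ 2 * x $ 2"] le[of i 1 1] le[of i 2 2]
    by (simp add: matrix_vector_mult_def sum_2)
  from norm_le_of_components[OF this] show "norm (B *v x) \<le> 4 * b * norm x"
    by simp
  have *: "\<forall>i. cmod (pullback_covector B x $ i) \<le> 2 * b * norm x"
    using norm_triangle_ineq4[of "B $ 2 $ 2 * x $ 1" "B $ 1 $ 2 * x $ 2"]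
      norm_triangle_ineq4[of "B $ 1 $ 1 * x $ 2" "B $ 2 $ 1 * x $ 1"]
      le[of 2 2 1] le[of 1 2 2] le[of 1 1 2] le[of 2 1 1]
    by (simp add: forall_2 pullback_covector_def)
  show "norm (pullback_covector B x) \<le> 4 * b * norm x"
    using norm_le_of_components[OF *[rule_format]] by simp
qed

lemma words_split:
  assumes "length u \<ge> 3"
  obtains i m j where "u = i # m @ [j]" "m \<noteq> []"
proof -
  obtain i u' where u: "u = i # u'"
    using assms by (cases u) auto
  obtain m j where "u' = m @ [j]"
    using assms u by (cases u' rule: rev_cases) auto
  moreover have "m \<noteq> []"
    using assms u calculation by auto
  ultimately show ?thesis
    using u that by blast
qed

text \<open>By a Pluecker relation the cross ratio differs from \<open>1\<close> by a quantity proportional to the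
  determinant of the middle part of the word, which domination makes exponentially small.\<close>

lemma cross_ratio_near_1:
  fixes B :: "'a \<Rightarrow> complex^2^2" and v om :: "'a \<Rightarrow> real^2" and b C \<delta> \<kappa> :: real
  assumes B: "\<And>i r s. cmod (B i $ r $ s) \<le> b" and det: "\<And>i. \<delta> \<le> cmod (det (B i))" and \<delta>: "\<delta> > 0"
    and v: "\<And>i. norm (v i) \<le> b" and om: "\<And>i. norm (om i) \<le> b" and C: "C \<ge> 0" and \<kappa>: "\<kappa> \<ge> 0"
    and nz: "\<And>u. adm E u \<Longrightarrow> word_entry B v om u \<noteq> 0"
    and small: "\<And>u. adm E u \<Longrightarrow> cmod (det (word_prod B (butlast u))) \<le> C * \<kappa> ^ (length u - 1) * (cmod (word_entry B v om u))\<^sup>2"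
    and u: "adm E u" "length u \<ge> 3"
  shows "cmod (cross_ratio (word_entry B v om) u - 1) \<le> (8 * b ^ 3)\<^sup>2 * (C / \<delta>) * \<kappa> ^ (length u - 2)"
proof -
  let ?g = "word_entry B v om"
  obtain i m j where u_eq: "u = i # m @ [j]" and m: "m \<noteq> []"
    using words_split[OF u(2)] by blast
  have adm: "adm E (m @ [j])" "adm E (i # m)" "adm E m"
    using u(1) m by (auto simp: u_eq successively_Cons successively_append_iff)
  have b: "b \<ge> 0"
    using order_trans[OF norm_ge_zero v] .
  define Mm where "Mm = word_prod B (butlast m)"
  define l where "l = last m"
  have word_prod_m: "word_prod B m = B l ** Mm"
    using m by (subst append_butlast_last_id[OF m, symmetric], subst word_prod_append) (simp add: Mm_def l_def)
  \<comment> \<open>All four values of \<open>g\<close> are determinants through the same middle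
    product \<open>Mm\<close>; they differ only in the start vector \<open>X\<close> or
    \<open>Y\<close> and the end vector \<open>n\<close> or \<open>n'\<close>.\<close>
  define X where "X = B i *v cvec (v i)"
  define Y where "Y = cvec (v (hd m))"
  define n where "n = pullback_covector (B l) (cvec (om j))"
  define n' where "n' = cvec (om l)"
  have g1: "?g u = det2 (Mm *v X) n"
    using m by (simp add: word_entry_def u_eq butlast_append word_prod_m X_def n_def flip: det2_pullback matrix_vector_mul_assoc)
  have g2: "?g (m @ [j]) = det2 (Mm *v Y) n"
    using m by (simp add: word_entry_def word_prod_m Y_def n_def flip: det2_pullback matrix_vector_mul_assoc)
  have g3: "?g (i # m) = det2 (Mm *v X) n'"
    using m by (simp add: word_entry_def X_def n'_def Mm_def l_def flip: matrix_vector_mul_assoc)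
  have g4: "?g m = det2 (Mm *v Y) n'"
    using m by (simp add: word_entry_def Y_def n'_def Mm_def l_def)
  have "?g u * ?g m - ?g (m @ [j]) * ?g (i # m) = det Mm * det2 X Y * det2 n n'"
    unfolding g1 g2 g3 g4 det2_pluecker det2_mult ..
  moreover have "butlast (tl u) = m" "tl u = m @ [j]" "butlast u = i # m"
    using m by (simp_all add: u_eq butlast_append)
  ultimately have cr: "cross_ratio ?g u - 1 = det Mm * det2 X Y * det2 n n' / (?g (m @ [j]) * ?g (i # m))"
    using nz[OF adm(1)] nz[OF adm(2)] by (simp add: cross_ratio_def divide_simps)
  have nX: "norm X \<le> 4 * b * b" and nn: "norm n \<le> 4 * b * b"
    unfolding X_def n_def using norm_matrix_vector_le[OF B] v om b
    by (auto intro!: order_trans[OF norm_matrix_vector_le(1)[OF B]] order_trans[OF norm_matrix_vector_le(2)[OF B]] mult_left_mono)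
  have "cmod (det2 X Y) \<le> 2 * (4 * b * b) * b"
    using nX v b by (intro order_trans[OF norm_det2_le] mult_mono) (auto simp: Y_def)
  then have XY: "cmod (det2 X Y) \<le> 8 * b ^ 3"
    by (simp add: power3_eq_cube)
  have "cmod (det2 n n') \<le> 2 * (4 * b * b) * b"
    using nn om b by (intro order_trans[OF norm_det2_le] mult_mono) (auto simp: n'_def)
  then have nn': "cmod (det2 n n') \<le> 8 * b ^ 3"
    by (simp add: power3_eq_cube)
  define G where "G = cmod (?g (m @ [j]) * ?g (i # m))"
  have Gpos: "G > 0"
    using nz[OF adm(1)] nz[OF adm(2)] by (simp add: G_def)
  have "\<delta> * cmod (det Mm) \<le> cmod (det (word_prod B (butlast (m @ [j]))))"
    using det[of l] by (simp add: word_prod_m det_mul norm_mult mult_right_mono)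
  also have "\<dots> \<le> C * \<kappa> ^ length m * (cmod (?g (m @ [j])))\<^sup>2"
    using small[OF adm(1)] by simp
  finally have s1: "\<delta> * cmod (det Mm) \<le> C * \<kappa> ^ length m * (cmod (?g (m @ [j])))\<^sup>2" .
  have "\<delta> * cmod (det Mm) \<le> cmod (det (word_prod B (butlast (i # m))))"
    using det[of i] m by (simp add: Mm_def det_mul norm_mult mult.commute[of "cmod (det (word_prod B (butlast m)))"] mult_right_mono)
  also have "\<dots> \<le> C * \<kappa> ^ length m * (cmod (?g (i # m)))\<^sup>2"
    using small[OF adm(2)] by simp
  finally have s2: "\<delta> * cmod (det Mm) \<le> C * \<kappa> ^ length m * (cmod (?g (i # m)))\<^sup>2" .
  \<comment> \<open>The two estimates are multiplied and the root is taken, so that the denominator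
    \<open>G\<close> of the cross ratio appears instead of the square of one of its factors.\<close>
  have "(\<delta> * cmod (det Mm))\<^sup>2 \<le> (C * \<kappa> ^ length m * (cmod (?g (m @ [j])))\<^sup>2) * (C * \<kappa> ^ length m * (cmod (?g (i # m)))\<^sup>2)"
    unfolding power2_eq_square[of "\<delta> * _"] by (rule mult_mono[OF s1 s2]) (use C \<kappa> \<delta> in auto)
  also have "\<dots> = (C * \<kappa> ^ length m * G)\<^sup>2"
    by (simp add: G_def norm_mult power2_eq_square mult_ac)
  finally have "\<delta> * cmod (det Mm) \<le> C * \<kappa> ^ length m * G"
    by (rule power2_le_imp_le) (use C \<kappa> in \<open>simp add: G_def\<close>)
  then have detMm: "cmod (det Mm) \<le> C / \<delta> * \<kappa> ^ length m * G"
    using \<delta> by (simp add: field_simps)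
  have "cmod (cross_ratio ?g u - 1) = cmod (det Mm) * cmod (det2 X Y) * cmod (det2 n n') / G"
    unfolding cr G_def by (simp add: norm_mult norm_divide)
  also have "\<dots> \<le> (C / \<delta> * \<kappa> ^ length m * G) * (8 * b ^ 3) * (8 * b ^ 3) / G"
    using C \<kappa> \<delta> b Gpos by (intro divide_right_mono mult_mono detMm XY nn') auto
  also have "\<dots> = (8 * b ^ 3)\<^sup>2 * (C / \<delta>) * \<kappa> ^ (length u - 2)"
    using Gpos by (simp add: u_eq power2_eq_square)
  finally show ?thesis .
qed

section \<open>Holomorphic families\<close>

lemma holomorphic_det:
  fixes M :: "complex \<Rightarrow> complex^'n^'n"
  assumes "\<And>i j. (\<lambda>z. M z $ i $ j) holomorphic_on S"
  shows "(\<lambda>z. det (M z)) holomorphic_on S"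
  unfolding det_def by (intro holomorphic_intros assms)

lemma holomorphic_stat_matrix:
  assumes "\<And>i j. (\<lambda>z. Q z i j) holomorphic_on S"
  shows "(\<lambda>z. stat_matrix (Q z) $ i $ j) holomorphic_on S"
  unfolding stat_matrix_def vec_lambda_beta by (intro holomorphic_intros assms)

lemma holomorphic_stat_vec:
  assumes "\<And>i j. (\<lambda>z. Q z i j) holomorphic_on S" "\<And>z. z \<in> S \<Longrightarrow> det (stat_matrix (Q z)) \<noteq> 0"
  shows "(\<lambda>z. stat_vec (Q z) k) holomorphic_on S"
  unfolding stat_vec_def
proof (intro holomorphic_on_divide holomorphic_det)
  fix i j
  show "(\<lambda>z. (\<chi> i j. if j = k then 1 else stat_matrix (Q z) $ i $ j) $ i $ j) holomorphic_on S"
    by (cases "j = k") (simp_all add: holomorphic_stat_matrix[OF assms(1)])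
qed (use assms in \<open>simp_all add: holomorphic_stat_matrix\<close>)

lemma holomorphic_trans_prod:
  assumes "\<And>i j. (\<lambda>z. Q z i j) holomorphic_on S"
  shows "(\<lambda>z. trans_prod (Q z) u) holomorphic_on S"
proof (induction u)
  case (Cons i u)
  then show ?case
    by (cases u) (auto intro!: holomorphic_intros assms)
qed simp

lemma holomorphic_word_prod:
  fixes B :: "complex \<Rightarrow> 'a \<Rightarrow> complex^2^2"
  assumes "\<And>i r s. (\<lambda>z. B z i $ r $ s) holomorphic_on S"
  shows "(\<lambda>z. word_prod (B z) u $ r $ s) holomorphic_on S"
proof (induction u arbitrary: r s)
  case Nil
  show ?case
    by (simp add: mat_def)
next
  case (Cons i u)
  then show ?case
    by (auto simp: matrix_matrix_mult_def intro!: holomorphic_intros assms)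
qed

lemma holomorphic_word_entry:
  fixes B :: "complex \<Rightarrow> 'a \<Rightarrow> complex^2^2"
  assumes "\<And>i r s. (\<lambda>z. B z i $ r $ s) holomorphic_on S"
  shows "(\<lambda>z. word_entry (B z) v om u) holomorphic_on S"
  unfolding word_entry_def det2_def matrix_vector_mult_def vec_lambda_beta
  by (intro holomorphic_intros holomorphic_word_prod assms)

lemma sum_norm_path_weight_le:
  fixes Q :: "'a::finite \<Rightarrow> 'a \<Rightarrow> 'b::real_normed_field"
  assumes "\<And>i. (\<Sum>j\<in>UNIV. norm (Q i j)) \<le> R"
  shows "(\<Sum>u\<in>words (Suc n). norm (path_weight p Q u)) \<le> (\<Sum>i\<in>UNIV. norm (p i)) * R ^ n"
proof (induction n)
  case 0
  then show ?case
    by (simp add: sum_words_Cons path_weight_def)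
next
  case (Suc n)
  have R: "R \<ge> 0"
    by (rule order_trans[OF sum_nonneg assms]) simp
  have "(\<Sum>u\<in>words (Suc (Suc n)). norm (path_weight p Q u)) = (\<Sum>u\<in>words (Suc n). norm (path_weight p Q u) * (\<Sum>j\<in>UNIV. norm (Q (last u) j)))"
    unfolding sum_words_snoc[of _ "Suc n"]
  proof (rule sum.cong)
    fix u :: "'a list" assume "u \<in> words (Suc n)"
    then have "u \<noteq> []"
      by auto
    then show "(\<Sum>j\<in>UNIV. norm (path_weight p Q (u @ [j]))) = norm (path_weight p Q u) * (\<Sum>j\<in>UNIV. norm (Q (last u) j))"
      by (simp add: path_weight_snoc norm_mult sum_distrib_left)
  qed simp
  also have "\<dots> \<le> (\<Sum>u\<in>words (Suc n). norm (path_weight p Q u) * R)"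
    by (intro sum_mono mult_left_mono assms) auto
  also have "\<dots> \<le> (\<Sum>i\<in>UNIV. norm (p i)) * R ^ n * R"
    unfolding sum_distrib_right[symmetric] using Suc R by (intro mult_right_mono)
  finally show ?case
    by (simp add: mult_ac)
qed

section \<open>Real parameters inside a complex holomorphic family\<close>

lemma trans_prod_of_real:
  "trans_prod (\<lambda>i j. of_real (P i j) :: 'b::real_normed_field) u = of_real (trans_prod P u)"
proof (induction u)
  case (Cons i u)
  then show ?case
    by (cases u) auto
qed simp

lemma det_of_real: "det (\<chi> i j. (of_real (M $ i $ j) :: 'b::real_normed_field)) = of_real (det M)"
  by (simp add: det_def)

lemma stat_matrix_of_real:
  "stat_matrix (\<lambda>i j. of_real (P i j) :: 'b::real_normed_field) = (\<chi> i j. of_real (stat_matrix P $ i $ j))"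
  by (simp add: vec_eq_iff stat_matrix_def)

lemma stat_vec_of_real:
  "stat_vec (\<lambda>i j. of_real (P i j) :: 'b::real_normed_field) k = of_real (stat_vec P k)"
proof -
  have "(\<chi> i j. if j = k then 1 else stat_matrix (\<lambda>i j. of_real (P i j) :: 'b) $ i $ j) =
      (\<chi> i j. (of_real ((\<chi> i j. if j = k then 1 else stat_matrix P $ i $ j) $ i $ j) :: 'b))"
    by (simp add: vec_eq_iff stat_matrix_of_real)
  then show ?thesis
    by (simp only: stat_vec_def det_of_real of_real_divide stat_matrix_of_real)
qed

text \<open>What the perturbation argument secures on a complex neighbourhood. The vectors
  \<open>v\<close> and \<open>om\<close> do not depend on \<open>z\<close>, which keeps
  \<open>g\<close> holomorphic; convexity provides logarithms of \<open>g\<close>; and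
  \<open>R * \<kappa> < 1\<close> lets contraction beat the growth of the weights.\<close>

locale hyperbolic_family =
  fixes E :: "('a::finite \<times> 'a) set" and S :: "complex set"
    and Q :: "complex \<Rightarrow> 'a \<Rightarrow> 'a \<Rightarrow> complex" and B :: "complex \<Rightarrow> 'a \<Rightarrow> complex^2^2"
    and v om :: "'a \<Rightarrow> real^2" and b C \<delta> \<kappa> R :: real
  assumes open_S: "open S" and convex_S: "convex S" and S_ne: "S \<noteq> {}"
    and Q_holomorphic: "(\<lambda>z. Q z i j) holomorphic_on S"
    and B_holomorphic: "(\<lambda>z. B z i $ r $ s) holomorphic_on S"
    and Q_det: "z \<in> S \<Longrightarrow> det (stat_matrix (Q z)) \<noteq> 0"
    and Q_norm: "z \<in> S \<Longrightarrow> (\<Sum>j\<in>UNIV. cmod (Q z i j)) \<le> R"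
    and p_norm: "z \<in> S \<Longrightarrow> (\<Sum>i\<in>UNIV. cmod (stat_vec (Q z) i)) \<le> 2"
    and B_norm: "z \<in> S \<Longrightarrow> cmod (B z i $ r $ s) \<le> b"
    and B_det: "z \<in> S \<Longrightarrow> \<delta> \<le> cmod (det (B z i))"
    and \<delta>: "\<delta> > 0" and v_norm: "norm (v i) \<le> b" and om_norm: "norm (om i) \<le> b" and C: "C \<ge> 0"
    and \<kappa>: "0 < \<kappa>" and R: "1 \<le> R" "R * \<kappa> < 1"
    and word_entry_nz: "z \<in> S \<Longrightarrow> adm E u \<Longrightarrow> word_entry (B z) v om u \<noteq> 0"
    and word_entry_small: "z \<in> S \<Longrightarrow> adm E u \<Longrightarrow>
       cmod (det (word_prod (B z) (butlast u))) \<le> C * \<kappa> ^ (length u - 1) * (cmod (word_entry (B z) v om u))\<^sup>2"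
begin

abbreviation "g z \<equiv> word_entry (B z) v om"

text \<open>The division by \<open>\<kappa>\<^sup>2\<close> turns the exponent
  \<open>length u - 2\<close> of \<open>cross_ratio_near_1\<close> into
  \<open>length u\<close>.\<close>

definition K :: real where "K = (8 * b ^ 3)\<^sup>2 * (C / \<delta>) / \<kappa>\<^sup>2"

lemma K_nonneg: "K \<ge> 0"
  unfolding K_def using C \<delta> by simp

lemma cross_ratio_bound:
  assumes "z \<in> S" "adm E u" "length u \<ge> 3"
  shows "cmod (cross_ratio (g z) u - 1) \<le> K * \<kappa> ^ length u"
proof -
  have "cmod (cross_ratio (g z) u - 1) \<le> (8 * b ^ 3)\<^sup>2 * (C / \<delta>) * \<kappa> ^ (length u - 2)"
    by (rule cross_ratio_near_1[where E = E])
      (use assms B_norm B_det \<delta> v_norm om_norm C \<kappa> word_entry_nz word_entry_small in auto)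
  also have "\<kappa> ^ (length u - 2) = \<kappa> ^ length u / \<kappa>\<^sup>2"
    using assms(3) \<kappa> by (simp add: power_diff)
  finally show ?thesis
    by (simp add: K_def)
qed

lemma subwords_admissible:
  assumes "adm E u" "length u \<ge> 3"
  shows "adm E (tl u)" "adm E (butlast u)" "adm E (butlast (tl u))"
proof -
  obtain i m j where "u = i # m @ [j]" "m \<noteq> []"
    using words_split[OF assms(2)] by blast
  then show "adm E (tl u)" "adm E (butlast u)" "adm E (butlast (tl u))"
    using assms(1) by (auto simp: successively_Cons successively_append_iff butlast_append)
qed

lemma ln_cross_ratio:
  assumes "z \<in> S" "adm E u" "length u \<ge> 3"
  shows "ln (cmod (cross_ratio (g z) u)) =
    log_ratio (\<lambda>u. cmod (g z u)) u - log_ratio (\<lambda>u. cmod (g z u)) (tl u)"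
proof -
  have "0 < cmod (g z u)" "0 < cmod (g z (tl u))" "0 < cmod (g z (butlast u))" "0 < cmod (g z (butlast (tl u)))"
    using word_entry_nz[OF assms(1)] assms(2) subwords_admissible[OF assms(2,3)] by auto
  then show ?thesis
    by (simp add: cross_ratio_def log_ratio_def norm_mult norm_divide ln_mult ln_div)
qed

lemma \<kappa>_less_1: "\<kappa> < 1"
proof -
  have "\<kappa> \<le> R * \<kappa>"
    using mult_right_mono[of 1 R \<kappa>] R \<kappa> by simp
  then show ?thesis
    using R by simp
qed

lemma eventually_small: "\<exists>N\<ge>3. \<forall>n\<ge>N. K * \<kappa> ^ n < 1 / 2"
proof -
  have "(\<lambda>n. K * \<kappa> ^ n) \<longlonglongrightarrow> K * 0"
    using \<kappa> \<kappa>_less_1 by (intro tendsto_mult tendsto_const LIMSEQ_power_zero) auto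
  then have "\<forall>\<^sub>F n in sequentially. K * \<kappa> ^ n < 1 / 2"
    by (rule order_tendstoD) simp
  then obtain N where "\<forall>n\<ge>N. K * \<kappa> ^ n < 1 / 2"
    unfolding eventually_at_top_linorder by blast
  then show ?thesis
    by (intro exI[of _ "max 3 N"]) auto
qed

text \<open>From length \<open>N\<close> on, all four words in the cross ratio of an admissible word
  are nonempty, and the cross ratio lies within 1/2 of 1, where the principal logarithm is
  holomorphic.\<close>

definition N where "N = (SOME N. N \<ge> 3 \<and> (\<forall>n\<ge>N. K * \<kappa> ^ n < 1 / 2))"

lemma N: "N \<ge> 3" "n \<ge> N \<Longrightarrow> K * \<kappa> ^ n < 1 / 2"
  unfolding N_def using someI_ex[OF eventually_small] by auto

lemma Ln_cross_ratio:
  assumes "z \<in> S" "adm E u" "length u \<ge> N"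
  shows "cmod (Ln (cross_ratio (g z) u)) \<le> 2 * K * \<kappa> ^ length u"
    and "cross_ratio (g z) u \<notin> \<real>\<^sub>\<le>\<^sub>0" and "cross_ratio (g z) u \<noteq> 0"
proof -
  have len: "length u \<ge> 3"
    using assms(3) N(1) by simp
  note bound = cross_ratio_bound[OF assms(1,2) len]
  have lt: "cmod (cross_ratio (g z) u - 1) < 1 / 2"
    using bound N(2)[OF assms(3)] by linarith
  show "cmod (Ln (cross_ratio (g z) u)) \<le> 2 * K * \<kappa> ^ length u"
    using norm_Ln_le[OF lt] bound by simp
  show "cross_ratio (g z) u \<notin> \<real>\<^sub>\<le>\<^sub>0"
  proof
    assume "cross_ratio (g z) u \<in> \<real>\<^sub>\<le>\<^sub>0"
    then have "Re (cross_ratio (g z) u) \<le> 0"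
      by (simp add: complex_nonpos_Reals_iff)
    moreover have "\<bar>Re (cross_ratio (g z) u - 1)\<bar> < 1 / 2"
      using abs_Re_le_cmod[of "cross_ratio (g z) u - 1"] lt by linarith
    ultimately show False
      by simp
  qed
  then show "cross_ratio (g z) u \<noteq> 0"
    by auto
qed

definition weight :: "complex \<Rightarrow> 'a list \<Rightarrow> complex" where
  "weight z u = path_weight (stat_vec (Q z)) (Q z) u"

definition adm_words :: "nat \<Rightarrow> 'a list set" where
  "adm_words n = {u \<in> words n. adm E u}"

definition correction :: "nat \<Rightarrow> complex \<Rightarrow> complex" where
  "correction n z = (\<Sum>u\<in>adm_words n. weight z u * Ln (cross_ratio (g z) u))"

lemma finite_adm_words [simp]: "finite (adm_words n)"
  unfolding adm_words_def by (rule finite_subset[OF _ finite_words[of n]]) auto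

lemma weight_holomorphic: "(\<lambda>z. weight z u) holomorphic_on S"
  unfolding weight_def path_weight_def
  by (intro holomorphic_intros holomorphic_stat_vec holomorphic_trans_prod Q_holomorphic Q_det)

lemma cross_ratio_holomorphic:
  assumes "adm E u" "length u \<ge> 3"
  shows "(\<lambda>z. cross_ratio (g z) u) holomorphic_on S"
  unfolding cross_ratio_def
  by (intro holomorphic_intros holomorphic_word_entry B_holomorphic)
    (use subwords_admissible[OF assms] word_entry_nz in auto)

lemma correction_holomorphic:
  assumes "n \<ge> N"
  shows "correction n holomorphic_on S"
  unfolding correction_def[abs_def]
proof (intro holomorphic_intros weight_holomorphic)
  fix u assume "u \<in> adm_words n"
  then have u: "adm E u" "length u \<ge> N"
    using assms by (auto simp: adm_words_def)
  then show "(\<lambda>z. cross_ratio (g z) u) holomorphic_on S"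
    using N(1) by (intro cross_ratio_holomorphic) auto
  show "cross_ratio (g z) u \<notin> \<real>\<^sub>\<le>\<^sub>0" if "z \<in> S" for z
    using Ln_cross_ratio(2)[OF that u] .
qed

lemma correction_bound:
  assumes z: "z \<in> S" and n: "n \<ge> N"
  shows "cmod (correction n z) \<le> 4 * K * (R * \<kappa>) ^ n"
proof -
  obtain n' where n': "n = Suc n'"
    using n N(1) by (cases n) auto
  have "cmod (correction n z) \<le> (\<Sum>u\<in>adm_words n. cmod (weight z u) * (2 * K * \<kappa> ^ n))"
    unfolding correction_def
  proof (rule sum_norm_le)
    fix u assume "u \<in> adm_words n"
    then have "adm E u" "length u = n"
      by (auto simp: adm_words_def)
    then show "cmod (weight z u * Ln (cross_ratio (g z) u)) \<le> cmod (weight z u) * (2 * K * \<kappa> ^ n)"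
      unfolding norm_mult using Ln_cross_ratio(1)[OF z, of u] n by (intro mult_left_mono) auto
  qed
  also have "\<dots> \<le> (\<Sum>u\<in>words n. cmod (weight z u) * (2 * K * \<kappa> ^ n))"
    using K_nonneg \<kappa> by (intro sum_mono2) (auto simp: adm_words_def)
  also have "\<dots> = (\<Sum>u\<in>words n. cmod (weight z u)) * (2 * K * \<kappa> ^ n)"
    by (simp add: sum_distrib_right)
  also have "\<dots> \<le> ((\<Sum>i\<in>UNIV. cmod (stat_vec (Q z) i)) * R ^ n') * (2 * K * \<kappa> ^ n)"
    unfolding weight_def n' using K_nonneg \<kappa> Q_norm[OF z]
    by (intro mult_right_mono sum_norm_path_weight_le) auto
  \<comment> \<open>The first 2 bounds the mass of the complexified stationary vector, and
    \<open>R \<ge> 1\<close> absorbs the passage from \<open>n - 1\<close> to \<open>n\<close>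
    factors.\<close>
  also have "\<dots> \<le> (2 * R ^ n) * (2 * K * \<kappa> ^ n)"
    using K_nonneg \<kappa> R p_norm[OF z] n' by (intro mult_right_mono mult_mono power_increasing) auto
  finally show ?thesis
    by (simp add: power_mult_distrib mult_ac)
qed

lemma corrections_sum:
  obtains F where "F holomorphic_on S" "\<And>z. z \<in> S \<Longrightarrow> (\<lambda>n. correction (n + N) z) sums F z"
proof -
  have sm: "summable (\<lambda>n. 4 * K * (R * \<kappa>) ^ (n + N))"
    using R \<kappa> by (intro summable_mult summable_ignore_initial_segment summable_geometric) (auto simp: abs_mult)
  have deriv: "(correction (n + N) has_field_derivative deriv (correction (n + N)) z) (at z)" if "z \<in> S" for n z
    using that by (intro holomorphic_derivI[OF correction_holomorphic open_S]) auto
  have bound: "\<forall>\<^sub>F n in sequentially. \<forall>z\<in>S. norm (correction (n + N) z) \<le> 4 * K * (R * \<kappa>) ^ (n + N)"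
    by (intro always_eventually allI ballI correction_bound) auto
  obtain F F' where F: "\<forall>z\<in>S. ((\<lambda>n. correction (n + N) z) sums F z) \<and>
      ((\<lambda>n. deriv (correction (n + N)) z) sums F' z) \<and> (F has_field_derivative F' z) (at z)"
    by (rule series_and_derivative_comparison[OF open_S sm deriv bound])
  then have "F holomorphic_on S"
    using open_S holomorphic_on_open by blast
  with F show ?thesis
    using that by blast
qed

text \<open>The ratios in the starting mean need not be near 1, so a holomorphic logarithm of each
  nowhere vanishing \<open>g\<close> is chosen on the convex set \<open>S\<close>. The choices for
  different words need not match, since only their real parts are compared with the mean.\<close>

lemma initial_term:
  "\<exists>G h. G holomorphic_on S \<and>
    (\<forall>z\<in>S. G z = (\<Sum>u\<in>adm_words (N - 1). weight z u * (h u z - h (butlast u) z))) \<and>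
    (\<forall>z\<in>S. \<forall>u. adm E u \<longrightarrow> Re (h u z) = ln (cmod (g z u)))"
proof -
  have "\<exists>h. h holomorphic_on S \<and> (\<forall>z\<in>S. exp (h z) = g z u)" if u: "adm E u" for u
  proof -
    obtain z0 where "z0 \<in> S"
      using S_ne by blast
    then show ?thesis
      using holomorphic_logarithm_exists[OF convex_S open_S holomorphic_word_entry[OF B_holomorphic] word_entry_nz[OF _ u]]
      by metis
  qed
  then obtain h where h: "\<And>u. adm E u \<Longrightarrow> h u holomorphic_on S" "\<And>u z. adm E u \<Longrightarrow> z \<in> S \<Longrightarrow> exp (h u z) = g z u"
    by metis
  show ?thesis
  proof (intro exI[of _ "\<lambda>z. \<Sum>u\<in>adm_words (N - 1). weight z u * (h u z - h (butlast u) z)"] exI[of _ h] conjI)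
    show "(\<lambda>z. \<Sum>u\<in>adm_words (N - 1). weight z u * (h u z - h (butlast u) z)) holomorphic_on S"
    proof (intro holomorphic_intros weight_holomorphic h)
      fix u assume "u \<in> adm_words (N - 1)"
      then have u: "adm E u" "length u \<ge> 2"
        using N(1) by (auto simp: adm_words_def)
      then show "u \<noteq> [] \<and> successively (\<lambda>i j. (i, j) \<in> E) u"
        by blast
      show "butlast u \<noteq> [] \<and> successively (\<lambda>i j. (i, j) \<in> E) (butlast u)"
        using u by (cases u rule: rev_cases) (auto simp: successively_append_iff)
    qed
    have "Re (h u z) = ln (cmod (g z u))" if "z \<in> S" "adm E u" for z u
      unfolding h(2)[OF that(2,1), symmetric] by simp
    then show "\<forall>z\<in>S. \<forall>u. adm E u \<longrightarrow> Re (h u z) = ln (cmod (g z u))"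
      by blast
  qed simp
qed

text \<open>At real parameters the real parts telescope: the initial term gives the mean logarithmic
  ratio at length \<open>N - 1\<close>, and each correction gives the next increment. Sums over
  admissible words are sums over all words there, because the other words have weight 0.\<close>

lemma limit_function:
  obtains F where "F holomorphic_on S"
    "\<And>z P. z \<in> S \<Longrightarrow> (\<And>i j. Q z i j = of_real (P i j)) \<Longrightarrow> irreducible_chain P \<Longrightarrow>
       (\<And>i j. P i j > 0 \<longleftrightarrow> (i, j) \<in> E) \<Longrightarrow>
       mean_log_ratio (stat_vec P) P (\<lambda>u. cmod (g z u)) \<longlonglongrightarrow> Re (F z)"
proof -
  obtain F where F: "F holomorphic_on S" "\<And>z. z \<in> S \<Longrightarrow> (\<lambda>n. correction (n + N) z) sums F z"
    using corrections_sum by blast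
  obtain G h where G: "G holomorphic_on S"
    "\<And>z. z \<in> S \<Longrightarrow> G z = (\<Sum>u\<in>adm_words (N - 1). weight z u * (h u z - h (butlast u) z))"
    and h: "\<And>z u. z \<in> S \<Longrightarrow> adm E u \<Longrightarrow> Re (h u z) = ln (cmod (g z u))"
    using initial_term by blast
  show ?thesis
  proof (rule that)
    show "(\<lambda>z. G z + F z) holomorphic_on S"
      by (intro holomorphic_intros G F)
    fix z P assume z: "z \<in> S" and P: "\<And>i j. Q z i j = of_real (P i j)" and irr: "irreducible_chain P"
      and E: "\<And>i j. P i j > 0 \<longleftrightarrow> (i, j) \<in> E"
    interpret irreducible_chain P by (rule irr)
    let ?p = "stat_vec P" and ?a = "\<lambda>u. cmod (g z u)"
    have Q: "Q z = (\<lambda>i j. of_real (P i j))"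
      by (simp add: P fun_eq_iff)
    have weight: "weight z u = of_real (path_weight ?p P u)" for u
      by (simp add: weight_def path_weight_def Q stat_vec_of_real trans_prod_of_real)
    have not_adm: "path_weight ?p P u = 0" if "u \<noteq> []" "\<not> adm E u" for u
      using path_weight_not_admissible[OF that(1), of ?p] that(2) by (simp add: E)
    have sum_adm: "(\<Sum>u\<in>words n. path_weight ?p P u * f u) = (\<Sum>u\<in>adm_words n. path_weight ?p P u * f u)" if "n \<ge> 1" for n f
    proof (rule sum.mono_neutral_right)
      show "\<forall>u\<in>words n - adm_words n. path_weight ?p P u * f u = 0"
      proof
        fix u assume "u \<in> words n - adm_words n"
        then have "u \<noteq> []" "\<not> adm E u"
          using that by (auto simp: adm_words_def)
        then show "path_weight ?p P u * f u = 0"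
          by (simp add: not_adm)
      qed
    qed (auto simp: adm_words_def)
    have G_eq: "Re (G z) = mean_log_ratio ?p P ?a (N - 1)"
    proof -
      have "Re (G z) = (\<Sum>u\<in>adm_words (N - 1). path_weight ?p P u * (Re (h u z) - Re (h (butlast u) z)))"
        using z by (simp add: G weight)
      also have "\<dots> = (\<Sum>u\<in>adm_words (N - 1). path_weight ?p P u * log_ratio ?a u)"
      proof (rule sum.cong)
        fix u assume "u \<in> adm_words (N - 1)"
        then have u: "adm E u" "length u \<ge> 2"
          using N(1) by (auto simp: adm_words_def)
        then have "adm E (butlast u)"
          by (cases u rule: rev_cases) (auto simp: successively_append_iff)
        then show "path_weight ?p P u * (Re (h u z) - Re (h (butlast u) z)) = path_weight ?p P u * log_ratio ?a u"
          using h[OF z] u by (simp add: log_ratio_def)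
      qed simp
      finally show ?thesis
        using N(1) by (simp add: mean_log_ratio_def sum_adm)
    qed
    have corr_eq: "Re (correction (n + N) z) =
        mean_log_ratio ?p P ?a (Suc n + (N - 1)) - mean_log_ratio ?p P ?a (n + (N - 1))" for n
    proof -
      have nN: "Suc (n + (N - 1)) = n + N"
        using N(1) by simp
      have "Re (correction (n + N) z) = (\<Sum>u\<in>adm_words (n + N). path_weight ?p P u * Re (Ln (cross_ratio (g z) u)))"
        by (simp add: correction_def weight)
      also have "\<dots> = (\<Sum>u\<in>adm_words (n + N). path_weight ?p P u * (log_ratio ?a u - log_ratio ?a (tl u)))"
      proof (rule sum.cong)
        fix u assume "u \<in> adm_words (n + N)"
        then have u: "adm E u" "length u \<ge> N"
          by (auto simp: adm_words_def)
        then have "Re (Ln (cross_ratio (g z) u)) = ln (cmod (cross_ratio (g z) u))"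
          using Ln_cross_ratio(3)[OF z] by simp
        also have "\<dots> = log_ratio ?a u - log_ratio ?a (tl u)"
          using u N(1) by (intro ln_cross_ratio z) auto
        finally show "path_weight ?p P u * Re (Ln (cross_ratio (g z) u)) = path_weight ?p P u * (log_ratio ?a u - log_ratio ?a (tl u))"
          by simp
      qed simp
      also have "\<dots> = (\<Sum>u\<in>words (n + N). path_weight ?p P u * (log_ratio ?a u - log_ratio ?a (tl u)))"
        using N(1) by (simp add: sum_adm)
      also have "\<dots> = mean_log_ratio ?p P ?a (Suc n + (N - 1)) - mean_log_ratio ?p P ?a (n + (N - 1))"
        using mean_log_ratio_Suc[OF stat_vec_stationary(2)[OF det_stat_matrix rows], of "n + (N - 1)" ?a] N(1)
        unfolding nN by simp
      finally show ?thesis .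
    qed
    have "(\<lambda>n. Re (correction (n + N) z)) sums Re (F z)"
      by (rule sums_Re[OF F(2)[OF z]])
    then have "(\<lambda>n. \<Sum>k<n. mean_log_ratio ?p P ?a (Suc k + (N - 1)) - mean_log_ratio ?p P ?a (k + (N - 1))) \<longlonglongrightarrow> Re (F z)"
      by (simp add: sums_def corr_eq)
    then have "(\<lambda>n. mean_log_ratio ?p P ?a (n + (N - 1)) - mean_log_ratio ?p P ?a (0 + (N - 1))) \<longlonglongrightarrow> Re (F z)"
      by (subst (asm) sum_lessThan_telescope)
    then have "(\<lambda>n. (mean_log_ratio ?p P ?a (n + (N - 1)) - mean_log_ratio ?p P ?a (N - 1)) + Re (G z)) \<longlonglongrightarrow> Re (F z) + Re (G z)"
      by (intro tendsto_add tendsto_const) simp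
    then have "(\<lambda>n. mean_log_ratio ?p P ?a (n + (N - 1))) \<longlonglongrightarrow> Re (G z + F z)"
      by (simp add: G_eq add.commute)
    then show "mean_log_ratio ?p P ?a \<longlonglongrightarrow> Re (G z + F z)"
      by (rule LIMSEQ_offset)
  qed
qed

lemma log_ratio_contraction:
  assumes "z \<in> S" "adm E u" "length u \<ge> N"
  shows "\<bar>log_ratio (\<lambda>u. cmod (g z u)) u - log_ratio (\<lambda>u. cmod (g z u)) (tl u)\<bar> \<le> 2 * K * \<kappa> ^ length u"
proof -
  have "log_ratio (\<lambda>u. cmod (g z u)) u - log_ratio (\<lambda>u. cmod (g z u)) (tl u) = Re (Ln (cross_ratio (g z) u))"
    using ln_cross_ratio[OF assms(1,2)] Ln_cross_ratio(3)[OF assms] assms(3) N(1) by simp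
  then show ?thesis
    using abs_Re_le_cmod[of "Ln (cross_ratio (g z) u)"] Ln_cross_ratio(1)[OF assms] by simp
qed

end

section \<open>Analyticity of the Lyapunov exponent\<close>

definition cmat :: "real^2^2 \<Rightarrow> complex^2^2" where
  "cmat M = (\<chi> r s. of_real (M $ r $ s))"

lemma cmat_nth [simp]: "cmat M $ r $ s = of_real (M $ r $ s)"
  by (simp add: cmat_def)

lemma word_prod_cmat: "word_prod (\<lambda>i. cmat (A i)) u = cmat (word_prod A u)"
proof (induction u)
  case Nil
  show ?case
    by (simp add: vec_eq_iff mat_def)
next
  case (Cons i u)
  then show ?case
    by (simp add: vec_eq_iff matrix_matrix_mult_def)
qed

lemma cmat_mult_cvec: "cmat M *v cvec x = cvec (M *v x)"
  by (simp add: vec_eq_iff matrix_vector_mult_def)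

text \<open>The bound on the images of all vectors dominates the norm by \<open>g\<close>.
  Conversely, \<open>g\<close> is the determinant of the image of some \<open>v i\<close> with some
  \<open>om j\<close>, hence at most a constant times the norm.\<close>

lemma ln_mnorm_word_entry:
  fixes A :: "'a \<Rightarrow> real^2^2"
  defines "B \<equiv> \<lambda>i. cmat (A i)"
  assumes g: "word_entry B v om u \<noteq> 0" and C: "C > 0" and b: "b > 0"
    and entries: "\<And>x i. cmod ((word_prod B (butlast u) *v x) $ i) \<le> C * cmod (word_entry B v om u) * norm x"
    and v: "\<And>i. norm (v i) \<le> b" and om: "\<And>i. norm (om i) \<le> b"
  shows "\<bar>ln (mnorm (word_prod A (butlast u))) - ln (cmod (word_entry B v om u))\<bar> \<le> \<bar>ln (2 * C)\<bar> + \<bar>ln (2 * b * b)\<bar>"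
proof -
  let ?g = "cmod (word_entry B v om u)"
  define M where "M = word_prod A (butlast u)"
  have M: "word_prod B (butlast u) = cmat M"
    unfolding B_def word_prod_cmat M_def ..
  have gpos: "?g > 0"
    using g by simp
  have up: "mnorm M \<le> 2 * C * ?g"
    unfolding mnorm_def
  proof (rule onorm_le)
    fix x
    have "norm (cmat M *v cvec x) \<le> 2 * (C * ?g * norm (cvec x))"
      by (rule norm_le_of_components) (rule entries[unfolded M])
    then show "norm (M *v x) \<le> 2 * C * ?g * norm x"
      by (simp add: cmat_mult_cvec)
  qed
  have nn: "0 \<le> mnorm M"
    unfolding mnorm_def by (rule onorm_pos_le[OF matrix_vector_mul_bounded_linear])
  have "?g \<le> 2 * norm (M *v v (hd u)) * norm (om (last u))"
    unfolding word_entry_def M cmat_mult_cvec using norm_det2_le[of "cvec (M *v v (hd u))" "cvec (om (last u))"] by simp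
  also have "\<dots> \<le> 2 * (mnorm M * b) * b"
  proof -
    have "norm (M *v v (hd u)) \<le> mnorm M * norm (v (hd u))"
      unfolding mnorm_def by (rule onorm[OF matrix_vector_mul_bounded_linear])
    also have "\<dots> \<le> mnorm M * b"
      using v nn by (intro mult_left_mono)
    finally show ?thesis
      using om b nn by (intro mult_mono) auto
  qed
  finally have lo: "?g \<le> (2 * b * b) * mnorm M"
    by (simp add: mult_ac)
  then have pos: "mnorm M > 0"
    using gpos nn b by (metis less_eq_real_def mult_zero_right not_less)
  have "ln (mnorm M) \<le> ln (2 * C * ?g)"
    using up pos by (rule ln_mono)
  then have 1: "ln (mnorm M) \<le> ln (2 * C) + ln ?g"
    using C gpos by (simp add: ln_mult)
  have "ln ?g \<le> ln ((2 * b * b) * mnorm M)"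
    using lo gpos by (rule ln_mono)
  then have 2: "ln ?g \<le> ln (2 * b * b) + ln (mnorm M)"
    using b pos by (subst (asm) ln_mult) auto
  show ?thesis
    unfolding M_def[symmetric] using 1 2 by linarith
qed

text \<open>\<open>lyap_exp\<close> is a definite description over all stationary data. A Markov
  measure exists, which gives existence of the value; two almost sure limits on one probability
  space agree, which gives uniqueness.\<close>

lemma lyap_exp_eqI:
  fixes P :: "'a::finite \<Rightarrow> 'a \<Rightarrow> real"
  assumes "irreducible_chain P"
    and lim: "\<And>p \<mu>. markov_chain P p \<mu> \<Longrightarrow> AE x in \<mu>. (\<lambda>n. ln (mnorm (mprod A x n)) / real n) \<longlonglongrightarrow> L"
  shows "lyap_exp A P = L"
proof -
  interpret irreducible_chain P
    by fact
  have chain: "markov_chain P p \<mu>" if "stationary_vec P p" "markov_measure P p \<mu>" for p \<mu>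
    using that by unfold_locales
  obtain \<mu> where \<mu>: "markov_measure P (stat_vec P) \<mu>"
    using markov_measure_exists[OF stationary_stat_vec nonneg rows] by blast
  show ?thesis
    unfolding lyap_exp_def
  proof (rule the_equality)
    show "\<exists>p \<mu>. stationary_vec P p \<and> markov_measure P p \<mu> \<and>
       (AE x in \<mu>. (\<lambda>n. ln (mnorm (mprod A x n)) / real n) \<longlonglongrightarrow> L)"
      using stationary_stat_vec \<mu> lim[OF chain[OF stationary_stat_vec \<mu>]] by blast
  next
    fix L' assume "\<exists>p \<mu>. stationary_vec P p \<and> markov_measure P p \<mu> \<and>
       (AE x in \<mu>. (\<lambda>n. ln (mnorm (mprod A x n)) / real n) \<longlonglongrightarrow> L')"
    then obtain p \<mu> where p: "stationary_vec P p" "markov_measure P p \<mu>"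
      and L': "AE x in \<mu>. (\<lambda>n. ln (mnorm (mprod A x n)) / real n) \<longlonglongrightarrow> L'"
      by blast
    interpret markov_chain P p \<mu>
      by (rule chain[OF p])
    have "AE x in \<mu>. L' = L"
      using L' lim[OF chain[OF p]] by eventually_elim (rule LIMSEQ_unique)
    then show "L' = L"
      by simp
  qed
qed

lemma finite_holomorphic_extensions:
  fixes f :: "'i::finite \<Rightarrow> real \<Rightarrow> real"
  assumes "\<And>i. real_analytic_on (f i) J" "x \<in> J"
  obtains r F where "r > 0" "\<And>i. F i holomorphic_on ball (of_real x) r"
    "\<And>i y. \<bar>y - x\<bar> < r \<Longrightarrow> F i (of_real y) = of_real (f i y)"
proof -
  have "\<exists>r F. r > 0 \<and> F holomorphic_on ball (of_real x) r \<and> (\<forall>y. \<bar>y - x\<bar> < r \<longrightarrow> F (of_real y) = of_real (f i y))" for i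
    using real_analytic_holomorphic_extension[OF assms(1)[of i] assms(2)] by metis
  then obtain r F where rF: "\<And>i. r i > 0" "\<And>i. F i holomorphic_on ball (of_real x) (r i)"
    "\<And>i y. \<bar>y - x\<bar> < r i \<Longrightarrow> F i (of_real y) = of_real (f i y)"
    by metis
  define r0 where "r0 = Min (range r)"
  have le: "r0 \<le> r i" for i
    by (simp add: r0_def)
  show ?thesis
  proof (rule that)
    show "r0 > 0"
      using rF(1) by (simp add: r0_def)
    show "F i holomorphic_on ball (of_real x) r0" for i
      using rF(2) by (rule holomorphic_on_subset) (rule subset_ball[OF le])
    show "F i (of_real y) = of_real (f i y)" if "\<bar>y - x\<bar> < r0" for i y
      using le[of i] that by (intro rF(3)) linarith
  qed
qed

lemma holomorphic_tendsto_nhds: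
  assumes "F holomorphic_on ball a r" "r > 0"
  shows "(F \<longlongrightarrow> F a) (nhds a)"
proof -
  have "isCont F a"
    using holomorphic_on_imp_continuous_on[OF assms(1)] assms(2) by (simp add: continuous_on_eq_continuous_at)
  then show ?thesis
    by (simp add: isCont_def tendsto_at_iff_tendsto_nhds)
qed

theorem theorem5p1:
  fixes E :: "('a::finite \<times> 'a) set"
    and J :: "real set"
    and P :: "real \<Rightarrow> 'a \<Rightarrow> 'a \<Rightarrow> real"
    and A :: "real \<Rightarrow> 'a \<Rightarrow> real^2^2"
    and t0 :: real
  assumes strongly_connected: "\<forall>i j. (i, j) \<in> E\<^sup>*"
    and J_open_interval: "open J" "is_interval J" "J \<noteq> {}"
    and P_stoch: "\<forall>t\<in>J. \<forall>i j. P t i j \<ge> 0"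
    and P_rows: "\<forall>t\<in>J. \<forall>i. (\<Sum>j\<in>UNIV. P t i j) = 1"
    and P_support: "\<forall>t\<in>J. \<forall>i j. P t i j > 0 \<longleftrightarrow> (i, j) \<in> E"
    and P_analytic: "\<forall>i j. real_analytic_on (\<lambda>t. P t i j) J"
    and A_GL: "\<forall>t\<in>J. \<forall>i. invertible (A t i)"
    and A_analytic: "\<forall>i r s. real_analytic_on (\<lambda>t. A t i $ r $ s) J"
    and t0_in: "t0 \<in> J"
    and PUH: "proj_unif_hyp E (A t0)"
  shows "\<exists>U. open U \<and> t0 \<in> U \<and> U \<subseteq> J \<and>
           real_analytic_on (\<lambda>t. lyap_exp (A t) (P t)) U"
proof -
  have E_eq: "{(i, j). P t i j > 0} = E" if "t \<in> J" for t
    using P_support that by auto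
  have chain: "irreducible_chain (P t)" if "t \<in> J" for t
    by unfold_locales (use P_stoch P_rows strongly_connected E_eq[OF that] that in auto)
  interpret P0: irreducible_chain "P t0"
    by (rule chain[OF t0_in])
  \<comment> \<open>\<open>E\<^sup>*\<close> is reflexive, so on a one-point alphabet connectivity
    provides no edge; the row sum does.\<close>
  have succ: "\<exists>j. (i, j) \<in> E" for i
  proof (rule ccontr)
    assume "\<nexists>j. (i, j) \<in> E"
    then have "P t0 i j = 0" for j
      using P_support P_stoch t0_in by (metis less_eq_real_def)
    then show False
      using P0.rows[of i] by simp
  qed
  \<comment> \<open>The last edge of a path from \<open>k\<close> back to \<open>j\<close> enters
    \<open>j\<close>; if that path is empty, \<open>k\<close> is \<open>j\<close> and the edge from
    \<open>j\<close> to \<open>k\<close> is a loop.\<close>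
  have pred: "\<exists>i. (i, j) \<in> E" for j
  proof -
    obtain k where "(j, k) \<in> E"
      using succ by blast
    moreover have "(k, j) \<in> E\<^sup>*"
      using strongly_connected by blast
    ultimately show ?thesis
      by (metis rtranclE)
  qed
  obtain d w where "dominated_splitting E (A t0) d w"
    using proj_unif_hyp_splitting[OF PUH] A_GL t0_in by metis
  then interpret dominated_splitting E "A t0" d w .
  obtain v om \<kappa> c where \<kappa>: "0 < \<kappa>" "\<kappa> < 1" and c: "0 < c"
    and words: "\<And>u. adm E u \<Longrightarrow> hyperbolic_word (A t0) v om \<kappa> c u"
    using hyperbolic_words[OF succ pred] by metis
  define \<theta> where "\<theta> = (1 - \<kappa>) / 16"
  define \<kappa>' where "\<kappa>' = ((1 + \<theta>) * (\<kappa> + \<theta>) + \<theta>\<^sup>2) / (1 - 2 * \<theta>)\<^sup>2"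
  note rate = contraction_rate[OF \<kappa> \<theta>_def, folded \<kappa>'_def]
  define \<epsilon> where "\<epsilon> = \<theta> * c ^ 4 / 8"
  have \<epsilon>: "\<epsilon> > 0"
    using rate c by (simp add: \<epsilon>_def)
  \<comment> \<open>Chosen so that \<open>1 - R * \<kappa>'\<close> is half of
    \<open>(1 - \<kappa>') * (2 - \<kappa>')\<close>.\<close>
  define R where "R = 1 + (1 - \<kappa>') / 2"
  have R: "R > 1" "R * \<kappa>' < 1"
  proof -
    show "R > 1"
      using rate by (simp add: R_def)
    have "0 < (1 - \<kappa>') * (2 - \<kappa>')"
      using rate by (intro mult_pos_pos) auto
    also have "(1 - \<kappa>') * (2 - \<kappa>') = 2 - 2 * (R * \<kappa>')"
      by (simp add: R_def field_simps)
    finally show "R * \<kappa>' < 1"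
      by simp
  qed
  obtain rP FP where rP: "rP > 0" "\<And>e. FP e holomorphic_on ball (of_real t0) rP"
    "\<And>e y. \<bar>y - t0\<bar> < rP \<Longrightarrow> FP e (of_real y) = of_real (P y (fst e) (snd e))"
    by (rule finite_holomorphic_extensions[of "\<lambda>e :: 'a \<times> 'a. \<lambda>t. P t (fst e) (snd e)" J t0])
      (use P_analytic t0_in in blast)+
  obtain rA FA where rA: "rA > 0" "\<And>e. FA e holomorphic_on ball (of_real t0) rA"
    "\<And>e y. \<bar>y - t0\<bar> < rA \<Longrightarrow> FA e (of_real y) = of_real (A y (fst e) $ fst (snd e) $ snd (snd e))"
    by (rule finite_holomorphic_extensions[of "\<lambda>e :: 'a \<times> 2 \<times> 2. \<lambda>t. A t (fst e) $ fst (snd e) $ snd (snd e)" J t0])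
      (use A_analytic t0_in in blast)+
  obtain rJ where rJ: "rJ > 0" "ball t0 rJ \<subseteq> J"
    using J_open_interval(1) t0_in open_contains_ball by blast
  define r1 where "r1 = min rP (min rA rJ)"
  have r1: "r1 > 0" "r1 \<le> rP" "r1 \<le> rA" "r1 \<le> rJ"
    using rP(1) rA(1) rJ(1) by (auto simp: r1_def)
  have in_J: "y \<in> J" if "\<bar>y - t0\<bar> < r1" for y
    using rJ(2) that r1 by (auto simp: dist_real_def abs_minus_commute)
  define a :: complex where "a = of_real t0"
  define Q where "Q z i j = (if (i, j) \<in> E then FP (i, j) z else 0)" for z i j
  define B where "B z i = (\<chi> r s. FA (i, r, s) z)" for z i
  have Q_holo: "(\<lambda>z. Q z i j) holomorphic_on ball a r1" for i j
    using holomorphic_on_subset[OF rP(2)[of "(i, j)"], of "ball a r1"] r1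
    by (cases "(i, j) \<in> E") (auto simp: Q_def a_def subset_ball)
  have B_holo: "(\<lambda>z. B z i $ r $ s) holomorphic_on ball a r1" for i r s
    using holomorphic_on_subset[OF rA(2)[of "(i, r, s)"], of "ball a r1"] r1
    by (auto simp: B_def a_def subset_ball)
  have Q_real: "Q (of_real y) i j = of_real (P y i j)" if "\<bar>y - t0\<bar> < r1" for y i j
  proof (cases "(i, j) \<in> E")
    case False
    then have "P y i j = 0"
      using P_support P_stoch in_J[OF that] by (metis less_eq_real_def)
    then show ?thesis
      using False by (simp add: Q_def)
  qed (use rP(3)[of y "(i, j)"] that r1 in \<open>simp add: Q_def\<close>)
  have B_real: "B (of_real y) i = cmat (A y i)" if "\<bar>y - t0\<bar> < r1" for y i
    using rA(3) that r1 by (simp add: B_def cmat_def vec_eq_iff)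
  have Q_a: "Q a = (\<lambda>i j. of_real (P t0 i j))"
    using Q_real[of t0] r1 by (simp add: a_def fun_eq_iff)
  have B_a: "B a i = cmat (A t0 i)" for i
    using B_real[of t0] r1 by (simp add: a_def)
  have stat_a: "stat_vec (Q a) i = of_real (stat_vec (P t0) i)" for i
    by (simp add: Q_a stat_vec_of_real)
  have det_stat_a: "det (stat_matrix (Q a)) \<noteq> 0"
    using P0.det_stat_matrix by (simp add: Q_a stat_matrix_of_real det_of_real)
  have det_A: "det (A t0 i) \<noteq> 0" for i
    using A_GL t0_in invertible_det_nz by blast
  \<comment> \<open>Half of the smallest determinant at \<open>t0\<close>, so that the lower bound
    is strict there and persists nearby.\<close>
  define \<delta> where "\<delta> = Min (range (\<lambda>i. \<bar>det (A t0 i)\<bar>)) / 2"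
  have \<delta>: "\<delta> > 0"
    using det_A by (simp add: \<delta>_def)
  have \<delta>_less: "\<delta> < \<bar>det (A t0 i)\<bar>" for i
  proof -
    have "2 * \<delta> \<le> \<bar>det (A t0 i)\<bar>"
      by (simp add: \<delta>_def)
    then show ?thesis
      using \<delta> by linarith
  qed
  \<comment> \<open>Finitely many open conditions follow, each satisfied at \<open>a\<close>. The
    row sums there are 1, below \<open>R\<close>, and the stationary vector has mass 1, below
    2.\<close>
  note lim = holomorphic_tendsto_nhds[OF _ r1(1)]
  have "\<forall>\<^sub>F z in nhds a. \<forall>i r s. cmod (B z i $ r $ s - of_real (A t0 i $ r $ s)) < \<epsilon>"
  proof (intro eventually_all_finite)
    fix i r s
    have "\<forall>\<^sub>F z in nhds a. dist (B z i $ r $ s) (B a i $ r $ s) < \<epsilon>"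
      using lim[OF B_holo] \<epsilon> by (rule tendstoD)
    then show "\<forall>\<^sub>F z in nhds a. cmod (B z i $ r $ s - of_real (A t0 i $ r $ s)) < \<epsilon>"
      by (simp add: B_a dist_norm)
  qed
  moreover have "\<forall>\<^sub>F z in nhds a. \<forall>i. (\<Sum>j\<in>UNIV. cmod (Q z i j)) < R"
  proof (intro eventually_all_finite)
    fix i
    have "((\<lambda>z. \<Sum>j\<in>UNIV. cmod (Q z i j)) \<longlongrightarrow> (\<Sum>j\<in>UNIV. cmod (Q a i j))) (nhds a)"
      by (intro tendsto_sum tendsto_norm lim Q_holo)
    moreover have "(\<Sum>j\<in>UNIV. cmod (Q a i j)) < R"
      using R P0.rows[of i] P0.nonneg by (simp add: Q_a)
    ultimately show "\<forall>\<^sub>F z in nhds a. (\<Sum>j\<in>UNIV. cmod (Q z i j)) < R"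
      by (rule order_tendstoD)
  qed
  moreover have "\<forall>\<^sub>F z in nhds a. det (stat_matrix (Q z)) \<noteq> 0"
  proof (rule tendsto_imp_eventually_ne[OF _ det_stat_a])
    show "((\<lambda>z. det (stat_matrix (Q z))) \<longlongrightarrow> det (stat_matrix (Q a))) (nhds a)"
      by (intro lim holomorphic_det holomorphic_stat_matrix Q_holo)
  qed
  moreover have "\<forall>\<^sub>F z in nhds a. (\<Sum>i\<in>UNIV. cmod (stat_vec (Q z) i)) < 2"
  proof (rule order_tendstoD)
    show "((\<lambda>z. \<Sum>i\<in>UNIV. cmod (stat_vec (Q z) i)) \<longlongrightarrow> (\<Sum>i\<in>UNIV. cmod (stat_vec (Q a) i))) (nhds a)"
      unfolding stat_vec_def
    proof (intro tendsto_sum tendsto_norm tendsto_divide det_stat_a lim holomorphic_det)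
      fix k i j
      show "(\<lambda>z. (\<chi> i j. if j = k then 1 else stat_matrix (Q z) $ i $ j) $ i $ j) holomorphic_on ball a r1"
        by (cases "j = k") (simp_all add: holomorphic_stat_matrix[OF Q_holo])
    qed (rule holomorphic_stat_matrix[OF Q_holo])
    show "(\<Sum>i\<in>UNIV. cmod (stat_vec (Q a) i)) < 2"
      using P0.stationary_stat_vec by (simp add: stat_a stationary_vec_def)
  qed
  moreover have "\<forall>\<^sub>F z in nhds a. \<forall>i. \<delta> < cmod (det (B z i))"
  proof (intro eventually_all_finite)
    fix i
    have "((\<lambda>z. cmod (det (B z i))) \<longlongrightarrow> cmod (det (B a i))) (nhds a)"
      by (intro tendsto_norm lim holomorphic_det B_holo)
    moreover have "\<delta> < cmod (det (B a i))"
      using \<delta>_less[of i] by (simp add: B_a cmat_def det_of_real)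
    ultimately show "\<forall>\<^sub>F z in nhds a. \<delta> < cmod (det (B z i))"
      by (rule order_tendstoD)
  qed
  ultimately have "\<forall>\<^sub>F z in nhds a. (\<forall>i r s. cmod (B z i $ r $ s - of_real (A t0 i $ r $ s)) < \<epsilon>) \<and>
      (\<forall>i. (\<Sum>j\<in>UNIV. cmod (Q z i j)) < R) \<and> det (stat_matrix (Q z)) \<noteq> 0 \<and>
      (\<Sum>i\<in>UNIV. cmod (stat_vec (Q z) i)) < 2 \<and> (\<forall>i. \<delta> < cmod (det (B z i)))"
    (is "\<forall>\<^sub>F z in nhds a. ?near z")
    by (intro eventually_conj)
  then obtain r2 where r2: "r2 > 0" and near: "\<And>z. dist z a < r2 \<Longrightarrow> ?near z"
    unfolding eventually_nhds_metric by blast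
  define r where "r = min r1 r2"
  define S where "S = ball a r"
  have r: "r > 0" "r \<le> r1" "r \<le> r2"
    using r1 r2 by (auto simp: r_def)
  have S: "S \<subseteq> ball a r1" "\<And>z. z \<in> S \<Longrightarrow> dist z a < r2"
    using r by (auto simp: S_def dist_commute)
  note near = near[OF S(2)]
  have near_A: "cmod (B z i $ r $ s - of_real (A t0 i $ r $ s)) \<le> \<theta> * c ^ 4 / 8" if "z \<in> S" for z i r s
    using near[OF that] unfolding \<epsilon>_def by (meson less_imp_le)
  note pw = perturbed_word[OF \<kappa> c \<theta>_def _ words near_A, folded \<kappa>'_def]
  \<comment> \<open>A common bound for \<open>v\<close>, \<open>om\<close> and the entries of
    \<open>B\<close> on \<open>S\<close>, where \<epsilon> allows for the perturbation.\<close>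
  define b where "b = 1 + \<epsilon> + (\<Sum>i\<in>UNIV. norm (v i) + norm (om i) + (\<Sum>r\<in>UNIV. \<Sum>s\<in>UNIV. \<bar>A t0 i $ r $ s\<bar>))"
  have b_ge: "norm (v i) + norm (om i) + (\<Sum>r\<in>UNIV. \<Sum>s\<in>UNIV. \<bar>A t0 i $ r $ s\<bar>) \<le> b - 1 - \<epsilon>" for i
  proof -
    have "norm (v i) + norm (om i) + (\<Sum>r\<in>UNIV. \<Sum>s\<in>UNIV. \<bar>A t0 i $ r $ s\<bar>) \<le>
        (\<Sum>i\<in>UNIV. norm (v i) + norm (om i) + (\<Sum>r\<in>UNIV. \<Sum>s\<in>UNIV. \<bar>A t0 i $ r $ s\<bar>))"
      by (rule member_le_sum) (auto intro!: add_nonneg_nonneg sum_nonneg)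
    then show ?thesis
      by (simp add: b_def)
  qed
  have sum_nn: "0 \<le> (\<Sum>r\<in>UNIV. \<Sum>s\<in>UNIV. \<bar>A t0 i $ r $ s\<bar>)" for i
    by (intro sum_nonneg) auto
  have b: "norm (v i) \<le> b" "norm (om i) \<le> b" "\<bar>A t0 i $ r $ s\<bar> \<le> b - \<epsilon>" "b > 0" for i r s
  proof -
    have "norm (v i) \<ge> 0" "norm (om i) \<ge> 0"
      by simp_all
    then show "norm (v i) \<le> b" "norm (om i) \<le> b" "b > 0"
      using b_ge[of i] sum_nn[of i] \<epsilon> by linarith+
    have "\<bar>A t0 i $ r $ s\<bar> \<le> (\<Sum>s\<in>UNIV. \<bar>A t0 i $ r $ s\<bar>)"
      by (rule member_le_sum) auto
    also have "\<dots> \<le> (\<Sum>r\<in>UNIV. \<Sum>s\<in>UNIV. \<bar>A t0 i $ r $ s\<bar>)"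
      by (rule member_le_sum) (auto intro: sum_nonneg)
    finally show "\<bar>A t0 i $ r $ s\<bar> \<le> b - \<epsilon>"
      using b_ge[of i] \<open>norm (v i) \<ge> 0\<close> \<open>norm (om i) \<ge> 0\<close> by linarith
  qed
  interpret H: hyperbolic_family E S Q B v om b "2 / c ^ 7" \<delta> \<kappa>' R
  proof
    show "open S" "convex S" "S \<noteq> {}"
      using r by (auto simp: S_def)
    show "(\<lambda>z. Q z i j) holomorphic_on S" for i j
      using Q_holo S(1) by (rule holomorphic_on_subset)
    show "(\<lambda>z. B z i $ r $ s) holomorphic_on S" for i r s
      using B_holo S(1) by (rule holomorphic_on_subset)
    show "cmod (B z i $ r $ s) \<le> b" if "z \<in> S" for z i r s
    proof -
      have "cmod (B z i $ r $ s - of_real (A t0 i $ r $ s)) < \<epsilon>"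
        using near[OF that] by blast
      moreover have "cmod (B z i $ r $ s) \<le> cmod (B z i $ r $ s - of_real (A t0 i $ r $ s)) + \<bar>A t0 i $ r $ s\<bar>"
        using norm_triangle_sub[of "B z i $ r $ s" "of_real (A t0 i $ r $ s)"] by simp
      ultimately show ?thesis
        using b(3)[of i r s] by linarith
    qed
    show "word_entry (B z) v om u \<noteq> 0" if "z \<in> S" "adm E u" for z u
      using pw(1)[OF _ that(2,1)] that(2) by blast
    show "cmod (det (word_prod (B z) (butlast u))) \<le> 2 / c ^ 7 * \<kappa>' ^ (length u - 1) * (cmod (word_entry (B z) v om u))\<^sup>2"
      if "z \<in> S" "adm E u" for z u
      using pw(2)[OF _ that(2,1)] that(2) by blast
  qed (use near \<delta> b c rate R in \<open>auto intro: less_imp_le\<close>)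
  obtain F where F: "F holomorphic_on S"
    "\<And>z P. z \<in> S \<Longrightarrow> (\<And>i j. Q z i j = of_real (P i j)) \<Longrightarrow> irreducible_chain P \<Longrightarrow>
       (\<And>i j. P i j > 0 \<longleftrightarrow> (i, j) \<in> E) \<Longrightarrow>
       mean_log_ratio (stat_vec P) P (\<lambda>u. cmod (word_entry (B z) v om u)) \<longlonglongrightarrow> Re (F z)"
    using H.limit_function by blast
  \<comment> \<open>For real \<open>t\<close> in the disc the general limit applies with the same
    \<open>v\<close> and \<open>om\<close>; the hyperbolicity used at \<open>t\<close> is that of
    the word bounds inherited from \<open>t0\<close>.\<close>
  have lyap: "lyap_exp (A t) (P t) = Re (F (of_real t))" if t: "\<bar>t - t0\<bar> < r" for t
  proof (rule lyap_exp_eqI)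
    have t1: "\<bar>t - t0\<bar> < r1"
      using t r by linarith
    have tJ: "t \<in> J"
      by (rule in_J[OF t1])
    define z :: complex where "z = of_real t"
    have z: "z \<in> S"
      using t by (simp add: S_def z_def a_def dist_norm abs_minus_commute flip: of_real_diff)
    have Bz: "B z = (\<lambda>i. cmat (A t i))"
      using B_real[OF t1] by (simp add: z_def fun_eq_iff)
    show "irreducible_chain (P t)"
      by (rule chain[OF tJ])
    fix p \<mu> assume "markov_chain (P t) p \<mu>"
    then interpret markov_chain "P t" p \<mu> .
    have p: "p = stat_vec (P t)"
      using stationary stationary_vec_eq by blast
    have lim: "mean_log_ratio p (P t) (\<lambda>u. cmod (word_entry (B z) v om u)) \<longlonglongrightarrow> Re (F z)"
      unfolding p using F(2)[OF z _ chain[OF tJ]] Q_real[OF t1] P_support tJ by (simp add: z_def)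
    show "AE x in \<mu>. (\<lambda>n. ln (mnorm (mprod (A t) x n)) / real n) \<longlonglongrightarrow> Re (F (of_real t))"
      unfolding z_def[symmetric]
    proof (rule lyapunov_limit[OF _ _ _ _ _ lim])
      show "\<bar>log_ratio (\<lambda>u. cmod (word_entry (B z) v om u)) u - log_ratio (\<lambda>u. cmod (word_entry (B z) v om u)) (tl u)\<bar>
          \<le> 2 * H.K * \<kappa>' ^ length u" if "adm {(i, j). 0 < P t i j} u" "H.N \<le> length u" for u
        using that H.log_ratio_contraction[OF z] by (simp add: E_eq[OF tJ])
      show "\<bar>ln (mnorm (word_prod (A t) (butlast u))) - ln (cmod (word_entry (B z) v om u))\<bar>
          \<le> \<bar>ln (2 * (12 / c ^ 5))\<bar> + \<bar>ln (2 * b * b)\<bar>" if "adm {(i, j). 0 < P t i j} u" for u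
      proof -
        have u: "adm E u"
          using that by (simp add: E_eq[OF tJ])
        then have ne: "u \<noteq> []"
          by blast
        show ?thesis
          unfolding Bz
          by (rule ln_mnorm_word_entry)
            (use pw(1,3)[OF ne u z, unfolded Bz] c b in auto)
      qed
    qed (use rate H.K_nonneg in auto)
  qed
  show ?thesis
  proof (intro exI[of _ "{t. \<bar>t - t0\<bar> < r}"] conjI)
    show "open {t. \<bar>t - t0\<bar> < r}"
      by (intro open_Collect_less continuous_intros)
    show "{t. \<bar>t - t0\<bar> < r} \<subseteq> J"
      using in_J r by force
    show "real_analytic_on (\<lambda>t. lyap_exp (A t) (P t)) {t. \<bar>t - t0\<bar> < r}"
      by (rule real_analytic_on_Re_holomorphic[OF F(1)[unfolded S_def a_def]]) (rule lyap)
  qed (use r in simp)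
qed

end
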